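(* Assume that $Q(a,u)$ is $(a+1)$-positive, and that $Q'_2(a,\rho_Q(a))<\infty$ for $-1/3\le a\le 0$. Let $t_c$ be the radius of convergence of $S(t)=1/(1-S^{\bullet}(t))$. Then $t/(1+S^{\bullet}(t))^2$ is increasing on $[0,t_c]$, and on this interval $$\frac{t}{(1+S^{\bullet}(t))^2}\le \rho_Q(-S^{\bullet}(t)),$$ with equality if and only if $t=t_c$. Moreover $S^{\bullet}(t_c)\le 1/3$.
   Context: $Q(a,u)$ is the generating function of square lattice loops (steps $(\pm1,0),(0,\pm1)$, starting and ending at the origin) confined to the quadrant $\{x\ge0,y\ge0\}$, counted by half-length ($u$) and by the number of $\mathsf{NW}$ plus $\mathsf{ES}$ factors ($a$), where $\mathsf{NW}$ means a step $(0,1)$ immediately followed by $(-1,0)$ and $\mathsf{ES}$ a step $(1,0)$ immediately followed by $(0,-1)$. $Q$ is $(a+1)$-positive if $Q(a,u)=\sum_{n\ge0}u^nP_n(a+1)$ with every $P_n\in\mathbb{N}[x]$. For $a\ge-1$, $\rho_Q(a)$ denotes the radius of convergence of $u\mapsto Q(a,u)$, and $Q'_2=\partial Q/\partial u$. $S(t)=\sum s_nt^n$ where $s_n$ is the number of permutations of length $n$ producible by two parallel stacks (equivalently, canonical operation sequences of length $2n$), and $S^{\bullet}(t)$ is the generating function (by half-length) of primitive canonical operation sequences, i.e. those that are non-empty and not the concatenation of two non-empty operation sequences; one has $S=1/(1-S^{\bullet})$. Operation sequences: words over $\{I_1,I_2,O_1,O_2\}$ that are shuffles of a Dyck word on $\{I_1,O_1\}$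 and a Dyck word on $\{I_2,O_2\}$; canonical means containing no factor $I_1O_2$ or $I_2O_1$ and, in the associated arch system (arches joining input and output times of each item, above the line for stack 1, below for stack 2), the leftmost arch of each connected component of the crossing graph (arches of different colours with interleaving endpoints are adjacent) is above the line. *)

theory Defs
  imports
    "HOL-Analysis.Analysis"
    "HOL-Computational_Algebra.Polynomial"
    "HOL-Combinatorics.Multiset_Permutations"
    "HOL-Library.Sublist"
begin

section \<open>Quadrant loops on the square lattice\<close>

datatype step = North | East | South | West

fun displacement :: "step \<Rightarrow> int \<times> int" where
  "displacement North = (0, 1)"
| "displacement East = (1, 0)"
| "displacement South = (0, -1)"
| "displacement West = (-1, 0)"

definition endpoint :: "step list \<Rightarrow> int \<times> int" where
  "endpoint w = sum_list (map displacement w)"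

definition quadrant_loop :: "step list \<Rightarrow> bool" where
  "quadrant_loop w \<longleftrightarrow>
     (\<forall>k \<le> length w. fst (endpoint (take k w)) \<ge> 0 \<and> snd (endpoint (take k w)) \<ge> 0) \<and>
     endpoint w = (0, 0)"

definition NW_ES_factors :: "step list \<Rightarrow> nat" where
  "NW_ES_factors w =
     card {i. Suc i < length w \<and> (w ! i, w ! Suc i) \<in> {(North, West), (East, South)}}"

text \<open>The coefficient of \<open>u\<^sup>n\<close> in \<open>Q(a,u)\<close>, as a polynomial in \<open>a\<close>.\<close>

definition Q_coeff :: "nat \<Rightarrow> real poly" where
  "Q_coeff n = (\<Sum>w \<in> {w. quadrant_loop w \<and> length w = 2 * n}. monom 1 (NW_ES_factors w))"

definition Q_succ_positive :: bool where
  "Q_succ_positive \<longleftrightarrow>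
     (\<forall>n. \<exists>P :: real poly. (\<forall>k. coeff P k \<in> \<nat>) \<and> Q_coeff n = pcompose P [:1, 1:])"

definition rho_Q :: "real \<Rightarrow> ereal" where
  "rho_Q a = conv_radius (\<lambda>n. poly (Q_coeff n) a)"

text \<open>
  The partial derivative of \<open>Q\<close> in \<open>u\<close>, differentiated term by term and with values in the
  extended reals. It is only meant for those \<open>a\<close> where all coefficients are nonnegative and
  for \<open>u \<ge> 0\<close>; there the sum always exists, and it is infinite iff the series diverges.
\<close>

definition Q_deriv_u :: "real \<Rightarrow> ereal \<Rightarrow> ereal" where
  "Q_deriv_u a u = (\<Sum>n. ereal (diffs (\<lambda>k. poly (Q_coeff k) a) n) * u ^ n)"


section \<open>Permutations produced by two parallel stacks\<close>

text \<open>
  A state consists of the remaining input, the two stacks (head on top) and the output so far.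
\<close>

type_synonym state = "nat list \<times> nat list \<times> nat list \<times> nat list"

inductive move :: "state \<Rightarrow> state \<Rightarrow> bool" where
  push1: "move (x # inp, st1, st2, out) (inp, x # st1, st2, out)"
| push2: "move (x # inp, st1, st2, out) (inp, st1, x # st2, out)"
| pop1: "move (inp, x # st1, st2, out) (inp, st1, st2, out @ [x])"
| pop2: "move (inp, st1, x # st2, out) (inp, st1, st2, out @ [x])"

definition producible :: "nat list \<Rightarrow> bool" where
  "producible p \<longleftrightarrow> move\<^sup>*\<^sup>* ([1..<Suc (length p)], [], [], []) ([], [], [], p)"

definition s_coeff :: "nat \<Rightarrow> real" where
  "s_coeff n = real (card {p \<in> permutations_of_set {1..n}. producible p})"


section \<open>Operation sequences\<close>

datatype stack = Stack1 | Stack2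

datatype operation = In stack | Out stack

definition dyck_word :: "'a \<Rightarrow> 'a \<Rightarrow> 'a list \<Rightarrow> bool" where
  "dyck_word up down w \<longleftrightarrow>
     set w \<subseteq> {up, down} \<and>
     (\<forall>k \<le> length w. count_list (take k w) down \<le> count_list (take k w) up) \<and>
     count_list w up = count_list w down"

definition operation_sequence :: "operation list \<Rightarrow> bool" where
  "operation_sequence w \<longleftrightarrow>
     (\<exists>u v. dyck_word (In Stack1) (Out Stack1) u \<and> dyck_word (In Stack2) (Out Stack2) v \<and>
            w \<in> shuffles u v)"

text \<open>
  An arch \<open>(i, j)\<close> joins the position \<open>i\<close> at which an item enters a stack to the position \<open>j\<close>
  at which it leaves it, that is, to the matching output letter in the Dyck word of that stack.
\<close>

definition arch_of :: "operation list \<Rightarrow> stack \<Rightarrow> nat \<times> nat \<Rightarrow> bool" where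
  "arch_of w s = (\<lambda>(i, j). i < j \<and> j < length w \<and> w ! i = In s \<and> w ! j = Out s \<and>
     dyck_word (In s) (Out s)
       (filter (\<lambda>x. x \<in> {In s, Out s}) (take (j - Suc i) (drop (Suc i) w))))"

definition arch :: "operation list \<Rightarrow> nat \<times> nat \<Rightarrow> bool" where
  "arch w A \<longleftrightarrow> (\<exists>s. arch_of w s A)"

definition interleaving :: "nat \<times> nat \<Rightarrow> nat \<times> nat \<Rightarrow> bool" where
  "interleaving A B \<longleftrightarrow>
     fst A < fst B \<and> fst B < snd A \<and> snd A < snd B \<or>
     fst B < fst A \<and> fst A < snd B \<and> snd B < snd A"

definition crossing :: "operation list \<Rightarrow> nat \<times> nat \<Rightarrow> nat \<times> nat \<Rightarrow> bool" where
  "crossing w A B \<longleftrightarrow>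
     (\<exists>s s'. s \<noteq> s' \<and> arch_of w s A \<and> arch_of w s' B \<and> interleaving A B)"

text \<open>
  The last condition says that in each connected component of the crossing graph the arch
  with the smallest left endpoint is above the line, i.e. belongs to the first stack.
\<close>

definition canonical :: "operation list \<Rightarrow> bool" where
  "canonical w \<longleftrightarrow> operation_sequence w \<and>
     \<not> sublist [In Stack1, Out Stack2] w \<and> \<not> sublist [In Stack2, Out Stack1] w \<and>
     (\<forall>A. arch w A \<and> (\<forall>B. (crossing w)\<^sup>*\<^sup>* A B \<longrightarrow> fst A \<le> fst B) \<longrightarrow> arch_of w Stack1 A)"

definition primitive :: "operation list \<Rightarrow> bool" where
  "primitive w \<longleftrightarrow> w \<noteq> [] \<and>
     \<not> (\<exists>u v. operation_sequence u \<and> operation_sequence v \<and> u \<noteq> [] \<and> v \<noteq> [] \<and> w = u @ v)"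

definition s_prim_coeff :: "nat \<Rightarrow> real" where
  "s_prim_coeff n = real (card {w. canonical w \<and> primitive w \<and> length w = 2 * n})"

definition S_prim :: "real \<Rightarrow> real" where
  "S_prim t = (\<Sum>n. s_prim_coeff n * t ^ n)"

end

theory Submission
  imports Defs "HOL-Complex_Analysis.Complex_Analysis"
begin

text \<open>
  A loop becomes an operation sequence by reading North, South, East, West as \<open>I\<^sub>1\<close>, \<open>O\<^sub>1\<close>, \<open>I\<^sub>2\<close>, \<open>O\<^sub>2\<close>;
  then \<open>NW\<close> and \<open>ES\<close> are the factors \<open>I\<^sub>1O\<^sub>2\<close> and \<open>I\<^sub>2O\<^sub>1\<close> that canonical sequences avoid. A non-empty
  sequence is \<open>c\<^sub>1w\<^sub>1\<dots>c\<^sub>mw\<^sub>m\<close> for a unique irreducible word \<open>c\<^sub>1\<dots>c\<^sub>m\<close> (the connected component of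
  the first arch) and sequences \<open>w\<^sub>i\<close>. Hence one kernel \<open>K\<close> with nonnegative coefficients governs both
  series: \<open>Q - 1 = 2 K(1 - (1 - a)/Q, u Q\<^sup>2)\<close> and \<open>S - 1 = K(y, t S\<^sup>2)\<close> with \<open>y = S_prim t = 1 - 1/S\<close>.
  Comparing the two, \<open>Q(-y, t/(1+y)\<^sup>2) = 2 S - 1\<close> as long as the curve \<open>(a, u) = (-y, t/(1+y)\<^sup>2)\<close> stays
  below \<open>\<rho>\<^sub>Q\<close>. On such a stretch \<open>y \<le> 1/3\<close>, because \<open>(Q - 1)/(u Q\<^sup>2)\<close> increases with \<open>u\<close> whereas
  \<open>(q - 1)/q\<^sup>2\<close> decreases for \<open>q > 2\<close>.

  Suppose that the curve first meets \<open>\<rho>\<^sub>Q\<close> at some \<open>t < t\<^sub>c\<close>. For \<open>a\<close> on the curve slightly before,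
  convexity of \<open>K\<close> keeps \<open>Q(a, \<cdot>)\<close> inside the domain of the kernel up to \<open>\<rho>\<^sub>Q(a)\<close>. There
  \<open>Q'\<^sub>2 < \<infinity>\<close> makes the kernel equation uniquely solvable for \<open>Q\<close>, so that \<open>Q(a, \<cdot>)\<close> is analytic at
  \<open>\<rho>\<^sub>Q(a)\<close>, against Pringsheim's theorem. Likewise, if the curve were still below \<open>\<rho>\<^sub>Q\<close> at \<open>t\<^sub>c\<close>, then
  \<open>Q(-y, t/(1+y)\<^sup>2) = (1+y)/(1-y)\<close> could be solved for \<open>y\<close> and \<open>S\<close> would be analytic at \<open>t\<^sub>c\<close>.
\<close>

section \<open>Operation sequences as balanced words\<close>

text \<open>\<open>Q\<close> is expanded in \<open>b = 1 + a\<close>, where its coefficients are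
  nonnegative although \<open>a\<close> is negative on the curve; convergence then passes to all
  smaller \<open>b\<close> and \<open>u\<close>, and \<open>rho\<close> is antitone in
  \<open>b\<close>. Nor is the domain of the kernel known in advance: every box in which it is used
  comes from the convergence of \<open>S\<close> at some \<open>t\<close> below its radius, and
  \<open>Q\<close> must first be shown to stay inside such a box. The word sums give the kernel
  equation of \<open>Q\<close> only for \<open>u < 1/16\<close>; analytic continuation in
  \<open>u\<close> extends it as far as the box allows, and a second continuation, in
  \<open>t\<close>, carries \<open>Q = 2 S - 1\<close> along the curve. The bound 1/3 has one
  origin: \<open>(1 + y)/(1 - y)\<close> equals 2 exactly at \<open>y = 1/3\<close>. It also keeps
  \<open>a = -y\<close> in the interval where the derivative is assumed finite.\<close>

definition height :: "stack \<Rightarrow> operation list \<Rightarrow> int" where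
  "height s w = int (count_list w (In s)) - int (count_list w (Out s))"

lemma height_Nil [simp]: "height s [] = 0"
  and height_append [simp]: "height s (u @ v) = height s u + height s v"
  and height_Cons [simp]: "height s (x # w) =
    (if x = In s then 1 else if x = Out s then -1 else 0) + height s w"
  by (auto simp: height_def)

definition stack_balanced :: "stack \<Rightarrow> operation list \<Rightarrow> bool" where
  "stack_balanced s w \<longleftrightarrow> height s w = 0 \<and> (\<forall>k. 0 \<le> height s (take k w))"

definition balanced :: "operation list \<Rightarrow> bool" where
  "balanced w \<longleftrightarrow> (\<forall>s. stack_balanced s w)"

lemma stack_balanced_Nil [simp]: "stack_balanced s []"
  by (simp add: stack_balanced_def)

lemma balanced_Nil [simp]: "balanced []"
  by (simp add: balanced_def)

lemma stack_balanced_take: "stack_balanced s w \<Longrightarrow> w = u @ v \<Longrightarrow> 0 \<le> height s u"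
  unfolding stack_balanced_def by (metis append_eq_conv_conj)

lemma take_filter_prefix: "\<exists>j. take k (filter P w) = filter P (take j w)"
proof (induction w arbitrary: k)
  case (Cons x w)
  show ?case
  proof (cases "P x \<and> k > 0")
    case True
    then obtain k' where k: "k = Suc k'" by (cases k) auto
    obtain j where "take k' (filter P w) = filter P (take j w)" using Cons by blast
    then have "take k (filter P (x # w)) = filter P (take (Suc j) (x # w))" using True k by simp
    then show ?thesis by blast
  next
    case False
    show ?thesis
    proof (cases "k = 0")
      case True
      then show ?thesis by (intro exI[of _ 0]) simp
    next
      case k: False
      obtain j where "take k (filter P w) = filter P (take j w)" using Cons by blast
      then have "take k (filter P (x # w)) = filter P (take (Suc j) (x # w))" using False k by simp
      then show ?thesis by blast
    qed
  qed
qed auto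

lemma filter_take_prefix: "\<exists>j\<le>length (filter P w). filter P (take k w) = take j (filter P w)"
proof (intro exI conjI)
  have "filter P w = filter P (take k w) @ filter P (drop k w)"
    by (metis append_take_drop_id filter_append)
  then show "filter P (take k w) = take (length (filter P (take k w))) (filter P w)"
    "length (filter P (take k w)) \<le> length (filter P w)"
    by auto
qed

lemma count_list_filter: "P x \<Longrightarrow> count_list (filter P w) x = count_list w x"
  by (induction w) auto

text \<open>Prefixes of the filtered word are exactly the filtered prefixes, and the letters of the
  other stack do not change \<open>height s\<close>. Dyck conditions can thus be read on the
  shuffled word itself, both for operation sequences and for the word enclosed by an arch.\<close>

lemma dyck_word_filter_iff:
  "dyck_word (In s) (Out s) (filter (\<lambda>x. x \<in> {In s, Out s}) w) \<longleftrightarrow> stack_balanced s w"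
  (is "dyck_word _ _ (filter ?P w) \<longleftrightarrow> _")
proof -
  have c: "height s (filter ?P v) = height s v" for v
    by (simp add: height_def count_list_filter)
  have "dyck_word (In s) (Out s) (filter ?P w) \<longleftrightarrow>
      height s (filter ?P w) = 0 \<and> (\<forall>k\<le>length (filter ?P w). 0 \<le> height s (take k (filter ?P w)))"
    by (auto simp: dyck_word_def height_def)
  also have "\<dots> \<longleftrightarrow> height s w = 0 \<and> (\<forall>k. 0 \<le> height s (take k w))"
  proof -
    have "0 \<le> height s (take k w)" if "\<forall>k\<le>length (filter ?P w). 0 \<le> height s (take k (filter ?P w))" for k
      using that filter_take_prefix[of ?P w k] by (metis c)
    moreover have "0 \<le> height s (take k (filter ?P w))" if "\<forall>k. 0 \<le> height s (take k w)" for k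
      using that take_filter_prefix[of k ?P w] by (metis c)
    ultimately show ?thesis using c by auto
  qed
  finally show ?thesis by (simp add: stack_balanced_def)
qed

lemma operation_sequence_iff_balanced: "operation_sequence w \<longleftrightarrow> balanced w"
proof
  let ?P = "\<lambda>s x. x \<in> {In s, Out s}"
  have neg: "(\<lambda>x. \<not> ?P Stack1 x) = ?P Stack2"
  proof
    fix x show "(\<not> ?P Stack1 x) = ?P Stack2 x"
      by (cases x; rename_tac s; case_tac s) auto
  qed
  {
    assume "operation_sequence w"
    then obtain u v where u: "dyck_word (In Stack1) (Out Stack1) u"
      and v: "dyck_word (In Stack2) (Out Stack2) v" and w: "w \<in> shuffles u v"
      unfolding operation_sequence_def by blast
    have su: "set u \<subseteq> {In Stack1, Out Stack1}" and sv: "set v \<subseteq> {In Stack2, Out Stack2}"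
      using u v by (auto simp: dyck_word_def)
    have fu: "filter (?P Stack1) u = u" "filter (?P Stack1) v = []"
         "filter (?P Stack2) v = v" "filter (?P Stack2) u = []"
      using su sv by (auto simp: filter_id_conv filter_empty_conv)
    have fs: "filter P w \<in> shuffles (filter P u) (filter P v)" for P
      using w filter_shuffles[of P u v] by blast
    have "filter (?P Stack1) w = u" "filter (?P Stack2) w = v"
      using fs[of "?P Stack1"] fs[of "?P Stack2"] unfolding fu by auto
    then have "stack_balanced s w" for s
      using u v dyck_word_filter_iff[of s w] by (cases s) auto
    then show "balanced w" by (simp add: balanced_def)
  next
    assume "balanced w"
    then have "dyck_word (In s) (Out s) (filter (?P s) w)" for s
      unfolding dyck_word_filter_iff by (simp add: balanced_def)
    moreover have "w \<in> shuffles (filter (?P Stack1) w) (filter (?P Stack2) w)"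
      using partition_in_shuffles[of w "?P Stack1"] unfolding neg .
    ultimately show "operation_sequence w" unfolding operation_sequence_def by blast
  }
qed

text \<open>Both \<open>x\<close> and \<open>y\<close> are prefixes of balanced words, so their
  heights are nonnegative; they add up to 0, hence all heights vanish. Uniqueness of the
  decomposition rests on this overlap property.\<close>

lemma stack_balanced_overlap:
  assumes "stack_balanced s (x @ y)" "stack_balanced s (y @ z)"
  shows "stack_balanced s x" "stack_balanced s y" "stack_balanced s z"
proof -
  have hx: "height s x \<ge> 0" and hy: "height s y \<ge> 0"
    using assms stack_balanced_take by blast+
  have s1: "height s x + height s y = 0" and s2: "height s y + height s z = 0"
    using assms by (auto simp: stack_balanced_def)
  have h: "height s x = 0" "height s y = 0" "height s z = 0" using hx hy s1 s2 by auto
  have "0 \<le> height s (take k x)" "0 \<le> height s (take k y)" for k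
    using stack_balanced_take[OF assms(1), of "take k x" "drop k x @ y"]
      stack_balanced_take[OF assms(2), of "take k y" "drop k y @ z"]
    by (metis append_assoc append_take_drop_id)+
  moreover have "0 \<le> height s (take k z)" for k
    using stack_balanced_take[OF assms(2), of "y @ take k z" "drop k z"] h by simp
  ultimately show "stack_balanced s x" "stack_balanced s y" "stack_balanced s z"
    using h by (auto simp: stack_balanced_def)
qed

lemma stack_balanced_insert:
  assumes f: "stack_balanced s f"
  shows "stack_balanced s (p @ f @ q) \<longleftrightarrow> stack_balanced s (p @ q)"
proof
  assume a: "stack_balanced s (p @ f @ q)"
  have "0 \<le> height s (take k (p @ q))" for k
  proof (cases "k \<le> length p")
    case True
    then show ?thesis using a[unfolded stack_balanced_def, THEN conjunct2, rule_format, of k] by simp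
  next
    case False
    then show ?thesis using a[unfolded stack_balanced_def, THEN conjunct2, rule_format, of "k + length f"] f
      by (simp add: stack_balanced_def)
  qed
  then show "stack_balanced s (p @ q)" using a f by (simp add: stack_balanced_def)
next
  assume a: "stack_balanced s (p @ q)"
  have "0 \<le> height s (take k (p @ f @ q))" for k
  proof (cases "k \<le> length p")
    case True
    then show ?thesis using a[unfolded stack_balanced_def, THEN conjunct2, rule_format, of k] by simp
  next
    case k: False
    show ?thesis
    proof (cases "k \<le> length p + length f")
      case True
      have "0 \<le> height s p" using a stack_balanced_take by blast
      then show ?thesis using k True f by (simp add: stack_balanced_def)
    next
      case False
      then show ?thesis
        using a[unfolded stack_balanced_def, THEN conjunct2, rule_format, of "k - length f"] f k
        by (simp add: stack_balanced_def) (metis diff_commute diff_diff_left)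
    qed
  qed
  then show "stack_balanced s (p @ f @ q)" using a f by (simp add: stack_balanced_def)
qed

lemma balanced_overlap:
  assumes "balanced (x @ y)" "balanced (y @ z)"
  shows "balanced x" "balanced y" "balanced z"
  using assms stack_balanced_overlap unfolding balanced_def by blast+

lemma balanced_insert: "balanced f \<Longrightarrow> balanced (p @ f @ q) \<longleftrightarrow> balanced (p @ q)"
  unfolding balanced_def using stack_balanced_insert by blast

lemma balanced_append: "balanced u \<Longrightarrow> balanced v \<Longrightarrow> balanced (u @ v)"
  using balanced_insert[of v u "[]"] by simp

lemma balanced_cancel_left: "balanced u \<Longrightarrow> balanced (u @ v) \<Longrightarrow> balanced v"
  using balanced_insert[of u "[]" v] by simp

lemma balanced_hd:
  assumes "balanced w" "w \<noteq> []"
  obtains s where "hd w = In s"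
proof (cases "hd w")
  case (Out s)
  then have "height s (take 1 w) = -1" using assms(2) by (cases w) auto
  then show ?thesis using assms(1) by (auto simp: balanced_def stack_balanced_def dest!: spec[of _ s] spec[of _ 1])
qed (use that in blast)

lemma balanced_last:
  assumes "balanced w" "w \<noteq> []"
  obtains s where "last w = Out s"
proof (cases "last w")
  case (In s)
  have "height s w = height s (butlast w) + height s [last w]"
    using assms(2) by (metis append_butlast_last_id height_append)
  then have "height s (butlast w) = -1" using assms(1) In by (simp add: balanced_def stack_balanced_def)
  moreover have "butlast w = take (length w - 1) w" by (simp add: butlast_conv_take)
  ultimately show ?thesis using assms(1) unfolding balanced_def stack_balanced_def by (metis neg_0_le_iff_le not_one_le_zero)
qed (use that in blast)

lemma balanced_even_length:
  assumes "balanced w"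
  shows "even (length w)"
proof -
  have l: "int (length w) = (\<Sum>s\<in>{Stack1, Stack2}. int (count_list w (In s)) + int (count_list w (Out s)))" for w
  proof (induction w)
    case (Cons x w)
    then show ?case by (cases x; rename_tac s; case_tac s) auto
  qed auto
  have "int (count_list w (In s)) = int (count_list w (Out s))" for s
    using assms by (simp add: balanced_def stack_balanced_def height_def)
  then have "int (length w) = 2 * (\<Sum>s\<in>{Stack1, Stack2}. int (count_list w (In s)))"
    unfolding l by simp
  then show ?thesis by presburger
qed


section \<open>Decomposition along the first connected component\<close>

text \<open>Requiring \<open>p \<noteq> []\<close> exempts only \<open>f = c\<close>: a proper
  non-empty balanced prefix would leave a non-empty balanced suffix. In terms of arches these are
  the connected systems; the direction needed later is
  \<open>irreducible_word_connected\<close>.\<close>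

definition irreducible_word :: "operation list \<Rightarrow> bool" where
  "irreducible_word c \<longleftrightarrow> balanced c \<and> c \<noteq> [] \<and>
     (\<forall>p f q. c = p @ f @ q \<and> p \<noteq> [] \<and> balanced f \<longrightarrow> f = [])"

text \<open>A gap follows every letter, also the last one, whereas none precedes the first: a word
  starts with the first letter of its first component.\<close>

fun interlace :: "(operation \<times> operation list) list \<Rightarrow> operation list" where
  "interlace [] = []"
| "interlace ((x, g) # zs) = x # g @ interlace zs"

lemma interlace_append [simp]: "interlace (xs @ ys) = interlace xs @ interlace ys"
  by (induction xs rule: interlace.induct) auto

lemma interlace_Nil_iff [simp]: "interlace zs = [] \<longleftrightarrow> zs = []"
  by (cases zs rule: interlace.cases) auto

definition decomposition :: "(operation \<times> operation list) list \<Rightarrow> bool" where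
  "decomposition zs \<longleftrightarrow> irreducible_word (map fst zs) \<and> (\<forall>g\<in>set (map snd zs). balanced g)"

lemma balanced_interlace:
  assumes "\<forall>g\<in>set (map snd zs). balanced g"
  shows "balanced (p @ interlace zs) \<longleftrightarrow> balanced (p @ map fst zs)"
  using assms
proof (induction zs arbitrary: p rule: interlace.induct)
  case (2 x g zs)
  have "balanced (p @ interlace ((x, g) # zs)) \<longleftrightarrow> balanced ((p @ [x]) @ interlace zs)"
    using balanced_insert[of g "p @ [x]" "interlace zs"] 2 by simp
  also have "\<dots> \<longleftrightarrow> balanced ((p @ [x]) @ map fst zs)" using 2 by (subst "2.IH") auto
  finally show ?case by simp
qed simp

text \<open>A cut after the first letter lies in some gap or at the border of one, so the inserted
  balanced factor is absorbed by that gap and the skeleton stays the same.\<close>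

lemma interlace_insert:
  assumes "interlace zs = p @ q" "p \<noteq> []" "balanced f" "\<forall>g\<in>set (map snd zs). balanced g"
  shows "\<exists>zs'. interlace zs' = p @ f @ q \<and> map fst zs' = map fst zs \<and> (\<forall>g\<in>set (map snd zs'). balanced g)"
  using assms
proof (induction zs arbitrary: p rule: interlace.induct)
  case (2 x g zs)
  then obtain p' where p: "p = x # p'" and e: "g @ interlace zs = p' @ q"
    by (cases p) auto
  show ?case
  proof (cases "\<exists>r. g = p' @ r \<and> q = r @ interlace zs")
    case True
    then obtain r where r: "g = p' @ r" "q = r @ interlace zs" by blast
    have "balanced (p' @ f @ r)" using balanced_insert[OF 2(4), of p' r] r 2 by simp
    then show ?thesis using 2 p r by (intro exI[of _ "(x, p' @ f @ r) # zs"]) auto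
  next
    case False
    then obtain r where r: "p' = g @ r" "interlace zs = r @ q"
      using e unfolding append_eq_append_conv2 by metis
    have "r \<noteq> []" using False r by auto
    then obtain zs' where "interlace zs' = r @ f @ q" "map fst zs' = map fst zs"
       "\<forall>g\<in>set (map snd zs'). balanced g" using 2(1)[OF r(2)] 2 by auto
    then show ?thesis using 2 p r by (intro exI[of _ "(x, g) # zs'"]) auto
  qed
qed auto

text \<open>If the word is not irreducible, remove a non-empty balanced factor that does not start
  it, decompose the shorter word, and put the factor back into a gap.\<close>

lemma decomposition_exists:
  assumes "balanced w" "w \<noteq> []"
  shows "\<exists>zs. decomposition zs \<and> interlace zs = w"
  using assms
proof (induction w rule: length_induct)
  case (1 w)
  show ?case
  proof (cases "irreducible_word w")
    case True
    have "interlace (map (\<lambda>x. (x, [])) w) = w" by (induction w) auto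
    then show ?thesis using True
      by (intro exI[of _ "map (\<lambda>x. (x, [])) w"]) (auto simp: decomposition_def o_def)
  next
    case False
    then obtain p f q where w: "w = p @ f @ q" "p \<noteq> []" "balanced f" "f \<noteq> []"
      using 1(2,3) unfolding irreducible_word_def by blast
    have "balanced (p @ q)" using w 1 balanced_insert by blast
    then obtain zs where "decomposition zs" "interlace zs = p @ q"
      using 1(1)[rule_format, of "p @ q"] w by auto
    then show ?thesis using interlace_insert[of zs p q f] w
      unfolding decomposition_def by metis
  qed
qed

text \<open>The tail of an irreducible word has this property and, unlike irreducibility, it passes
  on to further tails, as the induction over a decomposition needs.\<close>

definition factor_free :: "operation list \<Rightarrow> bool" where
  "factor_free c \<longleftrightarrow> (\<forall>p f q. c = p @ f @ q \<and> balanced f \<longrightarrow> f = [])"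

lemma factor_free_Cons: "factor_free (x # c) \<Longrightarrow> factor_free c"
  unfolding factor_free_def by (metis append_Cons)

lemma irreducible_word_tl: "irreducible_word (x # c) \<Longrightarrow> factor_free c"
  unfolding factor_free_def irreducible_word_def by (metis append_Cons list.distinct(1))

lemma interlace_prefix:
  assumes "interlace zs = h @ r" "h \<noteq> []"
  shows "\<exists>zs1 x p g' zs2. zs = zs1 @ (x, p @ g') # zs2 \<and> h = interlace zs1 @ x # p"
  using assms
proof (induction zs arbitrary: h rule: interlace.induct)
  case (2 x g zs)
  then obtain h' where h: "h = x # h'" and e: "g @ interlace zs = h' @ r"
    by (cases h) auto
  show ?case
  proof (cases "\<exists>r'. g = h' @ r'")
    case True
    then obtain r' where "g = h' @ r'" by blast
    then show ?thesis using h by (intro exI[of _ "[]"]) auto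
  next
    case False
    then obtain r' where r: "h' = g @ r'" "interlace zs = r' @ r"
      using e unfolding append_eq_append_conv2 by metis
    have "r' \<noteq> []" using False r by auto
    then obtain zs1 y p g' zs2 where "zs = zs1 @ (y, p @ g') # zs2" "r' = interlace zs1 @ y # p"
      using 2(1)[OF r(2)] by blast
    then show ?thesis using h r by (intro exI[of _ "(x, g) # zs1"]) auto
  qed
qed auto

text \<open>The prefix \<open>h\<close> ends inside some gap, after a part \<open>p\<close> of it.
  Since \<open>p\<close> begins a balanced gap and ends the balanced word \<open>h\<close>, the
  overlap property makes the part of \<open>h\<close> before \<open>p\<close> balanced; deleting the
  complete gaps leaves a non-empty balanced factor of the skeleton.\<close>

lemma interlace_no_balanced_prefix:
  assumes "factor_free (map fst zs)" "\<forall>g\<in>set (map snd zs). balanced g"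
    "interlace zs = h @ r" "balanced h"
  shows "h = []"
proof (rule ccontr)
  assume "h \<noteq> []"
  then obtain zs1 x p g' zs2 where z: "zs = zs1 @ (x, p @ g') # zs2" "h = interlace zs1 @ x # p"
    using interlace_prefix assms(3) by blast
  have b: "balanced (p @ g')" "\<forall>g\<in>set (map snd zs1). balanced g" using assms(2) z by auto
  have "balanced ((interlace zs1 @ [x]) @ p)" using assms(4) z by simp
  then have "balanced (interlace zs1 @ [x])" using balanced_overlap(1) b(1) by blast
  then have "balanced ([] @ interlace (zs1 @ [(x, [])]))" by simp
  then have "balanced (map fst zs1 @ [x])"
    by (subst (asm) balanced_interlace) (use b in auto)
  moreover have "map fst zs = [] @ (map fst zs1 @ [x]) @ map fst zs2" using z by simp
  ultimately show False using assms(1) unfolding factor_free_def by blast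
qed

text \<open>The longer gap is the shorter one followed by some \<open>h\<close>; then
  \<open>h\<close> is balanced and begins what follows the shorter gap, so it is empty.\<close>

lemma interlace_gap_eq:
  assumes "factor_free (map fst zs)" "\<forall>h\<in>set (map snd zs). balanced h"
    "factor_free (map fst zs')" "\<forall>h\<in>set (map snd zs'). balanced h"
    "balanced g" "balanced g'" "g @ interlace zs = g' @ interlace zs'"
  shows "g = g'"
proof -
  have *: "h = []" if "factor_free (map fst zs)" "\<forall>h\<in>set (map snd zs). balanced h"
    "balanced g" "balanced (g @ h)" "interlace zs = h @ r" for zs g h r
    using interlace_no_balanced_prefix that balanced_cancel_left by metis
  from assms(7) show ?thesis unfolding append_eq_append_conv2 using assms *
    by (metis append_Nil2)
qed

lemma interlace_inj_aux:
  assumes "factor_free (map fst zs)" "\<forall>h\<in>set (map snd zs). balanced h"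
    "factor_free (map fst zs')" "\<forall>h\<in>set (map snd zs'). balanced h" "interlace zs = interlace zs'"
  shows "zs = zs'"
  using assms
proof (induction zs arbitrary: zs' rule: interlace.induct)
  case 1
  then show ?case by (metis interlace_Nil_iff)
next
  case (2 x g zs)
  then obtain g' zs1 where z: "zs' = (x, g') # zs1" and e: "g @ interlace zs = g' @ interlace zs1"
    by (cases zs' rule: interlace.cases) auto
  have f: "factor_free (map fst zs)" "factor_free (map fst zs1)"
    using 2(2,4) z factor_free_Cons by (force, force)
  have b: "\<forall>h\<in>set (map snd zs). balanced h" "\<forall>h\<in>set (map snd zs1). balanced h" "balanced g" "balanced g'"
    using 2(3,5) z by auto
  have g: "g = g'" using interlace_gap_eq[OF f(1) b(1) f(2) b(2-4) e] .
  then have "zs = zs1" using 2(1)[OF f(1) b(1) f(2) b(2)] e by simp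
  then show ?case using g z by simp
qed

lemma interlace_inj:
  assumes "decomposition zs" "decomposition zs'" "interlace zs = interlace zs'"
  shows "zs = zs'"
proof -
  obtain x g ys where z: "zs = (x, g) # ys"
    using assms(1) by (cases zs) (auto simp: decomposition_def irreducible_word_def)
  obtain x' g' ys' where z': "zs' = (x', g') # ys'"
    using assms(2) by (cases zs') (auto simp: decomposition_def irreducible_word_def)
  have f: "factor_free (map fst ys)" "factor_free (map fst ys')"
    using assms z z' irreducible_word_tl by (auto simp: decomposition_def)
  have b: "\<forall>h\<in>set (map snd ys). balanced h" "\<forall>h\<in>set (map snd ys'). balanced h" "balanced g" "balanced g'"
    using assms z z' by (auto simp: decomposition_def)
  have e: "x = x'" "g @ interlace ys = g' @ interlace ys'" using assms z z' by auto
  have "g = g'" using interlace_gap_eq[OF f(1) b(1) f(2) b(2-4) e(2)] .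
  then show ?thesis using interlace_inj_aux[OF f(1) b(1) f(2) b(2)] e z z' by simp
qed

lemma bij_betw_interlace:
  "bij_betw interlace {zs. decomposition zs} {w. balanced w \<and> w \<noteq> []}"
proof (rule bij_betw_imageI)
  show "inj_on interlace {zs. decomposition zs}" using interlace_inj by (auto simp: inj_on_def)
  have "balanced (interlace zs)" "interlace zs \<noteq> []" if "decomposition zs" for zs
    using balanced_interlace[of zs "[]"] that
    by (auto simp: decomposition_def irreducible_word_def)
  then show "interlace ` {zs. decomposition zs} = {w. balanced w \<and> w \<noteq> []}"
    using decomposition_exists by force
qed

section \<open>Mismatched factors\<close>

definition mismatch :: "operation \<Rightarrow> operation \<Rightarrow> bool" where
  "mismatch x y \<longleftrightarrow> (\<exists>s s'. x = In s \<and> y = Out s' \<and> s \<noteq> s')"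

text \<open>The final \<open>False\<close> gives one flag per letter, so that the flags line up with
  the gaps of a decomposition; what follows the last letter of the skeleton creates no mismatch with
  it.\<close>

fun mismatch_flags :: "operation list \<Rightarrow> bool list" where
  "mismatch_flags [] = []"
| "mismatch_flags [x] = [False]"
| "mismatch_flags (x # y # w) = mismatch x y # mismatch_flags (y # w)"

definition mismatches :: "operation list \<Rightarrow> nat" where
  "mismatches w = count_list (mismatch_flags w) True"

lemma length_mismatch_flags [simp]: "length (mismatch_flags w) = length w"
  by (induction w rule: mismatch_flags.induct) auto

lemma mismatches_Nil [simp]: "mismatches [] = 0"
  by (simp add: mismatches_def)

lemma mismatches_Cons:
  "mismatches (x # w) = (if w \<noteq> [] \<and> mismatch x (hd w) then 1 else 0) + mismatches w"
  by (cases w) (auto simp: mismatches_def)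

lemma mismatches_append:
  "mismatches (u @ v) = mismatches u + mismatches v +
     (if u \<noteq> [] \<and> v \<noteq> [] \<and> mismatch (last u) (hd v) then 1 else 0)"
  by (induction u) (auto simp: mismatches_Cons)

lemma mismatches_le_length: "mismatches w \<le> length w"
  unfolding mismatches_def by (metis count_le_length length_mismatch_flags)

lemma mismatch_Out [simp]: "\<not> mismatch (Out s) y" "\<not> mismatch x (In s)"
  by (auto simp: mismatch_def)

text \<open>A non-empty balanced word begins with an input and ends with an output, so no mismatch
  can straddle either of its borders.\<close>

lemma mismatches_balanced_between:
  assumes "balanced g"
  shows "mismatches (x # g @ v) =
    (if g = [] then (if v \<noteq> [] \<and> mismatch x (hd v) then 1 else 0) else mismatches g) + mismatches v"
proof (cases "g = []")
  case False
  obtain s s' where "hd g = In s" "last g = Out s'"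
    using balanced_hd balanced_last assms False by metis
  then show ?thesis using False by (simp add: mismatches_Cons mismatches_append)
qed (simp add: mismatches_Cons)

lemma mismatches_append_balanced:
  assumes "balanced u"
  shows "mismatches (u @ v) = mismatches u + mismatches v"
proof (cases "u = []")
  case False
  then obtain s where "last u = Out s" using balanced_last assms by metis
  then show ?thesis by (simp add: mismatches_append)
qed simp

lemma hd_interlace: "zs \<noteq> [] \<Longrightarrow> hd (interlace zs) = fst (hd zs)"
  by (cases zs) auto

text \<open>A mismatch between neighbouring letters of the skeleton survives exactly when the gap
  between them is empty; all other mismatches lie inside a gap.\<close>

lemma mismatches_interlace:
  assumes "\<forall>g\<in>set (map snd zs). balanced g"
  shows "mismatches (interlace zs) =
    (\<Sum>(b, g) \<leftarrow> zip (mismatch_flags (map fst zs)) (map snd zs).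
       if g = [] then of_bool b else mismatches g)"
  using assms
proof (induction zs rule: interlace.induct)
  case (2 x g zs)
  show ?case
  proof (cases zs)
    case Nil
    then show ?thesis using 2 mismatches_balanced_between[of g x "[]"] by simp
  next
    case (Cons z zs')
    then show ?thesis using 2 mismatches_balanced_between[of g x "interlace zs"]
      by (auto simp: hd_interlace)
  qed
qed simp

section \<open>Quadrant loops as balanced words\<close>

fun op_of_step :: "step \<Rightarrow> operation" where
  "op_of_step North = In Stack1"
| "op_of_step South = Out Stack1"
| "op_of_step East = In Stack2"
| "op_of_step West = Out Stack2"

lemma bij_op_of_step: "bij op_of_step"
proof (rule bijI)
  show "inj op_of_step"
  proof (rule injI)
    fix x y show "op_of_step x = op_of_step y \<Longrightarrow> x = y" by (cases x; cases y) auto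
  qed
  show "surj op_of_step"
  proof (rule surjI)
    fix x show "op_of_step (case x of In Stack1 \<Rightarrow> North | In Stack2 \<Rightarrow> East | Out Stack1 \<Rightarrow> South
      | Out Stack2 \<Rightarrow> West) = x"
      by (auto split: operation.splits stack.splits)
  qed
qed

lemma endpoint_eq_height:
  "endpoint w = (height Stack2 (map op_of_step w), height Stack1 (map op_of_step w))"
proof (induction w)
  case (Cons x w)
  then show ?case by (cases x) (auto simp: endpoint_def)
qed (simp add: endpoint_def zero_prod_def)

lemma stack_all: "(\<forall>s. P s) \<longleftrightarrow> P Stack1 \<and> P Stack2"
  by (metis stack.exhaust)

lemma quadrant_loop_iff: "quadrant_loop w \<longleftrightarrow> balanced (map op_of_step w)"
proof -
  have "(\<forall>k. 0 \<le> height s (take k u)) \<longleftrightarrow> (\<forall>k\<le>length u. 0 \<le> height s (take k u))" for s u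
    by (metis nat_le_linear take_all)
  from this[of _ "map op_of_step w"]
  have "(\<forall>k. 0 \<le> height s (take k (map op_of_step w))) \<longleftrightarrow>
      (\<forall>k\<le>length w. 0 \<le> height s (map op_of_step (take k w)))" for s
    by (simp add: take_map)
  then show ?thesis
    by (auto simp: quadrant_loop_def balanced_def stack_balanced_def endpoint_eq_height stack_all)
qed

lemma nth_mismatch_flags:
  "i < length w \<Longrightarrow> mismatch_flags w ! i \<longleftrightarrow> Suc i < length w \<and> mismatch (w ! i) (w ! Suc i)"
proof (induction w arbitrary: i rule: mismatch_flags.induct)
  case (3 x y w)
  then show ?case by (cases i) auto
qed auto

lemma NW_ES_factors_eq: "NW_ES_factors w = mismatches (map op_of_step w)"
proof -
  have m: "(x, y) \<in> {(North, West), (East, South)} \<longleftrightarrow> mismatch (op_of_step x) (op_of_step y)" for x y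
    by (cases x; cases y) (auto simp: mismatch_def)
  have "mismatches (map op_of_step w) = card {i. i < length w \<and> mismatch_flags (map op_of_step w) ! i = True}"
    unfolding mismatches_def count_list_eq_length_filter length_filter_conv_card by simp
  also have "{i. i < length w \<and> mismatch_flags (map op_of_step w) ! i = True} =
      {i. Suc i < length w \<and> (w ! i, w ! Suc i) \<in> {(North, West), (East, South)}}"
    unfolding m by (auto simp: nth_mismatch_flags)
  finally show ?thesis by (simp add: NW_ES_factors_def)
qed

lemma Q_coeff_eq:
  "Q_coeff n = (\<Sum>w | balanced w \<and> length w = 2 * n. monom 1 (mismatches w))"
proof -
  have "bij_betw (map op_of_step) {w. quadrant_loop w \<and> length w = 2 * n} {w. balanced w \<and> length w = 2 * n}"
  proof (rule bij_betw_imageI)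
    show "inj_on (map op_of_step) {w. quadrant_loop w \<and> length w = 2 * n}"
      using bij_op_of_step by (metis bij_is_inj inj_mapI inj_on_subset subset_UNIV)
    have "\<exists>v. w = map op_of_step v" for w
      using bij_op_of_step by (metis ex_map_conv bij_is_surj surjD)
    then have "w \<in> map op_of_step ` {w. quadrant_loop w \<and> length w = 2 * n}"
      if "balanced w" "length w = 2 * n" for w
      using that by (metis (mono_tags, lifting) image_eqI length_map mem_Collect_eq quadrant_loop_iff)
    then show "map op_of_step ` {w. quadrant_loop w \<and> length w = 2 * n} = {w. balanced w \<and> length w = 2 * n}"
      by (auto simp: quadrant_loop_iff)
  qed
  from sum.reindex_bij_betw[OF this, of "\<lambda>w. monom 1 (mismatches w)"]
  show ?thesis unfolding Q_coeff_def NW_ES_factors_eq .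
qed

lemma not_sublist_iff_mismatches:
  "\<not> sublist [In Stack1, Out Stack2] w \<and> \<not> sublist [In Stack2, Out Stack1] w \<longleftrightarrow> mismatches w = 0"
proof (induction w rule: mismatch_flags.induct)
  case (3 x y w)
  have "mismatch x y \<longleftrightarrow> x = In Stack1 \<and> y = Out Stack2 \<or> x = In Stack2 \<and> y = Out Stack1"
  proof (cases x; cases y)
    fix s s' assume "x = In s" "y = Out s'"
    then show ?thesis by (cases s; cases s') (auto simp: mismatch_def)
  qed (auto simp: mismatch_def)
  moreover have "sublist [a, b] (x # y # w) \<longleftrightarrow> a = x \<and> b = y \<or> sublist [a, b] (y # w)" for a b
    by (subst sublist_Cons_right) auto
  ultimately show ?case using 3 by (auto simp: mismatches_Cons)
next
  case (2 x)
  then show ?case by (auto simp: mismatches_def dest: sublist_length_le)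
qed (auto simp: mismatches_def dest: sublist_length_le)


section \<open>Arches\<close>

text \<open>The arch opened at \<open>i\<close> is closed by the step that first brings the height
  back to its value before \<open>i\<close>; until then the height stays at least one above that
  value.\<close>

lemma arch_of_iff:
  "arch_of w s (i, j) \<longleftrightarrow> i < j \<and> j < length w \<and> w ! i = In s \<and> w ! j = Out s \<and>
     height s (take j w) = height s (take i w) + 1 \<and>
     (\<forall>m. i < m \<and> m \<le> j \<longrightarrow> height s (take i w) + 1 \<le> height s (take m w))"
proof -
  have inner: "stack_balanced s (take (j - Suc i) (drop (Suc i) w)) \<longleftrightarrow>
     height s (take j w) = height s (take i w) + 1 \<and>
     (\<forall>m. i < m \<and> m \<le> j \<longrightarrow> height s (take i w) + 1 \<le> height s (take m w))"
    if ij: "i < j" "j < length w" "w ! i = In s"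
  proof -
    have h: "height s (take (Suc i + k) w) = height s (take i w) + 1 + height s (take k (drop (Suc i) w))" for k
      using ij by (simp only: take_add height_append) (simp add: take_Suc_conv_app_nth)
    have hj: "height s (take j w) = height s (take i w) + 1 + height s (take (j - Suc i) (drop (Suc i) w))"
      using h[of "j - Suc i"] ij by simp
    have tk: "take k (take (j - Suc i) (drop (Suc i) w)) = take (min k (j - Suc i)) (drop (Suc i) w)" for k
      by simp
    have "stack_balanced s (take (j - Suc i) (drop (Suc i) w)) \<longleftrightarrow>
      height s (take (j - Suc i) (drop (Suc i) w)) = 0 \<and>
      (\<forall>k\<le>j - Suc i. 0 \<le> height s (take k (drop (Suc i) w)))"
    proof -
      have "(\<forall>k. P (min k n)) \<longleftrightarrow> (\<forall>k\<le>n. P k)" for P and n :: nat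
        by (metis min.absorb1 min.cobounded2)
      from this[of "\<lambda>m. 0 \<le> height s (take m (drop (Suc i) w))" "j - Suc i"]
      show ?thesis unfolding stack_balanced_def tk by blast
    qed
    also have "\<dots> \<longleftrightarrow> height s (take j w) = height s (take i w) + 1 \<and>
      (\<forall>k\<le>j - Suc i. height s (take i w) + 1 \<le> height s (take (Suc i + k) w))"
      unfolding hj h by auto
    also have "(\<forall>k\<le>j - Suc i. height s (take i w) + 1 \<le> height s (take (Suc i + k) w)) \<longleftrightarrow>
      (\<forall>m. i < m \<and> m \<le> j \<longrightarrow> height s (take i w) + 1 \<le> height s (take m w))"
    proof (intro iffI allI impI)
      fix m assume a: "\<forall>k\<le>j - Suc i. height s (take i w) + 1 \<le> height s (take (Suc i + k) w)" "i < m \<and> m \<le> j"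
      have "m = Suc i + (m - Suc i)" "m - Suc i \<le> j - Suc i" using a(2) by auto
      then show "height s (take i w) + 1 \<le> height s (take m w)" using a(1) by metis
    qed (use ij in auto)
    finally show ?thesis .
  qed
  show ?thesis unfolding arch_of_def dyck_word_filter_iff prod.case using inner by blast
qed

lemma height_Suc:
  "i < length w \<Longrightarrow> height s (take (Suc i) w) =
     height s (take i w) + (if w ! i = In s then 1 else if w ! i = Out s then -1 else 0)"
  by (simp add: take_Suc_conv_app_nth)

lemma arch_of_height_end: "arch_of w s (i, j) \<Longrightarrow> height s (take (Suc j) w) = height s (take i w)"
  by (auto simp: arch_of_iff height_Suc)

lemma arch_of_left_unique:
  assumes "arch_of w s (i, j)" "arch_of w s' (i, j')"
  shows "s = s'" "j = j'"
proof -
  show s: "s = s'" using assms by (auto simp: arch_of_iff)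
  have *: "\<not> j < j'" if "arch_of w s (i, j)" "arch_of w s (i, j')" for j j'
    using arch_of_height_end[OF that(1)] that unfolding arch_of_iff
    by (auto dest!: spec[of _ "Suc j"])
  show "j = j'" using * assms s by (metis linorder_neqE_nat)
qed

lemma arch_of_right_unique:
  assumes "arch_of w s (i, j)" "arch_of w s' (i', j)"
  shows "i = i'"
proof -
  have s: "s = s'" using assms by (auto simp: arch_of_iff)
  have *: "\<not> i < i'" if "arch_of w s (i, j)" "arch_of w s (i', j)" for i i'
    using arch_of_height_end[OF that(1)] arch_of_height_end[OF that(2)] that unfolding arch_of_iff
    by (auto dest!: spec[of _ "i'"])
  show ?thesis using * assms s by (metis linorder_neqE_nat)
qed

text \<open>The closing letter precedes the first later time at which the height is back at its
  value before \<open>i\<close>; such a time exists because the final height is 0.\<close>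

lemma arch_of_left_exists:
  assumes "balanced w" "i < length w" "w ! i = In s"
  shows "\<exists>j. arch_of w s (i, j)"
proof -
  let ?H = "\<lambda>m. height s (take m w)"
  let ?P = "\<lambda>m. i < m \<and> ?H m \<le> ?H i"
  have "?H (length w) = 0" "?H i \<ge> 0"
    using assms(1) by (auto simp: balanced_def stack_balanced_def)
  then have ex: "?P (length w)" using assms(2) by simp
  define m where "m = (LEAST m. ?P m)"
  have Pm: "?P m" and le: "m \<le> length w" unfolding m_def using LeastI[of ?P, OF ex] Least_le[of ?P, OF ex] by auto
  have less: "?H i + 1 \<le> ?H k" if "i < k" "k < m" for k
    using not_less_Least[of k ?P] that unfolding m_def by auto
  have Si: "?H (Suc i) = ?H i + 1" using assms height_Suc by simp
  then have "m \<noteq> Suc i" using Pm by auto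
  then obtain j where j: "m = Suc j" "i < j" using Pm by (cases m) auto
  have "?H m = ?H j + (if w ! j = In s then 1 else if w ! j = Out s then -1 else 0)"
    using height_Suc[of j w s] j le by simp
  then have "w ! j = Out s \<and> ?H j = ?H i + 1" using less[of j] j Pm by (auto split: if_splits)
  then have "arch_of w s (i, j)" unfolding arch_of_iff using assms j le less by auto
  then show ?thesis by blast
qed

text \<open>Mirror image of the previous argument: the opening letter stands at the last earlier
  time at which the height does not exceed the one reached after \<open>j\<close>.\<close>

lemma arch_of_right_exists:
  assumes "balanced w" "j < length w" "w ! j = Out s"
  shows "\<exists>i. arch_of w s (i, j)"
proof -
  let ?H = "\<lambda>m. height s (take m w)"
  let ?P = "\<lambda>m. m \<le> j \<and> ?H m \<le> ?H (Suc j)"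
  have Sj: "?H (Suc j) = ?H j - 1" using assms height_Suc by simp
  have "?H (Suc j) \<ge> 0" using assms(1) by (auto simp: balanced_def stack_balanced_def)
  then have ex: "?P 0" by simp
  have b: "?P y \<Longrightarrow> y \<le> j" for y by simp
  define i where "i = (GREATEST m. ?P m)"
  have Pi: "?P i" unfolding i_def using GreatestI_nat[of ?P, OF ex b] .
  have gr: "?H (Suc j) + 1 \<le> ?H k" if "i < k" "k \<le> j" for k
    using Greatest_le_nat[of ?P k j, OF _ b] that unfolding i_def by force
  have ij: "i < j" using Pi Sj by (cases "i = j") auto
  have "?H (Suc i) = ?H i + (if w ! i = In s then 1 else if w ! i = Out s then -1 else 0)"
    using height_Suc[of i w s] ij assms by simp
  then have "w ! i = In s \<and> ?H i = ?H (Suc j)" using gr[of "Suc i"] ij Pi by (auto split: if_splits)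
  then have "arch_of w s (i, j)" unfolding arch_of_iff using assms ij gr Sj by auto
  then show ?thesis by blast
qed

text \<open>When the first arch closes, the height is back at its level before \<open>i\<close>, but
  the second arch, opened strictly above that level, is still open and keeps the height
  higher.\<close>

lemma arch_of_same_stack_not_interleaving:
  assumes "arch_of w s A" "arch_of w s B"
  shows "\<not> interleaving A B"
proof -
  have *: False if "arch_of w s (i, j)" "arch_of w s (k, l)" "i < k" "k < j" "j < l" for i j k l
  proof -
    have "height s (take k w) + 1 \<le> height s (take (Suc j) w)" "height s (take i w) + 1 \<le> height s (take k w)"
      using that unfolding arch_of_iff by auto
    then show False using arch_of_height_end[OF that(1)] by simp
  qed
  show ?thesis using assms * by (cases A; cases B) (auto simp: interleaving_def)
qed

lemma crossing_imp_arch: "crossing w A B \<Longrightarrow> arch w A \<and> arch w B"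
  by (auto simp: crossing_def arch_def)

text \<open>Interleaving arches always have different colours. Hence the crossing graph depends on
  the set of arches alone, which is what allows two words with equal arches to be compared.\<close>

lemma crossing_iff: "crossing w A B \<longleftrightarrow> arch w A \<and> arch w B \<and> interleaving A B"
proof
  assume "arch w A \<and> arch w B \<and> interleaving A B"
  then obtain s s' where "arch_of w s A" "arch_of w s' B" "interleaving A B" by (auto simp: arch_def)
  then show "crossing w A B" unfolding crossing_def using arch_of_same_stack_not_interleaving by metis
qed (auto simp: crossing_def arch_def)

lemma crossing_rtranclp_arch: "(crossing w)\<^sup>*\<^sup>* A B \<Longrightarrow> arch w A \<Longrightarrow> arch w B"
  by (induction rule: rtranclp_induct) (auto dest: crossing_imp_arch)

definition leftmost_in_component :: "operation list \<Rightarrow> nat \<times> nat \<Rightarrow> bool" where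
  "leftmost_in_component w A \<longleftrightarrow> (\<forall>B. (crossing w)\<^sup>*\<^sup>* A B \<longrightarrow> fst A \<le> fst B)"

definition rooted :: "operation list \<Rightarrow> bool" where
  "rooted w \<longleftrightarrow> (\<forall>A. arch w A \<and> leftmost_in_component w A \<longrightarrow> arch_of w Stack1 A)"

lemma canonical_iff: "canonical w \<longleftrightarrow> balanced w \<and> mismatches w = 0 \<and> rooted w"
  unfolding canonical_def rooted_def leftmost_in_component_def operation_sequence_iff_balanced
  using not_sublist_iff_mismatches by blast

text \<open>Embeddings of arch systems whose image is a union of connected components.\<close>

lemma leftmost_in_component_embedding:
  assumes step: "\<And>A B. crossing u A B \<Longrightarrow> crossing w (\<phi> A) (\<phi> B)"
    and lift: "\<And>A C. arch u A \<Longrightarrow> crossing w (\<phi> A) C \<Longrightarrow> \<exists>B. C = \<phi> B \<and> crossing u A B"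
    and mono: "\<And>A B. arch u A \<Longrightarrow> arch u B \<Longrightarrow> fst (\<phi> A) \<le> fst (\<phi> B) \<longleftrightarrow> fst A \<le> fst B"
    and A: "arch u A"
  shows "leftmost_in_component w (\<phi> A) \<longleftrightarrow> leftmost_in_component u A"
proof -
  have 1: "(crossing w)\<^sup>*\<^sup>* (\<phi> A) (\<phi> B)" if "(crossing u)\<^sup>*\<^sup>* A B" for B
    using that by (induction rule: rtranclp_induct) (auto intro: rtranclp.rtrancl_into_rtrancl step)
  have 2: "\<exists>B. C = \<phi> B \<and> (crossing u)\<^sup>*\<^sup>* A B" if "(crossing w)\<^sup>*\<^sup>* (\<phi> A) C" for C
    using that
  proof (induction rule: rtranclp_induct)
    case (step C D)
    then obtain B where B: "C = \<phi> B" "(crossing u)\<^sup>*\<^sup>* A B" by blast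
    moreover have "arch u B" using B A crossing_rtranclp_arch by blast
    ultimately show ?case using lift[of B D] step by (meson rtranclp.rtrancl_into_rtrancl)
  qed blast
  show ?thesis unfolding leftmost_in_component_def using 1 2 mono[OF A] crossing_rtranclp_arch[OF _ A] by blast
qed

section \<open>Arches of a word into which a balanced factor is inserted\<close>

context
  fixes p f q :: "operation list"
  assumes balanced_f: "balanced f" and balanced_pq: "balanced (p @ q)"
begin

definition outer_pos :: "nat \<Rightarrow> nat" where
  "outer_pos m = (if m < length p then m else m + length f)"

lemma nth_outer_pos: "(p @ f @ q) ! outer_pos m = (p @ q) ! m"
  by (auto simp: outer_pos_def nth_append)

lemma outer_pos_less [simp]: "outer_pos i < outer_pos j \<longleftrightarrow> i < j"
  by (auto simp: outer_pos_def)

lemma outer_pos_le [simp]: "outer_pos i \<le> outer_pos j \<longleftrightarrow> i \<le> j"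
  by (auto simp: outer_pos_def)

lemma height_f: "height s f = 0" "0 \<le> height s (take k f)"
  using balanced_f by (auto simp: balanced_def stack_balanced_def)

lemma height_outer_pos: "height s (take (outer_pos m) (p @ f @ q)) = height s (take m (p @ q))"
  using height_f by (auto simp: outer_pos_def)

lemma height_inner_pos:
  "k \<le> length f \<Longrightarrow> height s (take (length p + k) (p @ f @ q)) = height s p + height s (take k f)"
  by simp

lemma pos_cases:
  obtains (outer) j where "i = outer_pos j"
  | (inner) k where "k < length f" "i = length p + k"
proof (cases "i < length p \<or> length p + length f \<le> i")
  case True
  then have "i = outer_pos (if i < length p then i else i - length f)"
    by (auto simp: outer_pos_def)
  then show ?thesis using outer by blast
next
  case False
  then show ?thesis using inner[of "i - length p"] by auto
qed

lemma arch_of_outer: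
  assumes "arch_of (p @ q) s (i, j)"
  shows "arch_of (p @ f @ q) s (outer_pos i, outer_pos j)"
proof -
  let ?H = "\<lambda>m. height s (take m (p @ f @ q))"
  have a: "i < j" "j < length (p @ q)" "(p @ q) ! i = In s" "(p @ q) ! j = Out s"
    "height s (take j (p @ q)) = height s (take i (p @ q)) + 1"
    "\<And>m. i < m \<Longrightarrow> m \<le> j \<Longrightarrow> height s (take i (p @ q)) + 1 \<le> height s (take m (p @ q))"
    using assms by (auto simp: arch_of_iff)
  have "height s (take i (p @ q)) + 1 \<le> ?H m" if "outer_pos i < m" "m \<le> outer_pos j" for m
  proof (cases m rule: pos_cases)
    case (outer k)
    then show ?thesis using that a(6)[of k] unfolding outer height_outer_pos by simp
  next
    case (inner k)
    have "i < length p" "length p \<le> j" using that inner by (auto simp: outer_pos_def split: if_splits)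
    then have "height s (take i (p @ q)) + 1 \<le> height s p" using a(6)[of "length p"] by simp
    moreover have "?H m = height s p + height s (take k f)" using inner height_inner_pos by simp
    ultimately show ?thesis using height_f by (smt (verit))
  qed
  moreover have "outer_pos j < length (p @ f @ q)" using a(2) by (auto simp: outer_pos_def)
  ultimately show ?thesis
    unfolding arch_of_iff nth_outer_pos height_outer_pos using a by simp
qed

lemma arch_of_inner:
  assumes "arch_of f s (i, j)"
  shows "arch_of (p @ f @ q) s (length p + i, length p + j)"
proof -
  have "(p @ f @ q) ! (length p + k) = f ! k" if "k < length f" for k
    using that by (simp add: nth_append)
  moreover have "height s p + height s (take i f) + 1 \<le> height s (take m (p @ f @ q))"
    if "length p + i < m" "m \<le> length p + j" for m
  proof -
    define k where "k = m - length p"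
    have k: "m = length p + k" "i < k" "k \<le> j" using that by (auto simp: k_def)
    then have "height s (take i f) + 1 \<le> height s (take k f)" "k \<le> length f"
      using assms by (auto simp: arch_of_iff)
    then show ?thesis using height_inner_pos[of k s] k(1) by simp
  qed
  moreover have "i < j" "j < length f" "f ! i = In s" "f ! j = Out s"
    "height s (take j f) = height s (take i f) + 1"
    using assms by (auto simp: arch_of_iff)
  ultimately show ?thesis unfolding arch_of_iff by (auto simp: height_inner_pos)
qed

text \<open>The left end decides: it opens an arch in whichever of the two words it belongs to, this
  arch is mapped to an arch of the whole word, and an arch is determined by its left end.\<close>

lemma arch_of_insert_cases:
  assumes "arch_of (p @ f @ q) s (i, j)"
  obtains (outer) i' j' where "i = outer_pos i'" "j = outer_pos j'" "arch_of (p @ q) s (i', j')"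
  | (inner) i' j' where "i = length p + i'" "j = length p + j'" "arch_of f s (i', j')"
proof (cases i rule: pos_cases)
  case o: (outer i')
  have "(p @ q) ! i' = In s" "i < length (p @ f @ q)"
    using assms o nth_outer_pos[of i'] unfolding arch_of_iff by auto
  then obtain j' where j': "arch_of (p @ q) s (i', j')"
    using arch_of_left_exists[OF balanced_pq, of i'] o by (auto simp: outer_pos_def split: if_splits)
  then have "j = outer_pos j'" using arch_of_outer[OF j'] assms o arch_of_left_unique(2) by blast
  then show ?thesis using outer o j' by blast
next
  case i: (inner i')
  have "f ! i' = In s" using assms i by (simp add: arch_of_iff nth_append)
  then obtain j' where j': "arch_of f s (i', j')"
    using arch_of_left_exists[OF balanced_f, of i'] i by auto
  then have "j = length p + j'" using arch_of_inner[OF j'] assms i arch_of_left_unique(2) by blast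
  then show ?thesis using inner i j' by blast
qed

definition "outer_arch = map_prod outer_pos outer_pos"
definition "inner_arch = map_prod ((+) (length p)) ((+) (length p))"

lemma arch_of_outer_arch: "arch_of (p @ q) s A \<Longrightarrow> arch_of (p @ f @ q) s (outer_arch A)"
  by (cases A) (simp add: outer_arch_def arch_of_outer)

lemma arch_of_inner_arch: "arch_of f s A \<Longrightarrow> arch_of (p @ f @ q) s (inner_arch A)"
  by (cases A) (simp add: inner_arch_def arch_of_inner)

lemma arch_insert_cases:
  assumes "arch (p @ f @ q) A"
  obtains (outer) B where "A = outer_arch B" "arch (p @ q) B"
  | (inner) B where "A = inner_arch B" "arch f B"
proof -
  obtain s i j where A: "A = (i, j)" "arch_of (p @ f @ q) s (i, j)"
    using assms by (cases A) (auto simp: arch_def)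
  show ?thesis using A(2)
  proof (cases rule: arch_of_insert_cases)
    case (outer i' j')
    then show ?thesis using that(1)[of "(i', j')"] A by (auto simp: outer_arch_def arch_def)
  next
    case (inner i' j')
    then show ?thesis using that(2)[of "(i', j')"] A by (auto simp: inner_arch_def arch_def)
  qed
qed

lemma interleaving_outer: "interleaving (outer_arch A) (outer_arch B) \<longleftrightarrow> interleaving A B"
  by (auto simp: interleaving_def outer_arch_def)

lemma interleaving_inner: "interleaving (inner_arch A) (inner_arch B) \<longleftrightarrow> interleaving A B"
  by (auto simp: interleaving_def inner_arch_def)

lemma not_interleaving_outer_inner:
  assumes "arch f B"
  shows "\<not> interleaving (outer_arch A) (inner_arch B)" "\<not> interleaving (inner_arch B) (outer_arch A)"
proof -
  obtain i j k l where A: "A = (i, j)" and B: "B = (k, l)" by (cases A; cases B) auto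
  have kl: "k < l" "l < length f" using assms B by (auto simp: arch_def arch_of_iff)
  have o: "outer_pos m < length p \<or> length p + length f \<le> outer_pos m" for m
    by (auto simp: outer_pos_def)
  show "\<not> interleaving (outer_arch A) (inner_arch B)" "\<not> interleaving (inner_arch B) (outer_arch A)"
    using o[of i] o[of j] kl unfolding A B interleaving_def outer_arch_def inner_arch_def
    by (simp_all add: map_prod_def) linarith+
qed

lemma arch_outer_iff: "arch (p @ q) A \<Longrightarrow> arch (p @ f @ q) (outer_arch A)"
  unfolding arch_def using arch_of_outer_arch by blast

lemma arch_inner_iff: "arch f A \<Longrightarrow> arch (p @ f @ q) (inner_arch A)"
  unfolding arch_def using arch_of_inner_arch by blast

lemma leftmost_outer:
  assumes "arch (p @ q) A"
  shows "leftmost_in_component (p @ f @ q) (outer_arch A) \<longleftrightarrow> leftmost_in_component (p @ q) A"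
proof (rule leftmost_in_component_embedding)
  fix A B
  show "crossing (p @ q) A B \<Longrightarrow> crossing (p @ f @ q) (outer_arch A) (outer_arch B)"
    by (simp add: crossing_iff interleaving_outer arch_outer_iff)
  show "fst (outer_arch A) \<le> fst (outer_arch B) \<longleftrightarrow> fst A \<le> fst B"
    by (simp add: outer_arch_def)
next
  fix A C assume A: "arch (p @ q) A" and "crossing (p @ f @ q) (outer_arch A) C"
  then have i: "interleaving (outer_arch A) C" and C: "arch (p @ f @ q) C" by (auto simp: crossing_iff)
  from C show "\<exists>B. C = outer_arch B \<and> crossing (p @ q) A B"
  proof (cases rule: arch_insert_cases)
    case (outer B)
    then have "crossing (p @ q) A B" using A i by (simp add: crossing_iff interleaving_outer)
    then show ?thesis using outer by blast
  next
    case (inner B)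
    then show ?thesis using i not_interleaving_outer_inner by blast
  qed
qed (fact assms)

lemma leftmost_inner:
  assumes "arch f A"
  shows "leftmost_in_component (p @ f @ q) (inner_arch A) \<longleftrightarrow> leftmost_in_component f A"
proof (rule leftmost_in_component_embedding)
  fix A B
  show "crossing f A B \<Longrightarrow> crossing (p @ f @ q) (inner_arch A) (inner_arch B)"
    by (simp add: crossing_iff interleaving_inner arch_inner_iff)
  show "fst (inner_arch A) \<le> fst (inner_arch B) \<longleftrightarrow> fst A \<le> fst B"
    by (simp add: inner_arch_def)
next
  fix A C assume A: "arch f A" and "crossing (p @ f @ q) (inner_arch A) C"
  then have i: "interleaving (inner_arch A) C" and C: "arch (p @ f @ q) C" by (auto simp: crossing_iff)
  from C show "\<exists>B. C = inner_arch B \<and> crossing f A B"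
  proof (cases rule: arch_insert_cases)
    case (outer B)
    then show ?thesis using A i not_interleaving_outer_inner by blast
  next
    case (inner B)
    then have "crossing f A B" using A i by (simp add: crossing_iff interleaving_inner)
    then show ?thesis using inner by blast
  qed
qed (fact assms)

lemma arch_of_outer_iff:
  assumes "arch (p @ q) A"
  shows "arch_of (p @ f @ q) s (outer_arch A) \<longleftrightarrow> arch_of (p @ q) s A"
proof -
  obtain s' where "arch_of (p @ q) s' A" using assms by (auto simp: arch_def)
  then show ?thesis using arch_of_outer_arch[of s' A] arch_of_outer_arch[of s A] arch_of_left_unique(1)
    by (cases "outer_arch A") metis
qed

lemma arch_of_inner_iff:
  assumes "arch f A"
  shows "arch_of (p @ f @ q) s (inner_arch A) \<longleftrightarrow> arch_of f s A"
proof -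
  obtain s' where "arch_of f s' A" using assms by (auto simp: arch_def)
  then show ?thesis using arch_of_inner_arch[of s' A] arch_of_inner_arch[of s A] arch_of_left_unique(1)
    by (cases "inner_arch A") metis
qed

text \<open>Arches of the inserted factor cross none of the others, so the components of the whole
  word are the images of those of \<open>p @ q\<close> and of \<open>f\<close>, with colours and
  leftmost arches preserved.\<close>

lemma rooted_insert_aux: "rooted (p @ f @ q) \<longleftrightarrow> rooted (p @ q) \<and> rooted f"
proof
  assume r: "rooted (p @ f @ q)"
  show "rooted (p @ q) \<and> rooted f" unfolding rooted_def
  proof (intro conjI allI impI; elim conjE)
    fix A assume "arch (p @ q) A" "leftmost_in_component (p @ q) A"
    then show "arch_of (p @ q) Stack1 A"
      using r leftmost_outer arch_outer_iff arch_of_outer_iff unfolding rooted_def by blast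
  next
    fix A assume "arch f A" "leftmost_in_component f A"
    then show "arch_of f Stack1 A"
      using r leftmost_inner arch_inner_iff arch_of_inner_iff unfolding rooted_def by blast
  qed
next
  assume r: "rooted (p @ q) \<and> rooted f"
  show "rooted (p @ f @ q)" unfolding rooted_def
  proof (intro allI impI; elim conjE)
    fix A assume A: "arch (p @ f @ q) A" "leftmost_in_component (p @ f @ q) A"
    show "arch_of (p @ f @ q) Stack1 A" using A(1)
    proof (cases rule: arch_insert_cases)
      case (outer B)
      then show ?thesis using A r leftmost_outer arch_of_outer_iff unfolding rooted_def by blast
    next
      case (inner B)
      then show ?thesis using A r leftmost_inner arch_of_inner_iff unfolding rooted_def by blast
    qed
  qed
qed

end

lemma rooted_insert:
  "balanced f \<Longrightarrow> balanced (p @ q) \<Longrightarrow> rooted (p @ f @ q) \<longleftrightarrow> rooted (p @ q) \<and> rooted f"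
  by (rule rooted_insert_aux)

lemma rooted_interlace:
  assumes "\<forall>g\<in>set (map snd zs). balanced g" "balanced (p @ map fst zs)"
  shows "rooted (p @ interlace zs) \<longleftrightarrow> rooted (p @ map fst zs) \<and> (\<forall>g\<in>set (map snd zs). rooted g)"
  using assms
proof (induction zs arbitrary: p rule: interlace.induct)
  case (2 x g zs)
  have "balanced ((p @ [x]) @ interlace zs)" by (subst balanced_interlace) (use 2 in auto)
  then have "rooted ((p @ [x]) @ g @ interlace zs) \<longleftrightarrow> rooted ((p @ [x]) @ interlace zs) \<and> rooted g"
    using 2 by (intro rooted_insert) auto
  also have "rooted ((p @ [x]) @ interlace zs) \<longleftrightarrow>
      rooted ((p @ [x]) @ map fst zs) \<and> (\<forall>g\<in>set (map snd zs). rooted g)"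
    by (rule 2(1)) (use 2 in auto)
  finally show ?case by auto
qed simp

text \<open>The hull of a component that misses the first letter would be a proper balanced factor.\<close>

lemma irreducible_word_connected:
  assumes c: "irreducible_word c" and A: "arch c A"
  shows "\<exists>B. (crossing c)\<^sup>*\<^sup>* A B \<and> fst B = 0"
proof (rule ccontr)
  assume no0: "\<not> ?thesis"
  have bal: "balanced c" using c by (simp add: irreducible_word_def)
  define C where "C = {B. (crossing c)\<^sup>*\<^sup>* A B}"
  have CA: "arch c B" if "B \<in> C" for B using that A crossing_rtranclp_arch unfolding C_def by blast
  have closed: "Y \<in> C" if "X \<in> C" "arch c Y" "interleaving X Y" for X Y
  proof -
    have "crossing c X Y" using that CA crossing_iff by blast
    then show ?thesis using that unfolding C_def by (auto intro: rtranclp.rtrancl_into_rtrancl)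
  qed
  have "C \<subseteq> {..<length c} \<times> {..<length c}"
    using CA by (force simp: arch_def arch_of_iff)
  then have fin: "finite C" by (rule finite_subset) simp
  have "A \<in> C" by (simp add: C_def)
  define i where "i = Min (fst ` C)"
  define j where "j = Max (snd ` C)"
  have imin: "i \<le> fst B" and jmax: "snd B \<le> j" if "B \<in> C" for B
    unfolding i_def j_def using fin that by auto
  obtain X0 where X0: "X0 \<in> C" "fst X0 = i"
    using Min_in[of "fst ` C"] fin \<open>A \<in> C\<close> unfolding i_def by fastforce
  obtain X1 where X1: "X1 \<in> C" "snd X1 = j"
    using Max_in[of "snd ` C"] fin \<open>A \<in> C\<close> unfolding j_def by fastforce
  have lt: "fst B < snd B" "snd B < length c" if "B \<in> C" for B
    using CA[OF that] by (cases B; auto simp: arch_def arch_of_iff)+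
  have ij: "i < j" "j < length c" using lt[OF X0(1)] lt[OF X1(1)] jmax[OF X0(1)] X0 X1 by auto
  have "fst X0 \<noteq> 0"
  proof
    assume "fst X0 = 0"
    moreover have "(crossing c)\<^sup>*\<^sup>* A X0" using X0(1) by (simp add: C_def)
    ultimately have "\<exists>B. (crossing c)\<^sup>*\<^sup>* A B \<and> fst B = 0" by (intro exI conjI)
    with no0 show False by (rule notE)
  qed
  then have i0: "0 < i" using X0(2) by simp
  have conn: "P X" if XY: "X \<in> C" "P Y" "Y \<in> C"
    and inv: "\<And>U V. U \<in> C \<Longrightarrow> V \<in> C \<Longrightarrow> interleaving U V \<Longrightarrow> P U \<longleftrightarrow> P V" for P X Y
  proof -
    have Ps: "P Z \<longleftrightarrow> P A" if "Z \<in> C" for Z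
    proof -
      have "(crossing c)\<^sup>*\<^sup>* A Z" using that C_def by simp
      then show ?thesis
      proof (induction rule: rtranclp_induct)
        case (step U V)
        then have "U \<in> C" by (simp add: C_def)
        moreover have "V \<in> C" using step(1,2) by (auto simp: C_def intro: rtranclp.rtrancl_into_rtrancl)
        moreover have "interleaving U V" using step(2) by (simp add: crossing_iff)
        ultimately have "U \<in> C" "V \<in> C" "interleaving U V" by auto
        then show ?case using step inv[of U V] by simp
      qed simp
    qed
    then show ?thesis using XY by blast
  qed
  \<comment> \<open>The arch \<open>(k, l)\<close> is not in \<open>C\<close> and thus interleaves
    with no arch of \<open>C\<close>; as it starts left of all of them, each lies either before
    \<open>l\<close> or after \<open>l\<close>. Interleaving arches lie on the same side, so all of
    \<open>C\<close> lies on one side, although \<open>X0\<close> starts before \<open>l\<close> and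
    \<open>X1\<close> ends at or after \<open>l\<close>. The statement \<open>right\<close> is the
    mirror image.\<close>
  have left: False if B: "arch_of c s (k, l)" "k < i" "i \<le> l" "l \<le> j" for s k l
  proof -
    have nC: "(k, l) \<notin> C" using imin[of "(k, l)"] B by auto
    have arB: "arch c (k, l)" using B arch_def by blast
    have cl: "snd X < l \<or> l < fst X" if X: "X \<in> C" for X
    proof -
      have "\<not> interleaving X (k, l)" using closed[OF X arB] nC by blast
      moreover obtain s' where s': "arch_of c s' X" using CA[OF X] by (auto simp: arch_def)
      moreover have "snd X \<noteq> l" using arch_of_right_unique[of c s k l s' "fst X"] B s' nC X
        by (cases X) auto
      moreover have "fst X \<noteq> l" using B s' by (cases X) (auto simp: arch_of_iff)
      ultimately show ?thesis using imin[OF X] lt[OF X] B by (auto simp: interleaving_def)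
    qed
    have "fst X0 < l \<or> l < fst X0" using cl[OF X0(1)] lt[OF X0(1)] by auto
    then have "snd X0 < l" using cl[OF X0(1)] X0 B by auto
    then have "snd X1 < l"
    proof (rule conn[OF X1(1) _ X0(1), where P = "\<lambda>X. snd X < l"])
      fix U V assume "U \<in> C" "V \<in> C" "interleaving U V"
      then show "snd U < l \<longleftrightarrow> snd V < l" using cl[of U] cl[of V] lt[of U] lt[of V]
        by (auto simp: interleaving_def)
    qed
    then show False using X1 B by auto
  qed
  have right: False if B: "arch_of c s (k, l)" "i \<le> k" "k \<le> j" "j < l" for s k l
  proof -
    have nC: "(k, l) \<notin> C" using jmax[of "(k, l)"] B by auto
    have arB: "arch c (k, l)" using B arch_def by blast
    have cl: "snd X < k \<or> k < fst X" if X: "X \<in> C" for X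
    proof -
      have "\<not> interleaving X (k, l)" using closed[OF X arB] nC by blast
      moreover obtain s' where s': "arch_of c s' X" using CA[OF X] by (auto simp: arch_def)
      moreover have "fst X \<noteq> k" using arch_of_left_unique[of c s k l s' "snd X"] B s' nC X
        by (cases X) auto
      moreover have "snd X \<noteq> k" using B s' by (cases X) (auto simp: arch_of_iff)
      ultimately show ?thesis using jmax[OF X] lt[OF X] B by (auto simp: interleaving_def)
    qed
    have "snd X0 < k" using cl[OF X0(1)] X0 B by auto
    then have "snd X1 < k"
    proof (rule conn[OF X1(1) _ X0(1), where P = "\<lambda>X. snd X < k"])
      fix U V assume "U \<in> C" "V \<in> C" "interleaving U V"
      then show "snd U < k \<longleftrightarrow> snd V < k" using cl[of U] cl[of V] lt[of U] lt[of V]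
        by (auto simp: interleaving_def)
    qed
    then show False using X1 B by auto
  qed
  define g where "g = take (Suc j - i) (drop i c)"
  have split: "c = take i c @ g @ drop (Suc j) c"
    using append_take_drop_id[of "Suc j - i" "drop i c"] append_take_drop_id[of i c] ij
    by (simp add: g_def)
  have Hg: "height s (take k g) = height s (take (i + k) c) - height s (take i c)"
    if "k \<le> Suc j - i" for k s
    using that unfolding g_def by (simp add: take_add min_def)
  \<comment> \<open>The first drop below the level at \<open>i\<close> would be an output whose arch
    opened before \<open>i\<close>, which \<open>left\<close> excludes.\<close>
  have low: "height s (take i c) \<le> height s (take m c)" if "i \<le> m" "m \<le> Suc j" for s m
    using that
  proof (induction m rule: less_induct)
    case (less m)
    show ?case
    proof (rule ccontr)
      assume n: "\<not> ?thesis"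
      then have "m \<noteq> i" by auto
      then obtain l where l: "m = Suc l" "i \<le> l" "l \<le> j" using less by (cases m) auto
      have "height s (take i c) \<le> height s (take l c)" using less l by simp
      then have "c ! l = Out s" using n l ij height_Suc[of l c s] by (auto split: if_splits)
      then obtain k where k: "arch_of c s (k, l)" using arch_of_right_exists[OF bal, of l] l ij by auto
      have "height s (take (Suc l) c) = height s (take k c)" using arch_of_height_end[OF k] .
      moreover have "k < l" using k by (simp add: arch_of_iff)
      ultimately have "k < i" using less.IH[of k] n l by (cases "k < i") auto
      then show False using left[OF k] l by blast
    qed
  qed
  \<comment> \<open>A surplus would leave some item in its stack: the input after the last position
    at or below the level of \<open>i\<close> would open an arch that closes beyond
    \<open>j\<close>, against \<open>right\<close>.\<close>
  have eq: "height s (take (Suc j) c) = height s (take i c)" for s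
  proof (rule ccontr)
    assume n: "\<not> ?thesis"
    then have gt: "height s (take i c) < height s (take (Suc j) c)" using low[of "Suc j" s] ij by simp
    let ?P = "\<lambda>m. m \<le> j \<and> height s (take m c) \<le> height s (take i c)"
    have ex: "?P i" using ij by simp
    have b: "?P y \<Longrightarrow> y \<le> j" for y by simp
    define k where "k = (GREATEST m. ?P m)"
    have Pk: "?P k" unfolding k_def using GreatestI_nat[of ?P, OF ex b] .
    have ik: "i \<le> k" unfolding k_def using Greatest_le_nat[of ?P, OF ex b] .
    have up: "height s (take i c) < height s (take m c)" if "k < m" "m \<le> Suc j" for m
      using Greatest_le_nat[of ?P m j, OF _ b] that gt unfolding k_def by (cases "m = Suc j") force+
    have "c ! k = In s" using up[of "Suc k"] Pk height_Suc[of k c s] ij by (auto split: if_splits)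
    then obtain l where l: "arch_of c s (k, l)" using arch_of_left_exists[OF bal, of k] Pk ij by auto
    have "height s (take (Suc l) c) \<le> height s (take i c)" using arch_of_height_end[OF l] Pk by simp
    then have "j < l" using up[of "Suc l"] l by (force simp: arch_of_iff)
    then show False using right[OF l] ik Pk by blast
  qed
  have "0 \<le> height s (take k g)" for s k
  proof (cases "k \<le> Suc j - i")
    case True
    then show ?thesis using Hg[OF True] low[of "i + k" s] ij by simp
  next
    case False
    then have "take k g = take (Suc j - i) g" by (simp add: g_def)
    then show ?thesis using Hg[of "Suc j - i"] low[of "Suc j" s] ij by simp
  qed
  moreover have "height s g = 0" for s
  proof -
    have "take (Suc j - i) g = g" by (simp add: g_def)
    then show ?thesis using Hg[of "Suc j - i" s] eq ij by simp
  qed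
  ultimately have "balanced g" by (simp add: balanced_def stack_balanced_def)
  moreover have "take i c \<noteq> []" using i0 ij by auto
  moreover have "g \<noteq> []" using ij by (simp add: g_def)
  ultimately show False using c split unfolding irreducible_word_def by blast
qed

text \<open>By \<open>irreducible_word_connected\<close> every component contains the arch at
  position 0, so there is only one component and that arch is its leftmost.\<close>

lemma rooted_irreducible_word:
  assumes "irreducible_word c"
  shows "rooted c \<longleftrightarrow> hd c = In Stack1"
proof
  have ne: "c \<noteq> []" and bal: "balanced c" using assms by (auto simp: irreducible_word_def)
  then have h0: "hd c = c ! 0" "0 < length c" by (auto simp: hd_conv_nth)
  {
    assume r: "rooted c"
    obtain s where s: "hd c = In s" using balanced_hd bal ne by metis
    then obtain j where "arch_of c s (0, j)" using arch_of_left_exists[OF bal h0(2)] h0 by metis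
    then have "arch_of c Stack1 (0, j)"
      using r unfolding rooted_def leftmost_in_component_def arch_def by auto
    then show "hd c = In Stack1" using h0 by (simp add: arch_of_iff)
  next
    assume h: "hd c = In Stack1"
    show "rooted c" unfolding rooted_def
    proof (intro allI impI; elim conjE)
      fix A assume A: "arch c A" "leftmost_in_component c A"
      then have "fst A = 0" using irreducible_word_connected[OF assms A(1)]
        unfolding leftmost_in_component_def by force
      moreover obtain s where "arch_of c s A" using A by (auto simp: arch_def)
      ultimately show "arch_of c Stack1 A" using h h0 by (cases A) (auto simp: arch_of_iff)
    qed
  }
qed

text \<open>Balance, roots of components and mismatches all split over the skeleton and the gaps.
  The last condition says that every mismatch of the skeleton is broken up by a non-empty
  gap.\<close>

lemma canonical_interlace:
  assumes "decomposition zs"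
  shows "canonical (interlace zs) \<longleftrightarrow> fst (hd zs) = In Stack1 \<and> (\<forall>g\<in>set (map snd zs). canonical g) \<and>
     (\<forall>(b, g)\<in>set (zip (mismatch_flags (map fst zs)) (map snd zs)). b \<longrightarrow> g \<noteq> [])"
proof -
  have irr: "irreducible_word (map fst zs)" and bal: "\<forall>g\<in>set (map snd zs). balanced g"
    using assms by (auto simp: decomposition_def)
  have ne: "zs \<noteq> []" using irr by (auto simp: irreducible_word_def)
  have b: "balanced (interlace zs)" using balanced_interlace[OF bal, of "[]"] irr
    by (simp add: irreducible_word_def)
  have r: "rooted (interlace zs) \<longleftrightarrow> fst (hd zs) = In Stack1 \<and> (\<forall>g\<in>set (map snd zs). rooted g)"
    using rooted_interlace[OF bal, of "[]"] irr rooted_irreducible_word[OF irr] ne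
    by (simp add: irreducible_word_def hd_map)
  let ?Z = "zip (mismatch_flags (map fst zs)) (map snd zs)"
  have s: "set (map snd zs) = snd ` set ?Z"
    by (metis length_map length_mismatch_flags map_snd_zip set_map)
  have "mismatches (interlace zs) = 0 \<longleftrightarrow>
    (\<forall>(b, g)\<in>set ?Z. (if g = [] then of_bool b else mismatches g) = 0)"
    unfolding mismatches_interlace[OF bal] sum_list_eq_0_iff by auto
  also have "\<dots> \<longleftrightarrow> (\<forall>g\<in>set (map snd zs). mismatches g = 0) \<and> (\<forall>(b, g)\<in>set ?Z. b \<longrightarrow> g \<noteq> [])"
    unfolding s by (auto split: if_splits)
  finally show ?thesis unfolding canonical_iff using b r bal by blast
qed

lemma canonical_append:
  assumes "balanced u" "balanced v"
  shows "canonical (u @ v) \<longleftrightarrow> canonical u \<and> canonical v"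
proof -
  have "rooted (u @ v) \<longleftrightarrow> rooted u \<and> rooted v" using rooted_insert[of v u "[]"] assms by simp
  then show ?thesis unfolding canonical_iff
    using assms mismatches_append_balanced[of u v] balanced_append[of u v] by auto
qed

section \<open>Permutations and canonical operation sequences\<close>

text \<open>Here \<open>out\<close> is the output still to be written, not the output so far as in \<open>move\<close>.\<close>

fun exec :: "operation list \<Rightarrow> nat list \<Rightarrow> (stack \<Rightarrow> nat list) \<Rightarrow> nat list \<Rightarrow> bool" where
  "exec [] inp st out \<longleftrightarrow> inp = [] \<and> (\<forall>s. st s = []) \<and> out = []"
| "exec (In s # w) inp st out \<longleftrightarrow> (\<exists>x inp'. inp = x # inp' \<and> exec w inp' (st(s := x # st s)) out)"
| "exec (Out s # w) inp st out \<longleftrightarrow>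
     (\<exists>x r out'. st s = x # r \<and> out = x # out' \<and> exec w inp (st(s := r)) out')"

abbreviation no_stacks :: "stack \<Rightarrow> nat list" where
  "no_stacks \<equiv> \<lambda>_. []"

fun is_In :: "operation \<Rightarrow> bool" where
  "is_In (In s) = True"
| "is_In (Out s) = False"

definition inputs :: "operation list \<Rightarrow> nat" where
  "inputs w = length (filter is_In w)"

definition outputs :: "operation list \<Rightarrow> nat" where
  "outputs w = length (filter (\<lambda>x. \<not> is_In x) w)"

lemma inputs_simps [simp]:
  "inputs [] = 0" "inputs (x # w) = (if is_In x then 1 else 0) + inputs w" "inputs (u @ v) = inputs u + inputs v"
  by (auto simp: inputs_def)

lemma outputs_simps [simp]:
  "outputs [] = 0" "outputs (x # w) = (if is_In x then 0 else 1) + outputs w"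
  "outputs (u @ v) = outputs u + outputs v"
  by (auto simp: outputs_def)

lemma inputs_plus_outputs: "inputs w + outputs w = length w"
  unfolding inputs_def outputs_def by (rule sum_length_filter_compl)

lemma inputs_balanced:
  assumes "balanced w"
  shows "inputs w = outputs w"
proof -
  have h: "int (inputs w) - int (outputs w) = height Stack1 w + height Stack2 w" for w
  proof (induction w)
    case (Cons x w)
    then show ?case by (cases x; rename_tac s; case_tac s) auto
  qed simp
  show ?thesis using h[of w] assms by (simp add: balanced_def stack_balanced_def)
qed

lemma exec_inputs: "exec w inp st out \<Longrightarrow> inputs w = length inp"
  by (induction w inp st out rule: exec.induct) auto

lemma exec_outputs: "exec w inp st out \<Longrightarrow> outputs w = length out"
  by (induction w inp st out rule: exec.induct) auto

lemma exec_deterministic: "exec w inp st out \<Longrightarrow> exec w inp st out' \<Longrightarrow> out = out'"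
  by (induction w inp st out arbitrary: out' rule: exec.induct) auto

lemma exec_heights:
  "exec w inp st out \<Longrightarrow> height s w = - int (length (st s)) \<and> - int (length (st s)) \<le> height s (take k w)"
proof (induction w inp st out arbitrary: k rule: exec.induct)
  case (2 s' w inp st out)
  then obtain x inp' where "inp = x # inp'" "exec w inp' (st(s' := x # st s')) out" by auto
  from 2(1)[OF this(2), of "k - 1"] show ?case by (cases k) (auto split: if_splits)
next
  case (3 s' w inp st out)
  then obtain x r out' where *: "st s' = x # r" "out = x # out'" "exec w inp (st(s' := r)) out'" by auto
  from 3(1)[OF *(3), of "k - 1"] *(1) show ?case by (cases k) (auto split: if_splits)
qed auto

lemma exec_balanced: "exec w inp no_stacks out \<Longrightarrow> balanced w"
  unfolding balanced_def stack_balanced_def using exec_heights by fastforce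

lemma exec_exists:
  assumes "\<And>s k. - int (length (st s)) \<le> height s (take k w)" "\<And>s. height s w = - int (length (st s))"
    "inputs w = length inp"
  shows "\<exists>out. exec w inp st out"
  using assms
proof (induction w arbitrary: inp st)
  case (Cons x w)
  show ?case
  proof (cases x)
    case (In s)
    then obtain y inp' where inp: "inp = y # inp'" using Cons(4) by (cases inp) auto
    have "\<exists>out. exec w inp' (st(s := y # st s)) out"
    proof (rule Cons.IH)
      show "- int (length ((st(s := y # st s)) s')) \<le> height s' (take k w)" for s' k
        using Cons(2)[of s' "Suc k"] In by (auto split: if_splits)
      show "height s' w = - int (length ((st(s := y # st s)) s'))" for s'
        using Cons(3)[of s'] In by (auto split: if_splits)
      show "inputs w = length inp'" using Cons(4) In inp by simp
    qed
    then show ?thesis using In inp by auto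
  next
    case (Out s)
    then obtain y r where st: "st s = y # r" using Cons(2)[of s 1] by (cases "st s") auto
    have "\<exists>out. exec w inp (st(s := r)) out"
    proof (rule Cons.IH)
      show "- int (length ((st(s := r)) s')) \<le> height s' (take k w)" for s' k
        using Cons(2)[of s' "Suc k"] Out st by (auto split: if_splits)
      show "height s' w = - int (length ((st(s := r)) s'))" for s'
        using Cons(3)[of s'] Out st by (auto split: if_splits)
      show "inputs w = length inp" using Cons(4) Out by simp
    qed
    then show ?thesis using Out st by auto
  qed
qed (auto intro!: exI[of _ "[]"])

lemma balanced_exec_exists:
  assumes "balanced w" "length w = 2 * length inp"
  shows "\<exists>out. exec w inp no_stacks out"
proof (rule exec_exists)
  show "inputs w = length inp" using inputs_balanced[OF assms(1)] inputs_plus_outputs[of w] assms(2) by simp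
qed (use assms in \<open>auto simp: balanced_def stack_balanced_def\<close>)

lemma exec_mset: "exec w inp st out \<Longrightarrow> mset out = mset inp + mset (st Stack1) + mset (st Stack2)"
proof (induction w inp st out rule: exec.induct)
  case (2 s w inp st out)
  then obtain x inp' where x: "inp = x # inp'" "exec w inp' (st(s := x # st s)) out" by auto
  then show ?case using 2(1)[OF x(2)] by (cases s) auto
next
  case (3 s w inp st out)
  then obtain x r out' where x: "st s = x # r" "out = x # out'" "exec w inp (st(s := r)) out'" by auto
  then show ?case using 3(1)[OF x(3)] by (cases s) auto
qed auto

text \<open>The word \<open>v\<close> pops exactly the upper parts \<open>a\<close> and never
  reaches below them, so it acts as if the lower parts \<open>b\<close> were absent.\<close>

lemma exec_append_split:
  assumes "exec (v @ z) inp (\<lambda>s. a s @ b s) out"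
    "\<And>s k. - int (length (a s)) \<le> height s (take k v)" "\<And>s. height s v = - int (length (a s))"
  shows "exec v (take (inputs v) inp) a (take (outputs v) out) \<and>
    exec z (drop (inputs v) inp) b (drop (outputs v) out)"
  using assms
proof (induction v arbitrary: inp a out)
  case Nil
  then have "a s = []" for s by simp
  then show ?case using Nil by auto
next
  case (Cons x v)
  show ?case
  proof (cases x)
    case (In s)
    then obtain y inp' where y: "inp = y # inp'"
      "exec (v @ z) inp' ((\<lambda>s. a s @ b s)(s := y # a s @ b s)) out" using Cons(2) by auto
    have "(\<lambda>s. a s @ b s)(s := y # a s @ b s) = (\<lambda>s'. (a(s := y # a s)) s' @ b s')" by auto
    with y have e: "exec (v @ z) inp' (\<lambda>s'. (a(s := y # a s)) s' @ b s') out" by metis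
    have "exec v (take (inputs v) inp') (a(s := y # a s)) (take (outputs v) out) \<and>
      exec z (drop (inputs v) inp') b (drop (outputs v) out)"
    proof (rule Cons.IH[OF e])
      show "- int (length ((a(s := y # a s)) s')) \<le> height s' (take k v)" for s' k
        using Cons(3)[of s' "Suc k"] In by (auto split: if_splits)
      show "height s' v = - int (length ((a(s := y # a s)) s'))" for s'
        using Cons(4)[of s'] In by (auto split: if_splits)
    qed
    then show ?thesis using In y by auto
  next
    case (Out s)
    then obtain y r where a: "a s = y # r" using Cons(3)[of s 1] by (cases "a s") auto
    then obtain out' where y: "out = y # out'"
      "exec (v @ z) inp ((\<lambda>s. a s @ b s)(s := r @ b s)) out'" using Cons(2) Out by auto
    have "(\<lambda>s. a s @ b s)(s := r @ b s) = (\<lambda>s'. (a(s := r)) s' @ b s')" by auto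
    with y have e: "exec (v @ z) inp (\<lambda>s'. (a(s := r)) s' @ b s') out'" by metis
    have "exec v (take (inputs v) inp) (a(s := r)) (take (outputs v) out') \<and>
      exec z (drop (inputs v) inp) b (drop (outputs v) out')"
    proof (rule Cons.IH[OF e])
      show "- int (length ((a(s := r)) s')) \<le> height s' (take k v)" for s' k
        using Cons(3)[of s' "Suc k"] Out a by (auto split: if_splits)
      show "height s' v = - int (length ((a(s := r)) s'))" for s'
        using Cons(4)[of s'] Out a by (auto split: if_splits)
    qed
    then show ?thesis using Out y a by auto
  qed
qed

lemma exec_append_join:
  "exec v inp1 a out1 \<Longrightarrow> exec z inp2 b out2 \<Longrightarrow> exec (v @ z) (inp1 @ inp2) (\<lambda>s. a s @ b s) (out1 @ out2)"
proof (induction v inp1 a out1 rule: exec.induct)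
  case (2 s w inp st out)
  then obtain x inp' where x: "inp = x # inp'" "exec w inp' (st(s := x # st s)) out" by auto
  have "(\<lambda>s'. (st(s := x # st s)) s' @ b s') = (\<lambda>s. st s @ b s)(s := x # st s @ b s)" by auto
  then show ?case using 2(1)[OF x(2) 2(3)] x(1) by auto
next
  case (3 s w inp st out)
  then obtain x r out' where x: "st s = x # r" "out = x # out'" "exec w inp (st(s := r)) out'" by auto
  have "(\<lambda>s'. (st(s := r)) s' @ b s') = (\<lambda>s. st s @ b s)(s := r @ b s)" by auto
  then show ?case using 3(1)[OF x(3) 3(3)] x(1,2) by auto
qed auto

lemma exec_balanced_appendE:
  assumes "balanced g" "exec (g @ z) inp st out"
  obtains inp1 inp2 out1 out2 where "inp = inp1 @ inp2" "out = out1 @ out2"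
    "exec g inp1 no_stacks out1" "exec z inp2 st out2"
proof -
  have "exec (g @ z) inp (\<lambda>s. no_stacks s @ st s) out" using assms(2) by simp
  from exec_append_split[OF this] have "exec g (take (inputs g) inp) no_stacks (take (outputs g) out) \<and>
    exec z (drop (inputs g) inp) st (drop (outputs g) out)"
    using assms(1) by (simp add: balanced_def stack_balanced_def)
  then show ?thesis using that[OF append_take_drop_id[symmetric] append_take_drop_id[symmetric]] by blast
qed

lemma exec_append_no_stacks:
  "exec g inp1 no_stacks out1 \<Longrightarrow> exec z inp2 st out2 \<Longrightarrow> exec (g @ z) (inp1 @ inp2) st (out1 @ out2)"
  using exec_append_join[of g inp1 no_stacks out1 z inp2 st out2] by simp

definition stacks :: "nat list \<Rightarrow> nat list \<Rightarrow> stack \<Rightarrow> nat list" where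
  "stacks a b s = (case s of Stack1 \<Rightarrow> a | Stack2 \<Rightarrow> b)"

lemma stacks_upd [simp]:
  "(stacks a b)(Stack1 := c) = stacks c b" "(stacks a b)(Stack2 := c) = stacks a c"
  "stacks a b Stack1 = a" "stacks a b Stack2 = b" "stacks [] [] = no_stacks"
  by (auto simp: stacks_def fun_eq_iff split: stack.splits)

lemma moves_if_exec:
  "exec w inp st p \<Longrightarrow> move\<^sup>*\<^sup>* (inp, st Stack1, st Stack2, out) ([], [], [], out @ p)"
proof (induction w inp st p arbitrary: out rule: exec.induct)
  case (2 s w inp st p)
  then obtain x inp' where x: "inp = x # inp'" "exec w inp' (st(s := x # st s)) p" by auto
  have "move (inp, st Stack1, st Stack2, out) (inp', (st(s := x # st s)) Stack1, (st(s := x # st s)) Stack2, out)"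
    unfolding x by (cases s) (auto intro: move.intros)
  then show ?case using 2(1)[OF x(2), of out] by (rule converse_rtranclp_into_rtranclp)
next
  case (3 s w inp st p)
  then obtain x r p' where x: "st s = x # r" "p = x # p'" "exec w inp (st(s := r)) p'" by auto
  have "move (inp, st Stack1, st Stack2, out) (inp, (st(s := r)) Stack1, (st(s := r)) Stack2, out @ [x])"
    using x(1) by (cases s) (auto intro: move.intros)
  then show ?case using 3(1)[OF x(3), of "out @ [x]"] x(2) by (simp add: converse_rtranclp_into_rtranclp)
qed auto

lemma exec_if_moves:
  assumes "move\<^sup>*\<^sup>* c ([], [], [], q)" "c = (inp, a, b, out)"
  shows "\<exists>w p. q = out @ p \<and> exec w inp (stacks a b) p"
  using assms
proof (induction arbitrary: inp a b out rule: converse_rtranclp_induct)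
  case base
  then show ?case by (intro exI[of _ "[]"]) auto
next
  case (step c d)
  from step(1) show ?case
  proof cases
    case (push1 x inp' st1 st2 out')
    then obtain w p where "q = out @ p" "exec w inp' (stacks (x # a) b) p"
      using step.IH[of inp' "x # a" b out] step.prems by auto
    then show ?thesis using push1 step.prems by (intro exI[of _ "In Stack1 # w"] exI[of _ p]) auto
  next
    case (push2 x inp' st1 st2 out')
    then obtain w p where "q = out @ p" "exec w inp' (stacks a (x # b)) p"
      using step.IH[of inp' a "x # b" out] step.prems by auto
    then show ?thesis using push2 step.prems by (intro exI[of _ "In Stack2 # w"] exI[of _ p]) auto
  next
    case (pop1 inp' x st1 st2 out')
    then obtain w p where "q = (out @ [x]) @ p" "exec w inp (stacks st1 b) p"
      using step.IH[of inp st1 b "out @ [x]"] step.prems by auto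
    then show ?thesis using pop1 step.prems by (intro exI[of _ "Out Stack1 # w"] exI[of _ "x # p"]) auto
  next
    case (pop2 inp' st1 x st2 out')
    then obtain w p where "q = (out @ [x]) @ p" "exec w inp (stacks a st2) p"
      using step.IH[of inp a st2 "out @ [x]"] step.prems by auto
    then show ?thesis using pop2 step.prems by (intro exI[of _ "Out Stack2 # w"] exI[of _ "x # p"]) auto
  qed
qed

lemma producible_iff: "producible p \<longleftrightarrow> (\<exists>w. exec w [1..<Suc (length p)] no_stacks p)"
proof
  assume "producible p"
  then show "\<exists>w. exec w [1..<Suc (length p)] no_stacks p"
    using exec_if_moves[of _ p "[1..<Suc (length p)]" "[]" "[]" "[]"] unfolding producible_def by auto
next
  assume "\<exists>w. exec w [1..<Suc (length p)] no_stacks p"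
  then show "producible p" unfolding producible_def using moves_if_exec[of _ _ no_stacks p "[]"] by auto
qed

subsection \<open>Uniqueness of the canonical sequence\<close>

lemma mismatches_tl: "mismatches (x # w) = 0 \<Longrightarrow> mismatches w = 0"
  by (simp add: mismatches_Cons)

text \<open>Without mismatches a run of inputs ends with an output from the stack of its last input.
  The next item written is therefore one that was just pushed.\<close>

lemma exec_In_head:
  assumes "exec (In s # w) inp st out" "mismatches (In s # w) = 0"
  shows "out \<noteq> [] \<and> hd out \<in> set inp"
  using assms
proof (induction w arbitrary: s inp st)
  case (Cons y w)
  then obtain x inp' where x: "inp = x # inp'" "exec (y # w) inp' (st(s := x # st s)) out" by auto
  show ?case
  proof (cases y)
    case (In s')
    have e: "exec (In s' # w) inp' (st(s := x # st s)) out" using x In by simp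
    have "mismatches (In s' # w) = 0" using mismatches_tl Cons.prems(2) In by blast
    from Cons.IH[OF e this] show ?thesis using x by simp
  next
    case (Out s')
    then have "s' = s" using Cons.prems(2) by (auto simp: mismatches_Cons mismatch_def split: if_splits)
    then show ?thesis using x Out by auto
  qed
qed (auto split: if_splits)

text \<open>Without mismatches, an item is output as soon as possible, so the output dictates whether the
  next operation is an input or an output.\<close>

lemma exec_shape_unique:
  assumes "exec w inp st out" "exec w' inp st' out" "mismatches w = 0" "mismatches w' = 0"
    "distinct inp" "\<And>s x. x \<in> set inp \<Longrightarrow> x \<notin> set (st s) \<and> x \<notin> set (st' s)"
  shows "map is_In w = map is_In w'"
  using assms
proof (induction w inp st out arbitrary: w' st' rule: exec.induct)
  case (1 inp st out)
  then have "inputs w' = 0" "outputs w' = 0" using exec_inputs exec_outputs by fastforce+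
  then show ?case using inputs_plus_outputs[of w'] by simp
next
  case (2 s w inp st out)
  then have o: "out \<noteq> []" "hd out \<in> set inp" using exec_In_head by blast+
  obtain x inp' where x: "inp = x # inp'" "exec w inp' (st(s := x # st s)) out" using 2(2) by auto
  \<comment> \<open>By \<open>exec_In_head\<close> the next output is still in the remaining input,
    and the disjointness hypothesis keeps such items off the stacks.\<close>
  have "\<not> (\<exists>s' v. w' = Out s' # v)"
  proof
    assume "\<exists>s' v. w' = Out s' # v"
    then obtain s' r where "st' s' = hd out # r" using 2(3) by auto
    then show False using 2(7)[OF o(2), of s'] by simp
  qed
  moreover have "w' \<noteq> []" using 2(3) x by auto
  ultimately obtain s' v where w': "w' = In s' # v" by (metis list.exhaust operation.exhaust)
  have "map is_In w = map is_In v"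
  proof (rule 2(1)[OF x(2)])
    show "exec v inp' (st'(s' := x # st' s')) out" using 2(3) w' x by auto
    show "mismatches w = 0" "mismatches v = 0" using 2(4,5) w' mismatches_tl by blast+
    show "distinct inp'" using 2(6) x by simp
    show "y \<notin> set ((st(s := x # st s)) t) \<and> y \<notin> set ((st'(s' := x # st' s')) t)" if "y \<in> set inp'" for y t
      using that 2(6) 2(7)[of y] x by auto
  qed
  then show ?case using w' by simp
next
  case (3 s w inp st out)
  obtain x r out' where x: "st s = x # r" "out = x # out'" "exec w inp (st(s := r)) out'" using 3(2) by auto
  have "x \<notin> set inp" using 3(7)[of x s] x by auto
  have "\<not> (\<exists>s' v. w' = In s' # v)"
  proof
    assume "\<exists>s' v. w' = In s' # v"
    then show False using exec_In_head[of _ _ inp st' out] 3(3,5) x \<open>x \<notin> set inp\<close> by fastforce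
  qed
  moreover have "w' \<noteq> []" using 3(3) x by auto
  ultimately obtain s' v where w': "w' = Out s' # v" by (metis list.exhaust operation.exhaust)
  obtain r' where r': "st' s' = x # r'" "exec v inp (st'(s' := r')) out'" using 3(3) w' x by auto
  have "map is_In w = map is_In v"
  proof (rule 3(1)[OF x(3) r'(2)])
    show "mismatches w = 0" "mismatches v = 0" using 3(4,5) w' mismatches_tl by blast+
    show "distinct inp" by fact
    show "y \<notin> set ((st(s := r)) t) \<and> y \<notin> set ((st'(s' := r')) t)" if "y \<in> set inp" for y t
      using 3(7)[OF that, of s] 3(7)[OF that, of s'] 3(7)[OF that, of t] x r' by auto
  qed
  then show ?case using w' by simp
qed

text \<open>Only one stack is followed: whatever happens to the other one, \<open>v\<close> never
  pops more than the part \<open>a\<close> and what was pushed onto it, so \<open>b\<close> survives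
  at the bottom.\<close>

lemma exec_append_stack:
  assumes "exec (v @ z) inp st out" "st s = a @ b" "\<And>k. - int (length a) \<le> height s (take k v)"
  shows "\<exists>st2 a2. exec z (drop (inputs v) inp) st2 (drop (outputs v) out) \<and> st2 s = a2 @ b \<and>
    int (length a2) = int (length a) + height s v"
  using assms
proof (induction v arbitrary: inp st out a)
  case (Cons x v)
  show ?case
  proof (cases x)
    case (In s')
    then obtain y inp' where y: "inp = y # inp'" "exec (v @ z) inp' (st(s' := y # st s')) out"
      using Cons(2) by auto
    let ?a = "if s' = s then y # a else a"
    have "(st(s' := y # st s')) s = ?a @ b" using Cons(3) by auto
    moreover have "- int (length ?a) \<le> height s (take k v)" for k
      using Cons(4)[of "Suc k"] In by (auto split: if_splits)
    ultimately show ?thesis using Cons.IH[OF y(2), of ?a] In y by (auto split: if_splits)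
  next
    case (Out s')
    then obtain y r out' where y: "st s' = y # r" "out = y # out'" "exec (v @ z) inp (st(s' := r)) out'"
      using Cons(2) by auto
    have ne: "a \<noteq> []" if "s' = s" using Cons(4)[of 1] Out that by auto
    let ?a = "if s' = s then tl a else a"
    have "(st(s' := r)) s = ?a @ b" using Cons(3) y ne by (cases a) auto
    moreover have "- int (length ?a) \<le> height s (take k v)" for k
      using Cons(4)[of "Suc k"] Out ne by (auto split: if_splits)
    ultimately obtain st2 a2 where "exec z (drop (inputs v) inp) st2 (drop (outputs v) out')"
      "st2 s = a2 @ b" "int (length a2) = int (length ?a) + height s v"
      using Cons.IH[OF y(3), of ?a] by blast
    moreover have "int (length ?a) + height s v = int (length a) + height s (x # v)"
      using Out ne by (cases a) auto
    ultimately show ?thesis using Out y by auto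
  qed
qed auto

text \<open>Between the two ends of the arch the operations of stack \<open>s\<close> are balanced,
  so the item pushed at \<open>i\<close> is on top again when \<open>j\<close> pops. Hence input and
  output numbers of an arch carry the same item.\<close>

lemma exec_arch_label:
  assumes e: "exec w inp no_stacks out" and a: "arch_of w s (i, j)"
  shows "inp ! inputs (take i w) = out ! outputs (take j w)"
    "inputs (take i w) < length inp" "outputs (take j w) < length out"
proof -
  have ij: "i < j" "j < length w" "w ! i = In s" "w ! j = Out s" using a by (auto simp: arch_of_iff)
  define u v z where "u = take i w" and "v = take (j - Suc i) (drop (Suc i) w)" and "z = drop (Suc j) w"
  have v: "stack_balanced s v" using a unfolding arch_of_def dyck_word_filter_iff v_def by auto
  have dj: "drop (Suc i) w = v @ Out s # z"
    using append_take_drop_id[of "j - Suc i" "drop (Suc i) w"] ij Cons_nth_drop_Suc[OF ij(2)]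
    by (simp add: v_def z_def)
  have w: "w = u @ In s # v @ Out s # z"
    using id_take_nth_drop[of i w] ij dj by (simp add: u_def)
  have tj: "take j w = u @ In s # v"
  proof -
    have "j = length u + Suc (length v)" using ij by (auto simp: u_def v_def)
    then show ?thesis by (subst w) simp
  qed
  have bal: "balanced w" using exec_balanced[OF e] .
  have "0 \<le> height s (take k u)" for k
    using bal unfolding u_def by (simp add: balanced_def stack_balanced_def)
  then obtain st2 where e2: "exec (In s # v @ Out s # z) (drop (inputs u) inp) st2 (drop (outputs u) out)"
    using exec_append_stack[of u "In s # v @ Out s # z" inp no_stacks out s "[]" "[]"] e w by auto
  then obtain x inp' where x: "drop (inputs u) inp = x # inp'"
    "exec (v @ Out s # z) inp' (st2(s := x # st2 s)) (drop (outputs u) out)" by auto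
  have "0 \<le> height s (take k v)" "height s v = 0" for k using v by (auto simp: stack_balanced_def)
  then obtain st3 where e3: "exec (Out s # z) (drop (inputs v) inp') st3 (drop (outputs v) (drop (outputs u) out))"
     "st3 s = x # st2 s"
    using exec_append_stack[OF x(2), of s "[]" "x # st2 s"] by auto
  then obtain out' where o: "drop (outputs u + outputs v) out = x # out'" by (auto simp: add.commute)
  show "inputs (take i w) < length inp" using x(1) by (metis drop_eq_Nil2 leI list.distinct(1) u_def)
  show "outputs (take j w) < length out" unfolding tj using o
    by (metis add_0 drop_eq_Nil2 is_In.simps(1) leI list.distinct(1) outputs_simps(2,3))
  have "inp ! inputs u = x" using x(1) by (metis hd_drop_conv_nth drop_eq_Nil2 leI list.distinct(1) list.sel(1))
  moreover have "out ! (outputs u + outputs v) = x"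
    using o by (metis hd_drop_conv_nth drop_eq_Nil2 leI list.distinct(1) list.sel(1))
  ultimately show "inp ! inputs (take i w) = out ! outputs (take j w)" unfolding tj using u_def by simp
qed

lemma outputs_take_less:
  assumes "j < k" "j < length w" "\<not> is_In (w ! j)"
  shows "outputs (take j w) < outputs (take k w)"
proof -
  have "take k w = take (Suc j) w @ take (k - Suc j) (drop (Suc j) w)"
    using assms by (metis Suc_leI le_add_diff_inverse take_add)
  then show ?thesis using assms by (simp add: take_Suc_conv_app_nth)
qed

text \<open>The shape fixes how many inputs and outputs precede each position, hence which item
  enters at \<open>i\<close>. As the output items are distinct, that item leaves both words at the
  same time.\<close>

lemma arch_eq_if_same_shape:
  assumes e: "exec w inp no_stacks out" "exec w' inp no_stacks out" and d: "distinct out"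
    and sh: "map is_In w = map is_In w'" and a: "arch w A"
  shows "arch w' A"
proof -
  obtain s i j where A: "A = (i, j)" "arch_of w s (i, j)" using a by (cases A) (auto simp: arch_def)
  have ij: "i < j" "j < length w" "w ! i = In s" "w ! j = Out s" using A by (auto simp: arch_of_iff)
  have len: "length w' = length w" using sh by (metis length_map)
  have isn: "is_In (w' ! m) = is_In (w ! m)" if "m < length w" for m using sh that len by (metis nth_map)
  have inp: "inputs (take m w') = inputs (take m w)" "outputs (take m w') = outputs (take m w)" for m
  proof -
    have s: "map is_In (take m w') = map is_In (take m w)" using sh by (simp add: take_map[symmetric])
    have h: "inputs v = length (filter id (map is_In v))" "outputs v = length (filter Not (map is_In v))" for v
      by (auto simp: inputs_def outputs_def filter_map o_def)
    then show "inputs (take m w') = inputs (take m w)" "outputs (take m w') = outputs (take m w)"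
      by (simp_all only: h s)
  qed
  obtain s' where s': "w' ! i = In s'" using isn[of i] ij by (cases "w' ! i") auto
  obtain j' where j': "arch_of w' s' (i, j')" using arch_of_left_exists[OF exec_balanced[OF e(2)] _ s'] ij len by auto
  have jl: "j' < length w'" "\<not> is_In (w' ! j')" using j' by (auto simp: arch_of_iff)
  have "out ! outputs (take j w) = out ! outputs (take j' w)"
    using exec_arch_label[OF e(1) A(2)] exec_arch_label[OF e(2) j'] unfolding inp by simp
  then have "outputs (take j w) = outputs (take j' w)"
    using exec_arch_label[OF e(1) A(2)] exec_arch_label[OF e(2) j'] d unfolding inp
    by (simp add: nth_eq_iff_index_eq)
  then have "j = j'" using outputs_take_less[of j j' w] outputs_take_less[of j' j w] ij jl isn[of j'] len
    by (metis is_In.simps(2) less_irrefl linorder_neqE_nat)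
  then show ?thesis using j' A by (auto simp: arch_def)
qed

lemma leftmost_in_component_exists:
  assumes "arch w A"
  obtains B where "(crossing w)\<^sup>*\<^sup>* A B" "leftmost_in_component w B"
proof -
  let ?P = "\<lambda>B. (crossing w)\<^sup>*\<^sup>* A B"
  have "?P A" by simp
  then obtain B where B: "?P B" "\<And>C. ?P C \<Longrightarrow> fst B \<le> fst C"
    using ex_has_least_nat[of ?P A fst] by blast
  have "leftmost_in_component w B" unfolding leftmost_in_component_def
  proof (intro allI impI)
    fix C assume "(crossing w)\<^sup>*\<^sup>* B C"
    then show "fst B \<le> fst C" using B by (meson rtranclp_trans)
  qed
  then show ?thesis using that B(1) by blast
qed

text \<open>Input and output determine the shape, the shape the arches, and the arches the crossing
  graph. What remains is the colouring, which is a proper 2-colouring of each component and so is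
  fixed by the colour of its leftmost arch.\<close>

lemma canonical_exec_unique:
  assumes c: "canonical w" "canonical w'" and e: "exec w inp no_stacks out" "exec w' inp no_stacks out"
    and d: "distinct inp" "distinct out"
  shows "w = w'"
proof -
  have b: "balanced w" "balanced w'" and m: "mismatches w = 0" "mismatches w' = 0"
    and r: "rooted w" "rooted w'" using c by (auto simp: canonical_iff)
  have sh: "map is_In w = map is_In w'" using exec_shape_unique[OF e m d(1)] by simp
  have len: "length w' = length w" using sh by (metis length_map)
  have isn: "is_In (w' ! m) = is_In (w ! m)" if "m < length w" for m using sh that len by (metis nth_map)
  have ar: "arch w A \<longleftrightarrow> arch w' A" for A
    using arch_eq_if_same_shape[OF e d(2) sh] arch_eq_if_same_shape[OF e(2,1) d(2) sh[symmetric]] by blast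
  have cr: "crossing w = crossing w'" by (intro ext) (simp add: crossing_iff ar)
  have col: "arch_of w' s A" if "arch_of w s A" for s A
  proof (rule ccontr)
    assume n: "\<not> ?thesis"
    have aA: "arch w A" using that by (auto simp: arch_def)
    obtain B where B: "(crossing w)\<^sup>*\<^sup>* A B" "leftmost_in_component w B"
      using leftmost_in_component_exists[OF aA] .
    \<comment> \<open>A disagreement about the colour of one arch spreads along crossings, since
      crossing arches differ in colour in both words and only two colours exist.\<close>
    have "\<exists>t t'. arch_of w t B \<and> arch_of w' t' B \<and> t \<noteq> t'" using B(1)
    proof (induction rule: rtranclp_induct)
      case base
      obtain s' where "arch_of w' s' A" using aA ar by (auto simp: arch_def)
      then show ?case using that n by blast
    next
      case (step X Y)
      then obtain t t' where t: "arch_of w t X" "arch_of w' t' X" "t \<noteq> t'" by blast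
      have i: "interleaving X Y" and Y: "arch w Y" "arch w' Y" using step(2) ar by (auto simp: crossing_iff)
      obtain t2 t2' where t2: "arch_of w t2 Y" "arch_of w' t2' Y" using Y by (auto simp: arch_def)
      have "t2 \<noteq> t" "t2' \<noteq> t'" using arch_of_same_stack_not_interleaving i t t2 by blast+
      then have "t2 \<noteq> t2'" using t(3) by (metis stack.exhaust)
      then show ?case using t2 by blast
    qed
    then obtain t t' where t: "arch_of w t B" "arch_of w' t' B" "t \<noteq> t'" by blast
    have "leftmost_in_component w' B" using B(2) unfolding leftmost_in_component_def cr .
    then have "arch_of w Stack1 B" "arch_of w' Stack1 B"
      using r B(2) t unfolding rooted_def arch_def by blast+
    then show False using t arch_of_left_unique(1) by (metis prod.collapse)
  qed
  show ?thesis
  proof (rule nth_equalityI)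
    fix m assume ml: "m < length w"
    show "w ! m = w' ! m"
    proof (cases "w ! m")
      case (In s)
      then obtain j where "arch_of w s (m, j)" using arch_of_left_exists[OF b(1) ml] by blast
      then show ?thesis using col[of s "(m, j)"] In by (auto simp: arch_of_iff)
    next
      case (Out s)
      then obtain i where "arch_of w s (i, m)" using arch_of_right_exists[OF b(1) ml] by blast
      then show ?thesis using col[of s "(i, m)"] Out by (auto simp: arch_of_iff)
    qed
  qed (simp add: len)
qed


subsection \<open>Existence of the canonical sequence\<close>

fun relabel :: "(stack \<Rightarrow> stack) \<Rightarrow> operation \<Rightarrow> operation" where
  "relabel \<tau> (In s) = In (\<tau> s)"
| "relabel \<tau> (Out s) = Out (\<tau> s)"

context
  fixes \<tau> :: "stack \<Rightarrow> stack"
  assumes involution: "\<And>s. \<tau> (\<tau> s) = s"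
begin

lemma tau_eq_iff: "\<tau> s = \<tau> t \<longleftrightarrow> s = t"
  by (metis involution)

lemma height_relabel: "height (\<tau> s) (map (relabel \<tau>) w) = height s w"
proof (induction w)
  case (Cons x w)
  then show ?case by (cases x) (auto simp: tau_eq_iff)
qed simp

lemma balanced_relabel: "balanced (map (relabel \<tau>) w) \<longleftrightarrow> balanced w"
proof -
  have "stack_balanced (\<tau> s) (map (relabel \<tau>) w) \<longleftrightarrow> stack_balanced s w" for s
    unfolding stack_balanced_def take_map height_relabel ..
  then show ?thesis unfolding balanced_def by (metis involution)
qed

lemma irreducible_word_relabel: "irreducible_word c \<Longrightarrow> irreducible_word (map (relabel \<tau>) c)"
proof -
  assume c: "irreducible_word c"
  have fac: "f = []" if a: "map (relabel \<tau>) c = p @ f @ q" "p \<noteq> []" "balanced f" for p f q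
  proof -
    obtain p' f' q' where *: "c = p' @ f' @ q'" "p = map (relabel \<tau>) p'" "f = map (relabel \<tau>) f'"
    proof -
      obtain p' v where v: "c = p' @ v" "map (relabel \<tau>) p' = p" "map (relabel \<tau>) v = f @ q"
        using a(1) map_eq_append_conv[of "relabel \<tau>" c p "f @ q"] by metis
      obtain f' q' where "v = f' @ q'" "map (relabel \<tau>) f' = f"
        using v(3) map_eq_append_conv[of "relabel \<tau>" v f q] by metis
      then show ?thesis using that[of p' f' q'] v by simp
    qed
    have "balanced f'" "p' \<noteq> []" using a(2,3) *(2,3) balanced_relabel by simp_all
    moreover have "c = p' @ f' @ q' \<and> p' \<noteq> [] \<and> balanced f' \<longrightarrow> f' = []"
      using c unfolding irreducible_word_def by (elim conjE allE)
    ultimately show "f = []" using * by simp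
  qed
  show ?thesis unfolding irreducible_word_def balanced_relabel
  proof (intro conjI allI impI)
    show "balanced c" "map (relabel \<tau>) c \<noteq> []" using c by (simp_all add: irreducible_word_def)
    fix p f q assume "map (relabel \<tau>) c = p @ f @ q \<and> p \<noteq> [] \<and> balanced f"
    then show "f = []" using fac[of p f q] by simp
  qed
qed

lemma mismatch_relabel: "mismatch (relabel \<tau> x) (relabel \<tau> y) \<longleftrightarrow> mismatch x y"
  by (cases x; cases y) (auto simp: mismatch_def tau_eq_iff)

lemma mismatch_flags_relabel: "mismatch_flags (map (relabel \<tau>) c) = mismatch_flags c"
  by (induction c rule: mismatch_flags.induct) (auto simp: mismatch_relabel)

text \<open>Each gap leaves the stacks as it found them, so the skeleton can be recoloured and the
  gaps replaced independently by words with the same effect on empty stacks.\<close>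

lemma exec_relabel_interlace:
  assumes "exec (interlace zs) inp st out"
    "\<And>g. g \<in> set (map snd zs) \<Longrightarrow> balanced g \<and> balanced (F g)"
    "\<And>g inp out. g \<in> set (map snd zs) \<Longrightarrow> exec g inp no_stacks out \<Longrightarrow> exec (F g) inp no_stacks out"
  shows "exec (interlace (map (\<lambda>(x, g). (relabel \<tau> x, F g)) zs)) inp (st \<circ> \<tau>) out"
  using assms
proof (induction zs arbitrary: inp st out rule: interlace.induct)
  case (2 x g zs)
  let ?zs = "map (\<lambda>(x, g). (relabel \<tau> x, F g)) zs"
  have bal: "balanced g" "balanced (F g)" using 2(3)[of g] by auto
  have upd: "(st(s := v)) \<circ> \<tau> = (st \<circ> \<tau>)(\<tau> s := v)" for st :: "stack \<Rightarrow> nat list" and s v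
  proof
    fix t
    show "(st(s := v) \<circ> \<tau>) t = ((st \<circ> \<tau>)(\<tau> s := v)) t"
    proof (cases "t = \<tau> s")
      case True
      show ?thesis unfolding True o_apply fun_upd_apply involution by simp
    next
      case False
      then have "\<tau> t \<noteq> s" using involution by metis
      then show ?thesis unfolding o_apply fun_upd_apply using False by (simp only: if_False)
    qed
  qed
  have step: "exec (F g @ interlace ?zs) inp (st \<circ> \<tau>) out" if ex: "exec (g @ interlace zs) inp st out" for inp st out
  proof -
    obtain inp1 inp2 out1 out2 where *: "inp = inp1 @ inp2" "out = out1 @ out2"
      "exec g inp1 no_stacks out1" "exec (interlace zs) inp2 st out2"
      using exec_balanced_appendE[OF bal(1) ex] .
    have "exec (F g) inp1 no_stacks out1" using 2(4)[of g inp1 out1] *(3) by simp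
    moreover have "exec (interlace ?zs) inp2 (st \<circ> \<tau>) out2"
    proof (rule 2(1)[OF *(4)])
      fix g' inp out assume "g' \<in> set (map snd zs)"
      then have "g' \<in> set (map snd ((x, g) # zs))" by simp
      then show "balanced g' \<and> balanced (F g')" "exec g' inp no_stacks out \<Longrightarrow> exec (F g') inp no_stacks out"
        using 2(3,4) by metis+
    qed
    ultimately show ?thesis unfolding *(1,2) by (rule exec_append_no_stacks)
  qed
  show ?case
  proof (cases x)
    case (In s)
    then obtain y inp' where "inp = y # inp'" "exec (g @ interlace zs) inp' (st(s := y # st s)) out"
      using 2(2) by auto
    then show ?thesis using step[of inp' "st(s := y # st s)" out] unfolding In upd by (simp add: involution o_def)
  next
    case (Out s)
    then obtain y r out' where "st s = y # r" "out = y # out'" "exec (g @ interlace zs) inp (st(s := r)) out'"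
      using 2(2) by auto
    then show ?thesis using step[of inp "st(s := r)" out'] unfolding Out upd by (simp add: involution o_def)
  qed
qed auto

end

lemma length_interlace: "length (interlace zs) = (\<Sum>(x, g)\<leftarrow>zs. Suc (length g))"
  by (induction zs rule: interlace.induct) auto

lemma length_gap_less: "g \<in> set (map snd zs) \<Longrightarrow> length g < length (interlace zs)"
  by (induction zs rule: interlace.induct) (auto simp del: set_map)

lemma sum_list_map_eq_0D: "(\<Sum>x\<leftarrow>xs. f x) = (0::nat) \<Longrightarrow> x \<in> set xs \<Longrightarrow> f x = 0"
  by (induction xs) auto

text \<open>Make every gap canonical by induction and exchange the two stacks on the skeleton if it
  starts in \<open>Stack2\<close>. The skeleton is one component, so this sets its root without
  affecting the others.\<close>

lemma canonical_equivalent_exists: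
  assumes "balanced w" "mismatches w = 0"
  shows "\<exists>w'. canonical w' \<and> length w' = length w \<and>
    (\<forall>inp out. exec w inp no_stacks out \<longrightarrow> exec w' inp no_stacks out)"
  using assms
proof (induction w rule: length_induct)
  case (1 w)
  show ?case
  proof (cases "w = []")
    case True
    have "canonical []" by (simp add: canonical_iff rooted_def arch_def arch_of_def)
    then show ?thesis using True by (intro exI[of _ "[]"]) auto
  next
    case False
    then obtain zs where zs: "decomposition zs" "interlace zs = w"
      using decomposition_exists 1(2) by blast
    have irr: "irreducible_word (map fst zs)" and bal: "\<forall>g\<in>set (map snd zs). balanced g"
      using zs by (auto simp: decomposition_def)
    let ?P = "\<lambda>g g'. canonical g' \<and> length g' = length g \<and>
      (\<forall>inp out. exec g inp no_stacks out \<longrightarrow> exec g' inp no_stacks out)"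
    let ?Z = "zip (mismatch_flags (map fst zs)) (map snd zs)"
    have m: "\<forall>(b, g)\<in>set ?Z. (if g = [] then of_bool b else mismatches g) = 0"
    proof -
      have z: "(\<Sum>(b, g)\<leftarrow>?Z. if g = [] then of_bool b else mismatches g) = 0"
        using 1(3) zs mismatches_interlace[OF bal] by simp
      show ?thesis
      proof (intro ballI, clarify)
        fix b g assume "(b, g) \<in> set ?Z"
        from sum_list_map_eq_0D[OF z this]
        show "(if g = [] then of_bool b else mismatches g) = 0" by (simp only: prod.case)
      qed
    qed
    have s: "set (map snd zs) = snd ` set ?Z"
      by (metis length_map length_mismatch_flags map_snd_zip set_map)
    have mg: "mismatches g = 0" if gs: "g \<in> set (map snd zs)" for g
    proof (cases "g = []")
      case False
      obtain b where "(b, g) \<in> set ?Z" using gs[unfolded s] by (elim imageE) (metis prod.collapse)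
      then have "(if g = [] then of_bool b else mismatches g) = 0" using m by blast
      then show ?thesis using False by simp
    qed simp
    have "\<forall>g\<in>set (map snd zs). \<exists>g'. ?P g g'"
    proof
      fix g assume g: "g \<in> set (map snd zs)"
      have "length g < length w" using length_gap_less[OF g] zs by simp
      then show "\<exists>g'. ?P g g'" using 1(1) bal g mg by blast
    qed
    then obtain F where F: "\<And>g. g \<in> set (map snd zs) \<Longrightarrow> ?P g (F g)" by metis
    define \<tau> where "\<tau> = (if hd (map fst zs) = In Stack1 then id else
      (\<lambda>s. case s of Stack1 \<Rightarrow> Stack2 | Stack2 \<Rightarrow> Stack1))"
    have inv: "\<tau> (\<tau> s) = s" for s by (auto simp: \<tau>_def split: stack.splits)
    define zs' where "zs' = map (\<lambda>(x, g). (relabel \<tau> x, F g)) zs"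
    have fst': "map fst zs' = map (relabel \<tau>) (map fst zs)" and snd': "map snd zs' = map F (map snd zs)"
      by (auto simp: zs'_def)
    have dec: "decomposition zs'"
      unfolding decomposition_def fst' snd' using irreducible_word_relabel[OF inv irr] F
      by (auto simp: canonical_iff)
    have ne: "map fst zs \<noteq> []" using irr by (auto simp: irreducible_word_def)
    have hd1: "hd (map fst zs') = In Stack1"
    proof -
      obtain s where "hd (map fst zs) = In s" using balanced_hd irr ne unfolding irreducible_word_def by metis
      then show ?thesis unfolding fst' using ne by (cases s) (auto simp: hd_map \<tau>_def)
    qed
    \<comment> \<open>The replacement of gaps preserves lengths, so the non-empty gaps that break up
      mismatches of the skeleton remain non-empty.\<close>
    have gaps: "\<forall>(b, g)\<in>set (zip (mismatch_flags (map fst zs')) (map snd zs')). b \<longrightarrow> g \<noteq> []"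
    proof -
      have eq: "zip (mismatch_flags (map fst zs')) (map snd zs') = map (\<lambda>(b, g). (b, F g)) ?Z"
        unfolding fst' snd' mismatch_flags_relabel[OF inv] by (simp add: zip_map2 case_prod_beta)
      have "b \<longrightarrow> F g \<noteq> []" if z: "(b, g) \<in> set ?Z" for b g
      proof -
        have "g \<in> set (map snd zs)" using z by (rule set_zip_rightD)
        from F[OF this] have "length (F g) = length g" by blast
        moreover have "(if g = [] then of_bool b else mismatches g) = 0" using m z by blast
        ultimately show ?thesis by (auto split: if_splits)
      qed
      then show ?thesis unfolding eq by auto
    qed
    have "zs' \<noteq> []" using ne by (simp add: zs'_def)
    then have "fst (hd zs') = In Stack1" using hd1 by (simp add: hd_map)
    moreover have "\<forall>g\<in>set (map snd zs'). canonical g" unfolding snd' using F by auto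
    ultimately have can: "canonical (interlace zs')"
      unfolding canonical_interlace[OF dec] using gaps by blast
    have "length (interlace zs') = length w"
    proof -
      have "length (interlace zs') = (\<Sum>(x, g)\<leftarrow>zs. Suc (length (F g)))"
        unfolding length_interlace zs'_def by (simp add: o_def case_prod_unfold)
      also have "\<dots> = (\<Sum>(x, g)\<leftarrow>zs. Suc (length g))"
      proof (intro arg_cong[where f = sum_list] map_cong refl)
        fix z assume "z \<in> set zs"
        then have "snd z \<in> set (map snd zs)" by simp
        from F[OF this] show "(case z of (x, g) \<Rightarrow> Suc (length (F g))) = (case z of (x, g) \<Rightarrow> Suc (length g))"
          by (simp add: case_prod_unfold)
      qed
      finally show ?thesis using length_interlace[of zs] zs(2) by simp
    qed
    moreover have "exec (interlace zs') inp no_stacks out" if "exec w inp no_stacks out" for inp out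
    proof -
      have "exec (interlace zs) inp no_stacks out" using that zs by simp
      then have "exec (interlace zs') inp (no_stacks \<circ> \<tau>) out" unfolding zs'_def
      proof (rule exec_relabel_interlace[OF inv])
        fix g inp out assume g: "g \<in> set (map snd zs)"
        have "balanced g" using bal g by blast
        then show "balanced g \<and> balanced (F g)" "exec g inp no_stacks out \<Longrightarrow> exec (F g) inp no_stacks out"
          using F[OF g] by (simp_all add: canonical_iff)
      qed
      then show ?thesis by (simp add: o_def)
    qed
    ultimately show ?thesis using can by blast
  qed
qed

lemma exec_swap:
  "exec (u @ In s # Out s' # v) inp st out \<Longrightarrow> s \<noteq> s' \<Longrightarrow> exec (u @ Out s' # In s # v) inp st out"
proof (induction u arbitrary: inp st out)
  case Nil
  then obtain x inp' y r out' where "inp = x # inp'" "st s' = y # r" "out = y # out'"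
    "exec v inp' (st(s := x # st s, s' := r)) out'" by auto
  then show ?case using Nil(2) by (auto simp: fun_upd_twist)
next
  case (Cons a u)
  then show ?case by (cases a) auto
qed

text \<open>Counts the pairs of an input and a later output. Letting an output overtake the input
  just before it lowers the count by one, and for different stacks this does not change the result;
  a minimal word has no mismatch.\<close>

fun inversions :: "operation list \<Rightarrow> nat" where
  "inversions [] = 0"
| "inversions (x # w) = (if is_In x then outputs w else 0) + inversions w"

lemma inversions_swap: "inversions (u @ In s # Out s' # v) = Suc (inversions (u @ Out s' # In s # v))"
  by (induction u) auto

lemma mismatches_pos:
  "mismatches w \<noteq> 0 \<Longrightarrow> \<exists>u s s' v. w = u @ In s # Out s' # v \<and> s \<noteq> s'"
proof (induction w rule: mismatch_flags.induct)
  case (3 x y w)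
  show ?case
  proof (cases "mismatch x y")
    case True
    then show ?thesis by (intro exI[of _ "[]"]) (auto simp: mismatch_def)
  next
    case False
    then have "mismatches (y # w) \<noteq> 0" using 3(2) by (simp add: mismatches_Cons)
    then obtain u s s' v where "y # w = u @ In s # Out s' # v" "s \<noteq> s'" using 3(1) by blast
    then show ?thesis by (intro exI[of _ "x # u"]) auto
  qed
qed (auto simp: mismatches_def)

lemma exec_without_mismatches:
  assumes "exec w inp st out"
  shows "\<exists>w'. exec w' inp st out \<and> mismatches w' = 0"
proof -
  obtain w' where w': "exec w' inp st out" "\<And>v. exec v inp st out \<Longrightarrow> inversions w' \<le> inversions v"
    using ex_has_least_nat[of "\<lambda>w. exec w inp st out" w inversions] assms by blast
  have "mismatches w' = 0"
  proof (rule ccontr)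
    assume "mismatches w' \<noteq> 0"
    then obtain u s s' v where "w' = u @ In s # Out s' # v" "s \<noteq> s'" using mismatches_pos by blast
    then show False using w' exec_swap[of u s s' v inp st out] inversions_swap[of u s s' v]
      by (metis Suc_n_not_le_n)
  qed
  then show ?thesis using w'(1) by blast
qed

theorem s_coeff_eq: "s_coeff n = real (card {w. canonical w \<and> length w = 2 * n})"
proof -
  let ?I = "[1..<Suc n]"
  let ?C = "{w. canonical w \<and> length w = 2 * n}"
  let ?A = "{p \<in> permutations_of_set {1..n}. producible p}"
  define f where "f w = (THE p. exec w ?I no_stacks p)" for w
  have f: "exec w ?I no_stacks p \<Longrightarrow> f w = p" for w p
    unfolding f_def using exec_deterministic by blast
  have ex: "exec w ?I no_stacks (f w)" if "w \<in> ?C" for w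
    using balanced_exec_exists[of w ?I] that f by (auto simp: canonical_iff)
  have d: "distinct p" "set p = {1..n}" "length p = n" if "exec w ?I no_stacks p" for w p
  proof -
    have m: "mset p = mset ?I" using exec_mset[OF that] by simp
    show "distinct p" using m by (metis distinct_upt mset_eq_imp_distinct_iff)
    show "set p = {1..n}" using mset_eq_setD[OF m] by auto
    show "length p = n" using mset_eq_length[OF m] by simp
  qed
  have "bij_betw f ?C ?A"
  proof (rule bij_betw_imageI)
    show "inj_on f ?C"
    proof (rule inj_onI)
      fix w w' assume w: "w \<in> ?C" "w' \<in> ?C" "f w = f w'"
      have e: "exec w ?I no_stacks (f w)" "exec w' ?I no_stacks (f w)"
        using ex[OF w(1)] ex[OF w(2)] unfolding w(3) by blast+
      show "w = w'"
        using canonical_exec_unique[OF _ _ e distinct_upt d(1)[OF e(1)]] w(1,2) by blast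
    qed
    show "f ` ?C = ?A"
    proof (intro equalityI subsetI)
      fix p assume "p \<in> f ` ?C"
      then obtain w where w: "exec w ?I no_stacks p" using ex by auto
      then show "p \<in> ?A" using d[OF w] unfolding producible_iff permutations_of_set_def by auto
    next
      fix p assume p: "p \<in> ?A"
      then have "length p = n" by (auto dest: length_finite_permutations_of_set)
      then obtain w where w: "exec w ?I no_stacks p" using p unfolding producible_iff by blast
      obtain w1 where w1: "exec w1 ?I no_stacks p" "mismatches w1 = 0"
        using exec_without_mismatches[OF w] by blast
      obtain w2 where w2: "canonical w2" "length w2 = length w1" "exec w2 ?I no_stacks p"
        using canonical_equivalent_exists[OF exec_balanced[OF w1(1)] w1(2)] w1(1) by blast
      have "length ?I = n" by (simp del: upt_Suc)
      then have "length w2 = 2 * n"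
        using inputs_plus_outputs[of w2] exec_inputs[OF w2(3)] exec_outputs[OF w2(3)] d(3)[OF w2(3)] by linarith
      then show "p \<in> f ` ?C" using w2 f[OF w2(3)] by blast
    qed
  qed
  then have "card ?C = card ?A" by (rule bij_betw_same_card)
  then show ?thesis by (simp add: s_coeff_def)
qed

section \<open>Generating functions\<close>

lemma finite_words: "finite {w :: operation list. P w \<and> length w = n}"
  and card_words_le: "card {w :: operation list. P w \<and> length w = n} \<le> 4 ^ n"
proof -
  have U: "(UNIV :: operation set) = {In Stack1, In Stack2, Out Stack1, Out Stack2}"
  proof (intro equalityI subsetI)
    fix x :: operation show "x \<in> {In Stack1, In Stack2, Out Stack1, Out Stack2}"
      by (cases x; rename_tac s; case_tac s) auto
  qed simp
  have f: "finite (UNIV :: operation set)" unfolding U by simp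
  have c: "card (UNIV :: operation set) = 4" unfolding U by simp
  have sub: "{w :: operation list. P w \<and> length w = n} \<subseteq> {w. set w \<subseteq> UNIV \<and> length w = n}" by auto
  have fin: "finite {w :: operation list. set w \<subseteq> UNIV \<and> length w = n}" by (rule finite_lists_length_eq[OF f])
  show "finite {w :: operation list. P w \<and> length w = n}" by (rule finite_subset[OF sub fin])
  show "card {w :: operation list. P w \<and> length w = n} \<le> 4 ^ n"
    using card_mono[OF fin sub] unfolding card_lists_length_eq[OF f] c .
qed

lemma bij_betw_graded:
  assumes ev: "\<And>w. P w \<Longrightarrow> even (length w)"
  shows "bij_betw snd (Sigma UNIV (\<lambda>n. {w. P w \<and> length w = 2 * n})) {w. P w}"
proof (rule bij_betw_imageI)
  show "inj_on snd (Sigma UNIV (\<lambda>n. {w. P w \<and> length w = 2 * n}))" by (auto simp: inj_on_def)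
  show "snd ` Sigma UNIV (\<lambda>n. {w. P w \<and> length w = 2 * n}) = {w. P w}"
  proof (intro equalityI subsetI)
    fix w assume "w \<in> {w. P w}"
    then show "w \<in> snd ` Sigma UNIV (\<lambda>n. {w. P w \<and> length w = 2 * n})"
      using ev[of w] by (intro image_eqI[of _ _ "(length w div 2, w)"]) auto
  qed auto
qed

text \<open>Bijections between words and decompositions are applied to unordered sums, where no
  order of summation matters; grouping by half-length leads back to power series.\<close>

lemma has_sum_graded:
  fixes f :: "operation list \<Rightarrow> real"
  assumes "(f has_sum S) {w. P w}" and ev: "\<And>w. P w \<Longrightarrow> even (length w)"
  shows "(\<lambda>n. \<Sum>w | P w \<and> length w = 2 * n. f w) sums S"
proof -
  let ?B = "\<lambda>n. {w. P w \<and> length w = 2 * n}"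
  have bij: "bij_betw snd (Sigma UNIV ?B) {w. P w}" by (rule bij_betw_graded[OF ev])
  have "((\<lambda>x. f (snd x)) has_sum S) (Sigma UNIV ?B)"
    using assms(1) has_sum_reindex_bij_betw[OF bij, of f S] by simp
  then have "((\<lambda>n. \<Sum>w\<in>?B n. f w) has_sum S) UNIV"
    by (rule has_sum_SigmaD) (auto intro!: has_sum_finiteI finite_words)
  then show ?thesis by (rule has_sum_imp_sums)
qed

lemma summable_on_graded:
  fixes f :: "operation list \<Rightarrow> real"
  assumes "summable (\<lambda>n. \<Sum>w | P w \<and> length w = 2 * n. f w)" "\<And>w. P w \<Longrightarrow> 0 \<le> f w"
    and ev: "\<And>w. P w \<Longrightarrow> even (length w)"
  shows "f summable_on {w. P w}"
proof -
  let ?B = "\<lambda>n. {w. P w \<and> length w = 2 * n}"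
  have bij: "bij_betw snd (Sigma UNIV ?B) {w. P w}" by (rule bij_betw_graded[OF ev])
  have "(\<lambda>n. \<Sum>w\<in>?B n. f w) summable_on UNIV"
    by (rule summable_nonneg_imp_summable_on[OF assms(1)]) (auto intro!: sum_nonneg assms(2))
  then have "(\<lambda>x. f (snd x)) summable_on (Sigma UNIV ?B)"
    by (rule summable_on_SigmaI[rotated]) (auto intro!: has_sum_finiteI finite_words assms(2))
  then show ?thesis using summable_on_reindex_bij_betw[OF bij, of f] by simp
qed

lemma has_sum_times:
  fixes f g :: "_ \<Rightarrow> real"
  assumes "(f has_sum a) A" "(g has_sum b) B"
  shows "((\<lambda>(x, y). f x * g y) has_sum (a * b)) (A \<times> B)"
proof (rule has_sum_SigmaI)
  show "((\<lambda>y. (case (x, y) of (x, y) \<Rightarrow> f x * g y)) has_sum (f x * b)) B" for x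
    using has_sum_cmult_right[OF assms(2), of "f x"] by simp
  show "((\<lambda>x. f x * b) has_sum (a * b)) A" using has_sum_cmult_left[OF assms(1), of b] .
  have fa: "(\<lambda>x. norm (f x)) summable_on A" and ga: "(\<lambda>x. norm (g x)) summable_on B"
    using assms summable_on_iff_abs_summable_on_real has_sum_imp_summable by blast+
  have "(\<lambda>z. norm (case z of (x, y) \<Rightarrow> f x * g y)) summable_on A \<times> B"
  proof (rule summable_on_SigmaI)
    show "((\<lambda>y. norm (case (x, y) of (x, y) \<Rightarrow> f x * g y)) has_sum
        (norm (f x) * infsum (\<lambda>y. norm (g y)) B)) B" for x
      using has_sum_cmult_right[OF has_sum_infsum[OF ga], of "norm (f x)"] by (simp add: abs_mult)
    show "(\<lambda>x. norm (f x) * infsum (\<lambda>y. norm (g y)) B) summable_on A"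
      by (rule summable_on_cmult_left[OF fa])
  qed auto
  then show "(\<lambda>(x, y). f x * g y) summable_on A \<times> B" by (rule abs_summable_summable)
qed

lemma has_sum_lists:
  fixes \<omega> :: "'b \<Rightarrow> 'a \<Rightarrow> real"
  assumes "\<And>b. (\<omega> b has_sum S b) A"
  shows "((\<lambda>gs. \<Prod>(b, g)\<leftarrow>zip bs gs. \<omega> b g) has_sum (\<Prod>b\<leftarrow>bs. S b))
    {gs. length gs = length bs \<and> set gs \<subseteq> A}"
proof (induction bs)
  case Nil
  have "{gs. length gs = length [] \<and> set gs \<subseteq> A} = {[]}" by auto
  then show ?case using has_sum_finite[of "{[]}" "\<lambda>gs. \<Prod>(b, g)\<leftarrow>zip [] gs. \<omega> b g"] by simp
next
  case (Cons b bs)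
  let ?L = "{gs. length gs = length bs \<and> set gs \<subseteq> A}"
  let ?f = "\<lambda>gs. \<Prod>(b, g)\<leftarrow>zip (b # bs) gs. \<omega> b g"
  have bij: "bij_betw (\<lambda>(g, gs). g # gs) (A \<times> ?L) {gs. length gs = length (b # bs) \<and> set gs \<subseteq> A}"
  proof (rule bij_betw_imageI)
    show "inj_on (\<lambda>(g, gs). g # gs) (A \<times> ?L)" by (auto simp: inj_on_def)
    show "(\<lambda>(g, gs). g # gs) ` (A \<times> ?L) = {gs. length gs = length (b # bs) \<and> set gs \<subseteq> A}"
      by (force simp: length_Suc_conv image_iff)
  qed
  have "((\<lambda>(g, gs). \<omega> b g * (\<Prod>(b, g)\<leftarrow>zip bs gs. \<omega> b g)) has_sum (S b * (\<Prod>b\<leftarrow>bs. S b))) (A \<times> ?L)"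
    by (rule has_sum_times[OF assms Cons.IH])
  then have "((\<lambda>z. ?f (case z of (g, gs) \<Rightarrow> g # gs)) has_sum (\<Prod>b\<leftarrow>b # bs. S b)) (A \<times> ?L)"
    by (simp add: case_prod_unfold)
  then show ?case using has_sum_reindex_bij_betw[OF bij, of ?f] by simp
qed

lemma prod_list_flags:
  "(\<Prod>b\<leftarrow>bs. if b then x else y) = x ^ count_list bs True * (y :: real) ^ (length bs - count_list bs True)"
proof (induction bs)
  case (Cons b bs)
  have "count_list bs True \<le> length bs" by (rule count_le_length)
  then show ?case using Cons by (auto simp: Suc_diff_le)
qed simp

text \<open>Common source of both kernel equations. An empty gap at a mismatch of the skeleton has
  weight \<open>\<alpha>\<close> in place of 1, so such a gap contributes
  \<open>F - 1 + \<alpha>\<close> and any other gap \<open>F\<close>. Loops use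
  \<open>\<alpha> = a\<close>, canonical sequences \<open>\<alpha> = 0\<close>; the factor
  \<open>\<gamma>\<close> weighs the skeleton.\<close>

lemma has_sum_decompositions:
  fixes W \<gamma> :: "operation list \<Rightarrow> real"
  assumes W: "(W has_sum F) {w. balanced w}" and W0: "W [] = 1"
    and W_interlace: "\<And>zs. decomposition zs \<Longrightarrow> W (interlace zs) = \<gamma> (map fst zs) *
      (\<Prod>(b, g)\<leftarrow>zip (mismatch_flags (map fst zs)) (map snd zs). if b \<and> g = [] then \<alpha> else W g)"
  shows "((\<lambda>c. \<gamma> c * ((F - 1 + \<alpha>) ^ mismatches c * F ^ (length c - mismatches c))) has_sum (F - 1))
    {c. irreducible_word c}"
proof -
  let ?\<omega> = "\<lambda>b g. if b \<and> g = [] then \<alpha> else W g"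
  let ?L = "\<lambda>c. {gs. length gs = length (mismatch_flags c) \<and> set gs \<subseteq> {w. balanced w}}"
  let ?P = "\<lambda>c gs. \<Prod>(b, g)\<leftarrow>zip (mismatch_flags c) gs. ?\<omega> b g"
  have 1: "(W has_sum (F - 1)) {w. balanced w \<and> w \<noteq> []}"
  proof -
    have "(W has_sum (F - W [])) ({w. balanced w} - {[]})"
      using has_sum_Diff[OF W, of "{[]}" "W []"] has_sum_finite[of "{[]}" W] by simp
    moreover have "{w. balanced w} - {[]} = {w. balanced w \<and> w \<noteq> []}" by auto
    ultimately show ?thesis using W0 by simp
  qed
  have 2: "((\<lambda>zs. W (interlace zs)) has_sum (F - 1)) {zs. decomposition zs}"
    using 1 has_sum_reindex_bij_betw[OF bij_betw_interlace, of W] by simp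
  have bij: "bij_betw (\<lambda>(c, gs). zip c gs) (Sigma {c. irreducible_word c} ?L) {zs. decomposition zs}"
  proof (rule bij_betw_imageI)
    show "inj_on (\<lambda>(c, gs). zip c gs) (Sigma {c. irreducible_word c} ?L)"
      by (auto simp: inj_on_def dest: arg_cong[where f = "map fst"] arg_cong[where f = "map snd"])
    show "(\<lambda>(c, gs). zip c gs) ` Sigma {c. irreducible_word c} ?L = {zs. decomposition zs}"
    proof (intro equalityI subsetI)
      fix zs assume "zs \<in> (\<lambda>(c, gs). zip c gs) ` Sigma {c. irreducible_word c} ?L"
      then obtain c gs where z: "zs = zip c gs" "irreducible_word c" "length gs = length c"
        "set gs \<subseteq> {w. balanced w}" by auto
      then have "map fst zs = c" "map snd zs = gs" by simp_all
      then show "zs \<in> {zs. decomposition zs}" using z by (auto simp: decomposition_def simp del: set_map)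
    next
      fix zs assume "zs \<in> {zs. decomposition zs}"
      then have d: "decomposition zs" by simp
      show "zs \<in> (\<lambda>(c, gs). zip c gs) ` Sigma {c. irreducible_word c} ?L"
      proof (rule image_eqI)
        show "zs = (case (map fst zs, map snd zs) of (c, gs) \<Rightarrow> zip c gs)" by (simp add: zip_map_fst_snd)
        show "(map fst zs, map snd zs) \<in> Sigma {c. irreducible_word c} ?L"
          using d by (auto simp: decomposition_def)
      qed
    qed
  qed
  have "((\<lambda>z. W (interlace (case z of (c, gs) \<Rightarrow> zip c gs))) has_sum (F - 1)) (Sigma {c. irreducible_word c} ?L)"
    using 2 has_sum_reindex_bij_betw[OF bij, of "\<lambda>zs. W (interlace zs)"] by simp
  then have 3: "((\<lambda>(c, gs). \<gamma> c * ?P c gs) has_sum (F - 1)) (Sigma {c. irreducible_word c} ?L)"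
  proof (rule has_sum_cong[THEN iffD1, rotated])
    fix z assume "z \<in> Sigma {c. irreducible_word c} ?L"
    then obtain c gs where z: "z = (c, gs)" "irreducible_word c" "length gs = length c"
      "set gs \<subseteq> {w. balanced w}" by auto
    then have m: "map fst (zip c gs) = c" "map snd (zip c gs) = gs" by simp_all
    then have "decomposition (zip c gs)" using z by (auto simp: decomposition_def simp del: set_map)
    from W_interlace[OF this] show "W (interlace (case z of (c, gs) \<Rightarrow> zip c gs)) = (case z of (c, gs) \<Rightarrow> \<gamma> c * ?P c gs)"
      unfolding m z(1) by simp
  qed
  have \<omega>: "(?\<omega> b has_sum (if b then F - 1 + \<alpha> else F)) {w. balanced w}" for b
  proof (cases b)
    case True
    have "((\<lambda>g. if g = [] then \<alpha> - 1 else 0) has_sum (\<alpha> - 1)) {w. balanced w}"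
      by (rule has_sum_cong_neutral[THEN iffD1, OF _ _ _ has_sum_finite[of "{[]}" "\<lambda>_. \<alpha> - 1", simplified]]) auto
    from has_sum_add[OF W this] have "((\<lambda>g. W g + (if g = [] then \<alpha> - 1 else 0)) has_sum (F - 1 + \<alpha>)) {w. balanced w}"
      by (simp add: algebra_simps)
    moreover have "W g + (if g = [] then \<alpha> - 1 else 0) = ?\<omega> b g" for g using True W0 by auto
    ultimately show ?thesis using True by simp
  qed (use W in simp)
  have 4: "((\<lambda>gs. ?P c gs) has_sum ((F - 1 + \<alpha>) ^ mismatches c * F ^ (length c - mismatches c))) (?L c)" for c
    using has_sum_lists[where \<omega> = ?\<omega> and S = "\<lambda>b. if b then F - 1 + \<alpha> else F" and A = "{w. balanced w}"
      and bs = "mismatch_flags c", OF \<omega>]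
    unfolding prod_list_flags mismatches_def[symmetric] by simp
  show ?thesis
  proof (rule has_sum_SigmaD[OF 3])
    fix c
    show "((\<lambda>gs. case (c, gs) of (c, gs) \<Rightarrow> \<gamma> c * ?P c gs) has_sum
        (\<gamma> c * ((F - 1 + \<alpha>) ^ mismatches c * F ^ (length c - mismatches c)))) (?L c)"
      unfolding prod.case by (rule has_sum_cmult_right[OF 4])
  qed
qed

text \<open>The coefficient of \<open>x ^ n\<close> in the kernel \<open>K(v, x)\<close>. Only
  skeletons that start in \<open>Stack1\<close> are counted, as canonical sequences demand.\<close>

definition kappa :: "nat \<Rightarrow> real poly" where
  "kappa n = (\<Sum>c | (irreducible_word c \<and> hd c = In Stack1) \<and> length c = 2 * n. monom 1 (mismatches c))"

lemma poly_kappa: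
  "poly (kappa n) v = (\<Sum>c | (irreducible_word c \<and> hd c = In Stack1) \<and> length c = 2 * n. v ^ mismatches c)"
  by (simp add: kappa_def poly_sum poly_monom)

definition swap_stack :: "stack \<Rightarrow> stack" where
  "swap_stack s = (case s of Stack1 \<Rightarrow> Stack2 | Stack2 \<Rightarrow> Stack1)"

lemma swap_stack [simp]: "swap_stack (swap_stack s) = s" "swap_stack Stack1 = Stack2" "swap_stack Stack2 = Stack1"
  by (auto simp: swap_stack_def split: stack.splits)

text \<open>Exchanging the stacks is an involution on irreducible words that keeps mismatches and
  exchanges the two possible first letters; hence the factor 2 in the equation of
  \<open>Q\<close>.\<close>

lemma poly_kappa_double:
  "(\<Sum>c | irreducible_word c \<and> length c = 2 * n. v ^ mismatches c) = 2 * poly (kappa n) v"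
proof -
  let ?A = "\<lambda>s. {c. (irreducible_word c \<and> hd c = In s) \<and> length c = 2 * n}"
  let ?r = "map (relabel swap_stack)"
  have rr: "relabel swap_stack (relabel swap_stack x) = x" for x by (cases x) auto
  have mis: "mismatches (?r c) = mismatches c" for c
    unfolding mismatches_def by (subst mismatch_flags_relabel) auto
  have irr: "irreducible_word (?r c)" if "irreducible_word c" for c
    by (rule irreducible_word_relabel) (use that in auto)
  have r2: "?r (?r c) = c" for c by (simp add: o_def rr)
  have mem: "?r c \<in> ?A (swap_stack s)" if "c \<in> ?A s" for c s
  proof -
    have "c \<noteq> []" using that by (auto simp: irreducible_word_def)
    then show ?thesis using that irr by (auto simp: hd_map)
  qed
  have bij: "bij_betw ?r (?A Stack1) (?A Stack2)"
  proof (rule bij_betwI)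
    show "?r \<in> ?A Stack1 \<rightarrow> ?A Stack2" "?r \<in> ?A Stack2 \<rightarrow> ?A Stack1"
      using mem[of _ Stack1] mem[of _ Stack2] unfolding swap_stack by blast+
  qed (use r2 in auto)
  have "{c. irreducible_word c \<and> length c = 2 * n} = ?A Stack1 \<union> ?A Stack2"
  proof -
    have "hd c = In Stack1 \<or> hd c = In Stack2" if irr: "irreducible_word c" for c
    proof -
      obtain s where "hd c = In s"
        by (rule balanced_hd[of c]) (use irr in \<open>auto simp: irreducible_word_def\<close>)
      then show ?thesis by (cases s) auto
    qed
    then show ?thesis by blast
  qed
  then have "(\<Sum>c | irreducible_word c \<and> length c = 2 * n. v ^ mismatches c) =
      (\<Sum>c\<in>?A Stack1. v ^ mismatches c) + (\<Sum>c\<in>?A Stack2. v ^ mismatches c)"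
    by (simp only:) (rule sum.union_disjoint, auto intro!: finite_words)
  also have "(\<Sum>c\<in>?A Stack2. v ^ mismatches c) = (\<Sum>c\<in>?A Stack1. v ^ mismatches c)"
    using sum.reindex_bij_betw[OF bij, of "\<lambda>c. v ^ mismatches c"] by (simp add: mis)
  finally show ?thesis by (simp add: poly_kappa)
qed

lemma irreducible_length_pos: "irreducible_word c \<Longrightarrow> length c \<noteq> 0"
  by (simp add: irreducible_word_def)

lemma kappa_0: "kappa 0 = 0"
  unfolding kappa_def using irreducible_length_pos by (intro sum.neutral) auto

lemma balanced_single_arch: "balanced [In s, Out s]"
proof -
  have "0 \<le> height t (take k [In s, Out s])" for t k by (cases k; cases "k - 1") auto
  then show ?thesis by (simp add: balanced_def stack_balanced_def)
qed

lemma irreducible_single_arch: "irreducible_word [In s, Out s]"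
  unfolding irreducible_word_def
proof (intro conjI allI impI)
  show "balanced [In s, Out s]" by (rule balanced_single_arch)
  fix p f q assume a: "[In s, Out s] = p @ f @ q \<and> p \<noteq> [] \<and> balanced f"
  then obtain p' where "p = In s # p'" "[Out s] = p' @ f @ q" by (cases p) auto
  then have "f = [] \<or> f = [Out s]" by (cases p'; cases f) auto
  then show "f = []" using a balanced_even_length[of f] by auto
qed simp

lemma kappa_1: "kappa 1 = 1"
proof -
  have "{c. (irreducible_word c \<and> hd c = In Stack1) \<and> length c = 2 * 1} = {[In Stack1, Out Stack1]}"
  proof (intro equalityI subsetI)
    fix c assume "c \<in> {c. (irreducible_word c \<and> hd c = In Stack1) \<and> length c = 2 * 1}"
    then have c: "balanced c" "hd c = In Stack1" "length c = 2" by (auto simp: irreducible_word_def)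
    then obtain y where y: "c = [In Stack1, y]" by (auto simp: length_Suc_conv numeral_2_eq_2)
    have "height Stack1 c = 0" using c by (simp add: balanced_def stack_balanced_def)
    then have "y = Out Stack1" using y by (auto split: if_splits)
    then show "c \<in> {[In Stack1, Out Stack1]}" using y by simp
  qed (use irreducible_single_arch[of Stack1] in auto)
  moreover have "mismatches [In Stack1, Out Stack1] = 0" by (simp add: mismatches_def mismatch_def)
  ultimately show ?thesis by (simp add: kappa_def)
qed

lemma coeff_kappa_nonneg: "0 \<le> coeff (kappa n) k"
  unfolding kappa_def coeff_sum by (intro sum_nonneg) simp

section \<open>The kernel equation of the loops\<close>

lemma poly_Q_coeff:
  "poly (Q_coeff n) a = (\<Sum>w | balanced w \<and> length w = 2 * n. a ^ mismatches w)"
  by (simp add: Q_coeff_eq poly_sum poly_monom)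

text \<open>Each of the at most \<open>4 ^ (2 * n)\<close> words of length \<open>2 * n\<close> has
  weight at most \<open>u ^ n\<close> in absolute value, whence 1/16. This crude bound only has to
  provide an interval from which analytic continuation can start.\<close>

lemma sums_Q_coeff:
  fixes a u :: real
  assumes a: "\<bar>a\<bar> \<le> 1" and u: "0 \<le> u" "u < 1 / 16"
  shows "((\<lambda>w. u ^ (length w div 2) * a ^ mismatches w) has_sum (\<Sum>n. poly (Q_coeff n) a * u ^ n)) {w. balanced w}"
    and "summable (\<lambda>n. poly (Q_coeff n) a * u ^ n)"
proof -
  let ?W = "\<lambda>w. u ^ (length w div 2) * a ^ mismatches w"
  have le: "(\<Sum>w | balanced w \<and> length w = 2 * n. \<bar>?W w\<bar>) \<le> (16 * u) ^ n" for n
  proof -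
    have "(\<Sum>w | balanced w \<and> length w = 2 * n. \<bar>?W w\<bar>) \<le> (\<Sum>w | balanced w \<and> length w = 2 * n. u ^ n)"
    proof (rule sum_mono)
      fix w assume "w \<in> {w. balanced w \<and> length w = 2 * n}"
      then have "\<bar>?W w\<bar> = u ^ n * \<bar>a\<bar> ^ mismatches w" using u by (simp add: abs_mult power_abs)
      also have "\<dots> \<le> u ^ n * 1" using a u by (intro mult_left_mono power_le_one) auto
      finally show "\<bar>?W w\<bar> \<le> u ^ n" by simp
    qed
    also have "\<dots> = real (card {w. balanced w \<and> length w = 2 * n}) * u ^ n" by simp
    also have "\<dots> \<le> real (4 ^ (2 * n)) * u ^ n"
      using card_words_le[of balanced "2 * n"] u by (intro mult_right_mono) (auto simp: of_nat_le_iff simp del: of_nat_power)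
    also have "\<dots> = (16 * u) ^ n" by (simp add: power_mult power_mult_distrib)
    finally show ?thesis .
  qed
  have "summable (\<lambda>n. \<Sum>w | balanced w \<and> length w = 2 * n. \<bar>?W w\<bar>)"
  proof (rule summable_comparison_test'[where N = 0])
    show "summable (\<lambda>n. (16 * u) ^ n)" using u by (intro summable_geometric) auto
    show "norm (\<Sum>w | balanced w \<and> length w = 2 * n. \<bar>?W w\<bar>) \<le> (16 * u) ^ n" for n
      using le[of n] by (simp add: sum_nonneg)
  qed
  then have "(\<lambda>w. \<bar>?W w\<bar>) summable_on {w. balanced w}"
    by (rule summable_on_graded) (auto dest: balanced_even_length)
  then have "?W summable_on {w. balanced w}" using summable_on_iff_abs_summable_on_real by force
  then obtain S where S: "(?W has_sum S) {w. balanced w}" by (auto simp: summable_on_def)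
  have "(\<lambda>n. \<Sum>w | balanced w \<and> length w = 2 * n. ?W w) sums S"
    by (rule has_sum_graded[OF S]) (rule balanced_even_length)
  also have "(\<lambda>n. \<Sum>w | balanced w \<and> length w = 2 * n. ?W w) = (\<lambda>n. poly (Q_coeff n) a * u ^ n)"
    unfolding poly_Q_coeff sum_distrib_right by (intro ext sum.cong) auto
  finally have s: "(\<lambda>n. poly (Q_coeff n) a * u ^ n) sums S" .
  show "summable (\<lambda>n. poly (Q_coeff n) a * u ^ n)" using s by (rule sums_summable)
  show "(?W has_sum (\<Sum>n. poly (Q_coeff n) a * u ^ n)) {w. balanced w}" using S sums_unique[OF s] by simp
qed

lemma half_length_interlace:
  assumes "decomposition zs"
  shows "length (interlace zs) div 2 = length (map fst zs) div 2 + (\<Sum>g\<leftarrow>map snd zs. length g div 2)"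
proof -
  have bal: "\<forall>g\<in>set (map snd zs). balanced g" "even (length (map fst zs))"
    using assms balanced_even_length[of "map fst zs"] by (auto simp: decomposition_def irreducible_word_def)
  have "length (interlace zs) = length (map fst zs) + 2 * (\<Sum>g\<leftarrow>map snd zs. length g div 2)"
    using bal(1)
  proof (induction zs rule: interlace.induct)
    case (2 x g zs)
    have "even (length g)" using 2(2) balanced_even_length by simp
    then have "length g = 2 * (length g div 2)" by simp
    then show ?case using 2 by simp
  qed simp
  then show ?thesis using bal(2) by simp
qed

lemma prod_list_zip_split:
  fixes h :: "'a \<Rightarrow> nat" and k :: "'b \<Rightarrow> 'a \<Rightarrow> nat" and a u :: real
  assumes "length bs = length gs"
  shows "(\<Prod>(b, g)\<leftarrow>zip bs gs. u ^ h g * a ^ k b g) = u ^ (\<Sum>g\<leftarrow>gs. h g) * a ^ (\<Sum>(b, g)\<leftarrow>zip bs gs. k b g)"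
  using assms by (induction bs gs rule: list_induct2) (auto simp: power_add algebra_simps)

text \<open>A skeleton of length \<open>2 * n\<close> with \<open>m\<close> mismatches contributes
  \<open>(F - 1 + \<alpha>) ^ m * F ^ (2 * n - m)\<close>. Taking out \<open>F ^ (2 * n)\<close>
  leaves a power of \<open>1 - (1 - \<alpha>) / F\<close>; these are the two arguments of the
  kernel.\<close>

lemma sums_kappa:
  fixes F :: real
  assumes s: "((\<lambda>c. u ^ (length c div 2) * ((F - 1 + \<alpha>) ^ mismatches c * F ^ (length c - mismatches c))) has_sum S)
    {c. P c}" and P: "\<And>c. P c \<Longrightarrow> balanced c" and F: "F \<noteq> 0"
  shows "(\<lambda>n. (\<Sum>c | P c \<and> length c = 2 * n. (1 - (1 - \<alpha>) / F) ^ mismatches c) * (u * F\<^sup>2) ^ n) sums S"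
proof -
  have "(\<lambda>n. \<Sum>c | P c \<and> length c = 2 * n. u ^ (length c div 2) *
      ((F - 1 + \<alpha>) ^ mismatches c * F ^ (length c - mismatches c))) sums S"
    by (rule has_sum_graded[OF s]) (use P balanced_even_length in blast)
  also have "(\<lambda>n. \<Sum>c | P c \<and> length c = 2 * n. u ^ (length c div 2) *
      ((F - 1 + \<alpha>) ^ mismatches c * F ^ (length c - mismatches c))) =
    (\<lambda>n. (\<Sum>c | P c \<and> length c = 2 * n. (1 - (1 - \<alpha>) / F) ^ mismatches c) * (u * F\<^sup>2) ^ n)"
    unfolding sum_distrib_right
  proof (intro ext sum.cong refl)
    fix n c assume c: "c \<in> {c. P c \<and> length c = 2 * n}"
    have "F - 1 + \<alpha> = F * (1 - (1 - \<alpha>) / F)" using F by (simp add: field_simps)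
    then have "(F - 1 + \<alpha>) ^ mismatches c * F ^ (length c - mismatches c) =
      (1 - (1 - \<alpha>) / F) ^ mismatches c * F ^ (mismatches c + (length c - mismatches c))"
      by (simp add: power_mult_distrib power_add)
    also have "mismatches c + (length c - mismatches c) = 2 * n"
      using mismatches_le_length[of c] c by simp
    finally show "u ^ (length c div 2) * ((F - 1 + \<alpha>) ^ mismatches c * F ^ (length c - mismatches c)) =
      (1 - (1 - \<alpha>) / F) ^ mismatches c * (u * F\<^sup>2) ^ n"
      using c by (simp add: power_mult power_mult_distrib)
  qed
  finally show ?thesis .
qed

theorem Q_functional_equation:
  fixes a u Q :: real
  assumes a: "\<bar>a\<bar> \<le> 1" and u: "0 \<le> u" "u < 1 / 16"
    and Q: "Q = (\<Sum>n. poly (Q_coeff n) a * u ^ n)" and Q0: "Q \<noteq> 0"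
  shows "(\<lambda>n. 2 * poly (kappa n) (1 - (1 - a) / Q) * (u * Q\<^sup>2) ^ n) sums (Q - 1)"
proof -
  let ?W = "\<lambda>w. u ^ (length w div 2) * a ^ mismatches w"
  have W: "(?W has_sum Q) {w. balanced w}" using sums_Q_coeff(1)[OF a u] Q by simp
  have "((\<lambda>c. u ^ (length c div 2) * ((Q - 1 + a) ^ mismatches c * Q ^ (length c - mismatches c))) has_sum (Q - 1))
    {c. irreducible_word c}"
  proof (rule has_sum_decompositions[OF W])
    fix zs assume d: "decomposition zs"
    let ?bs = "mismatch_flags (map fst zs)" and ?gs = "map snd zs"
    have bal: "\<forall>g\<in>set ?gs. balanced g" using d by (simp add: decomposition_def)
    let ?k = "\<lambda>b g. if g = [] then of_bool b else mismatches g"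
    have "(\<Prod>(b, g)\<leftarrow>zip ?bs ?gs. if b \<and> g = [] then a else ?W g) =
        (\<Prod>(b, g)\<leftarrow>zip ?bs ?gs. u ^ (length g div 2) * a ^ ?k b g)"
      by (intro arg_cong[where f = prod_list] map_cong refl) auto
    also have "\<dots> = u ^ (\<Sum>g\<leftarrow>?gs. length g div 2) * a ^ mismatches (interlace zs)"
      unfolding mismatches_interlace[OF bal] by (rule prod_list_zip_split) simp
    finally show "?W (interlace zs) = u ^ (length (map fst zs) div 2) *
        (\<Prod>(b, g)\<leftarrow>zip ?bs ?gs. if b \<and> g = [] then a else ?W g)"
      unfolding half_length_interlace[OF d] by (simp add: power_add)
  qed simp
  from sums_kappa[OF this _ Q0] have "(\<lambda>n. (\<Sum>c | irreducible_word c \<and> length c = 2 * n.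
      (1 - (1 - a) / Q) ^ mismatches c) * (u * Q\<^sup>2) ^ n) sums (Q - 1)"
    by (simp add: irreducible_word_def)
  then show ?thesis unfolding poly_kappa_double .
qed

section \<open>The kernel equation of the canonical sequences\<close>

lemma canonical_Nil: "canonical []"
  by (simp add: canonical_iff rooted_def arch_def arch_of_def)

lemma canonical_has_sum:
  fixes t :: real
  assumes t: "0 \<le> t" and s: "summable (\<lambda>n. s_coeff n * t ^ n)"
  shows "((\<lambda>w. t ^ (length w div 2)) has_sum (\<Sum>n. s_coeff n * t ^ n)) {w. canonical w}"
proof -
  have ev: "canonical w \<Longrightarrow> even (length w)" for w using balanced_even_length canonical_iff by blast
  have eq: "(\<Sum>w | canonical w \<and> length w = 2 * n. t ^ (length w div 2)) = s_coeff n * t ^ n" for n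
    by (simp add: s_coeff_eq)
  have "(\<lambda>w. t ^ (length w div 2)) summable_on {w. canonical w}"
  proof (rule summable_on_graded)
    show "summable (\<lambda>n. \<Sum>w | canonical w \<and> length w = 2 * n. t ^ (length w div 2))"
      unfolding eq by (rule s)
  qed (use t ev in auto)
  then obtain S where S: "((\<lambda>w. t ^ (length w div 2)) has_sum S) {w. canonical w}" by (auto simp: summable_on_def)
  from has_sum_graded[OF S ev] have "(\<lambda>n. s_coeff n * t ^ n) sums S" unfolding eq .
  then show ?thesis using S sums_unique by metis
qed

text \<open>Balanced words that are not canonical get weight 0. By
  \<open>canonical_interlace\<close> this weight is multiplicative once skeletons that start in
  \<open>Stack2\<close>, and empty gaps at mismatches, also get weight 0.\<close>

theorem S_functional_equation:
  fixes t S :: real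
  assumes t: "0 \<le> t" and s: "summable (\<lambda>n. s_coeff n * t ^ n)"
    and S: "S = (\<Sum>n. s_coeff n * t ^ n)" and S0: "S \<noteq> 0"
  shows "(\<lambda>n. poly (kappa n) (1 - 1 / S) * (t * S\<^sup>2) ^ n) sums (S - 1)"
proof -
  let ?W = "\<lambda>w. if canonical w then t ^ (length w div 2) else 0"
  have W: "(?W has_sum S) {w. balanced w}"
    by (rule has_sum_cong_neutral[THEN iffD1, OF _ _ _ canonical_has_sum[OF t s, folded S]])
       (auto simp: canonical_iff)
  let ?\<gamma> = "\<lambda>c. if hd c = In Stack1 then t ^ (length c div 2) else 0"
  have "((\<lambda>c. ?\<gamma> c * ((S - 1 + 0) ^ mismatches c * S ^ (length c - mismatches c))) has_sum (S - 1))
    {c. irreducible_word c}"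
  proof (rule has_sum_decompositions[OF W])
    fix zs assume d: "decomposition zs"
    let ?bs = "mismatch_flags (map fst zs)" and ?gs = "map snd zs"
    have len: "length ?bs = length ?gs" by simp
    have ne: "zs \<noteq> []" using d by (auto simp: decomposition_def irreducible_word_def)
    have *: "(\<Prod>(b, g)\<leftarrow>zip bs gs. if b \<and> g = [] then 0 else ?W g) =
       (if (\<forall>g\<in>set gs. canonical g) \<and> (\<forall>(b, g)\<in>set (zip bs gs). b \<longrightarrow> g \<noteq> [])
        then t ^ (\<Sum>g\<leftarrow>gs. length g div 2) else 0)" if "length bs = length gs" for bs :: "bool list" and gs
      using that by (induction bs gs rule: list_induct2) (auto simp: power_add)
    show "?W (interlace zs) = ?\<gamma> (map fst zs) * (\<Prod>(b, g)\<leftarrow>zip ?bs ?gs. if b \<and> g = [] then 0 else ?W g)"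
      unfolding *[OF len] canonical_interlace[OF d] half_length_interlace[OF d]
      using ne by (simp add: power_add hd_map)
  qed (simp add: canonical_Nil)
  then have "((\<lambda>c. t ^ (length c div 2) * ((S - 1 + 0) ^ mismatches c * S ^ (length c - mismatches c))) has_sum (S - 1))
    {c. irreducible_word c \<and> hd c = In Stack1}"
    by (rule has_sum_cong_neutral[THEN iffD1, rotated -1]) auto
  from sums_kappa[OF this _ S0] show ?thesis unfolding poly_kappa
    by (simp add: irreducible_word_def)
qed

section \<open>Factorisation of canonical sequences into primitive ones\<close>

lemma primitive_iff:
  "primitive w \<longleftrightarrow> w \<noteq> [] \<and> \<not> (\<exists>u v. balanced u \<and> balanced v \<and> u \<noteq> [] \<and> v \<noteq> [] \<and> w = u @ v)"
  by (simp add: primitive_def operation_sequence_iff_balanced)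

lemma primitive_prefix_exists:
  assumes "balanced w" "w \<noteq> []"
  shows "\<exists>u v. w = u @ v \<and> balanced u \<and> balanced v \<and> primitive u"
  using assms
proof (induction w rule: length_induct)
  case (1 w)
  show ?case
  proof (cases "primitive w")
    case True
    then show ?thesis using 1 by (intro exI[of _ w] exI[of _ "[]"]) auto
  next
    case False
    then obtain u v where uv: "balanced u" "balanced v" "u \<noteq> []" "v \<noteq> []" "w = u @ v"
      using 1(3) unfolding primitive_iff by blast
    then obtain u1 u2 where "u = u1 @ u2" "balanced u1" "balanced u2" "primitive u1"
      using 1(1)[rule_format, of u] by auto
    then show ?thesis using uv balanced_append by (intro exI[of _ u1] exI[of _ "u2 @ v"]) auto
  qed
qed

lemma primitive_prefix_unique:
  assumes "u @ v = u' @ v'" "balanced u" "balanced u'" "primitive u" "primitive u'"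
  shows "u = u'"
proof -
  have *: "r = []" if "u' = u @ r" "balanced u" "balanced u'" "primitive u" "primitive u'" for u u' r
    using that balanced_cancel_left[of u r] unfolding primitive_iff by metis
  from assms(1) show ?thesis unfolding append_eq_append_conv2 using * assms by (metis append_Nil2)
qed

lemma bij_betw_primitive:
  "bij_betw (\<lambda>(u, v). u @ v) ({u. canonical u \<and> primitive u} \<times> {v. canonical v}) {w. canonical w \<and> w \<noteq> []}"
proof (rule bij_betw_imageI)
  show "inj_on (\<lambda>(u, v). u @ v) ({u. canonical u \<and> primitive u} \<times> {v. canonical v})"
  proof (rule inj_onI, clarify)
    fix u v u' v' assume a: "canonical u" "primitive u" "canonical v" "canonical u'" "primitive u'" "canonical v'"
      "u @ v = u' @ v'"
    then have "u = u'" using primitive_prefix_unique canonical_iff by blast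
    then show "u = u' \<and> v = v'" using a by simp
  qed
  show "(\<lambda>(u, v). u @ v) ` ({u. canonical u \<and> primitive u} \<times> {v. canonical v}) = {w. canonical w \<and> w \<noteq> []}"
  proof (intro equalityI subsetI)
    fix w assume "w \<in> (\<lambda>(u, v). u @ v) ` ({u. canonical u \<and> primitive u} \<times> {v. canonical v})"
    then obtain u v where *: "w = u @ v" "canonical u" "primitive u" "canonical v" by auto
    then have "u \<noteq> []" by (simp add: primitive_def)
    then show "w \<in> {w. canonical w \<and> w \<noteq> []}" using * canonical_append[of u v] by (simp add: canonical_iff)
  next
    fix w assume "w \<in> {w. canonical w \<and> w \<noteq> []}"
    then have w: "canonical w" "balanced w" "w \<noteq> []" by (auto simp: canonical_iff)
    then obtain u v where uv: "w = u @ v" "balanced u" "balanced v" "primitive u"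
      using primitive_prefix_exists by blast
    then have "canonical u" "canonical v" using w canonical_append by auto
    then show "w \<in> (\<lambda>(u, v). u @ v) ` ({u. canonical u \<and> primitive u} \<times> {v. canonical v})"
      using uv by (force intro: image_eqI[of _ _ "(u, v)"])
  qed
qed

lemma s_prim_coeff_le: "s_prim_coeff n \<le> s_coeff n"
  unfolding s_prim_coeff_def s_coeff_eq of_nat_le_iff
  by (rule card_mono[OF finite_words]) auto

lemma s_prim_coeff_nonneg: "0 \<le> s_prim_coeff n"
  by (simp add: s_prim_coeff_def)

lemma s_coeff_nonneg: "0 \<le> s_coeff n"
  by (simp add: s_coeff_def)

lemma summable_s_prim:
  fixes t :: real
  assumes "0 \<le> t" "summable (\<lambda>n. s_coeff n * t ^ n)"
  shows "summable (\<lambda>n. s_prim_coeff n * t ^ n)"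
  by (rule summable_comparison_test'[OF assms(2), of 0])
     (use assms s_prim_coeff_le s_prim_coeff_nonneg in \<open>auto intro!: mult_right_mono\<close>)

text \<open>A non-empty canonical word has exactly one primitive balanced prefix, and both this
  prefix and the rest are canonical because no component straddles the cut.\<close>

theorem S_eq_S_prim:
  fixes t S :: real
  assumes t: "0 \<le> t" and s: "summable (\<lambda>n. s_coeff n * t ^ n)" and S: "S = (\<Sum>n. s_coeff n * t ^ n)"
  shows "S - 1 = S_prim t * S"
proof -
  let ?f = "\<lambda>w :: operation list. t ^ (length w div 2)"
  let ?P = "{u. canonical u \<and> primitive u}"
  have c: "(?f has_sum S) {w. canonical w}" using canonical_has_sum[OF t s] S by simp
  have "?f summable_on ?P"
    using has_sum_imp_summable[OF c] by (rule summable_on_subset_banach) auto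
  then obtain p where p: "(?f has_sum p) ?P" by (auto simp: summable_on_def)
  have ev: "canonical w \<Longrightarrow> even (length w)" for w using balanced_even_length canonical_iff by blast
  have "(\<lambda>n. \<Sum>w | (canonical w \<and> primitive w) \<and> length w = 2 * n. ?f w) sums p"
    by (rule has_sum_graded[OF p]) (use ev in blast)
  moreover have eq: "(\<Sum>w | (canonical w \<and> primitive w) \<and> length w = 2 * n. ?f w) = s_prim_coeff n * t ^ n" for n
    by (simp add: s_prim_coeff_def conj_assoc)
  ultimately have "(\<lambda>n. s_prim_coeff n * t ^ n) sums p" unfolding eq by simp
  from sums_unique[OF this] have "S_prim t = p" unfolding S_prim_def by simp
  have "((\<lambda>(u, v). ?f u * ?f v) has_sum (p * S)) (?P \<times> {v. canonical v})" by (rule has_sum_times[OF p c])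
  then have "((\<lambda>z. ?f (case z of (u, v) \<Rightarrow> u @ v)) has_sum (p * S)) (?P \<times> {v. canonical v})"
  proof (rule has_sum_cong[THEN iffD1, rotated], clarify)
    fix u v assume "canonical u" "canonical v"
    then have "even (length u)" using ev by blast
    then show "?f u * ?f v = ?f (u @ v)" by (simp add: power_add[symmetric] div_plus_div_distrib_dvd_left)
  qed
  then have 1: "(?f has_sum (p * S)) {w. canonical w \<and> w \<noteq> []}"
    using has_sum_reindex_bij_betw[OF bij_betw_primitive, of ?f] by simp
  have "(?f has_sum (S - ?f [])) ({w. canonical w} - {[]})"
    using has_sum_Diff[OF c, of "{[]}" "?f []"] has_sum_finite[of "{[]}" ?f] canonical_Nil by simp
  moreover have "{w. canonical w} - {[]} = {w. canonical w \<and> w \<noteq> []}" by auto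
  ultimately have "p * S = S - 1" using has_sum_unique[OF 1] by simp
  then show ?thesis using \<open>S_prim t = p\<close> by simp
qed

lemma s_coeff_bounds: "1 \<le> s_coeff n" "s_coeff n \<le> 16 ^ n" "1 \<le> s_prim_coeff 1" "s_coeff 0 = 1"
proof -
  let ?a = "[In Stack1, Out Stack1]"
  have ca: "canonical ?a"
  proof -
    have "mismatches ?a = 0" by (simp add: mismatches_def mismatch_def)
    then show ?thesis using rooted_irreducible_word[OF irreducible_single_arch[of Stack1]] balanced_single_arch
      by (simp add: canonical_iff)
  qed
  have "\<exists>w. canonical w \<and> length w = 2 * n" for n
  proof (induction n)
    case 0
    then show ?case using canonical_Nil by (intro exI[of _ "[]"]) auto
  next
    case (Suc n)
    then obtain w where w: "canonical w" "length w = 2 * n" by blast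
    then have "canonical (?a @ w)" using canonical_append[of ?a w] ca by (simp add: canonical_iff)
    then show ?case using w by (intro exI[of _ "?a @ w"]) auto
  qed
  then have "{w. canonical w \<and> length w = 2 * n} \<noteq> {}" by blast
  then have "card {w. canonical w \<and> length w = 2 * n} \<noteq> 0" using finite_words card_0_eq by metis
  then show "1 \<le> s_coeff n" unfolding s_coeff_eq by simp
  have "card {w. canonical w \<and> length w = 2 * n} \<le> 16 ^ n"
    using card_words_le[of canonical "2 * n"] by (simp add: power_mult)
  then show "s_coeff n \<le> 16 ^ n" unfolding s_coeff_eq using of_nat_mono by fastforce
  have "{w. canonical w \<and> length w = 2 * 0} = {[]}" using canonical_Nil by auto
  then show "s_coeff 0 = 1" by (simp add: s_coeff_eq)
  have "primitive ?a" unfolding primitive_iff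
  proof (intro conjI notI)
    assume "\<exists>u v. balanced u \<and> balanced v \<and> u \<noteq> [] \<and> v \<noteq> [] \<and> ?a = u @ v"
    then obtain u v where uv: "balanced u" "u \<noteq> []" "v \<noteq> []" "?a = u @ v" by blast
    then have "length u + length v = 2" by (metis length_append list.size(3,4) One_nat_def Suc_1 add_Suc_right add_0_right)
    then have "length u = 1" using uv by (cases u; cases v) auto
    then show False using balanced_even_length[OF uv(1)] by simp
  qed simp
  then have "?a \<in> {w. canonical w \<and> primitive w \<and> length w = 2 * 1}" using ca by simp
  then have "card {w. canonical w \<and> primitive w \<and> length w = 2 * 1} \<noteq> 0"
    using finite_words[of "\<lambda>w. canonical w \<and> primitive w" "2 * 1"] by (metis (no_types, lifting) card_0_eq conj_assoc empty_iff Collect_cong)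
  then show "1 \<le> s_prim_coeff 1" unfolding s_prim_coeff_def by simp
qed

section \<open>Tools from complex analysis\<close>

text \<open>Identity theorem on the component of \<open>A\<close> that contains the segment. In the
  applications \<open>A\<close> is built from sublevel sets and may be disconnected.\<close>

lemma holomorphic_eq_on_segment:
  fixes f g :: "complex \<Rightarrow> complex" and r \<epsilon> :: real
  assumes "open A" "f holomorphic_on A" "g holomorphic_on A" "of_real ` {0..r} \<subseteq> A"
    and "0 < \<epsilon>" "\<And>t. 0 < t \<Longrightarrow> t < \<epsilon> \<Longrightarrow> t \<le> r \<Longrightarrow> f (of_real t) = g (of_real t)"
    and r: "0 < r" and t: "t \<in> {0..r}"
  shows "f (of_real t) = g (of_real t)"
proof -
  let ?C = "connected_component_set A 0"
  have "connected (complex_of_real ` {0..r})"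
    by (intro connected_continuous_image continuous_intros) simp
  moreover have "0 \<in> complex_of_real ` {0..r}" using r by force
  ultimately have sub: "complex_of_real ` {0..r} \<subseteq> ?C"
    using assms(4) by (intro connected_component_maximal)
  let ?U = "complex_of_real ` {0<..<min \<epsilon> r}"
  have U: "?U \<subseteq> ?C" using sub by (force simp: image_subset_iff)
  have lim: "(0::complex) islimpt ?U"
  proof (unfold islimpt_approachable, intro allI impI)
    fix e :: real assume "0 < e"
    define x where "x = min (e/2) (min \<epsilon> r / 2)"
    have "0 < x" "x < e" "x < min \<epsilon> r" using \<open>0 < e\<close> assms(5) r by (auto simp: x_def min_def)
    then show "\<exists>x'\<in>?U. x' \<noteq> 0 \<and> dist x' 0 < e"
      by (intro bexI[of _ "of_real x"]) auto
  qed
  have "f (of_real t) - g (of_real t) = 0"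
  proof (rule analytic_continuation[where f = "\<lambda>z. f z - g z" and U = ?U and \<xi> = 0 and S = ?C])
    show "(\<lambda>z. f z - g z) holomorphic_on ?C"
      by (intro holomorphic_intros holomorphic_on_subset[OF assms(2)] holomorphic_on_subset[OF assms(3)]
          connected_component_subset)
    show "open ?C" using assms(1) by (rule open_connected_component)
    show "(0::complex) \<in> ?C" using sub r by force
    show "of_real t \<in> ?C" using sub t by blast
    show "\<And>z. z \<in> ?U \<Longrightarrow> f z - g z = 0" using assms(6) by auto
  qed (use U lim in auto)
  then show ?thesis by simp
qed

lemma diffs_funpow: "(diffs ^^ k) a n = fact (n + k) / fact n * (a (n + k) :: complex)"
proof (induction k arbitrary: n)
  case (Suc k)
  have "(diffs ^^ Suc k) a n = of_nat (Suc n) * (fact (Suc n + k) / fact (Suc n) * a (Suc n + k))"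
    by (simp add: diffs_def Suc)
  also have "\<dots> = fact (n + Suc k) / fact n * a (n + Suc k)"
    by (simp add: field_simps del: of_nat_Suc)
  finally show ?case .
qed simp

lemma higher_deriv_power_series:
  fixes a :: "nat \<Rightarrow> complex"
  assumes "\<And>z. norm z < \<rho> \<Longrightarrow> summable (\<lambda>n. a n * z ^ n)" and z: "norm z < \<rho>"
  shows "(deriv ^^ k) (\<lambda>z. \<Sum>n. a n * z ^ n) z = (\<Sum>n. (diffs ^^ k) a n * z ^ n) \<and>
    summable (\<lambda>n. (diffs ^^ k) a n * z ^ n)"
  using z
proof (induction k arbitrary: z)
  case 0
  then show ?case using assms by simp
next
  case (Suc k)
  have s: "summable (\<lambda>n. (diffs ^^ k) a n * w ^ n)" if "norm w < \<rho>" for w using Suc.IH that by blast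
  have "deriv ((deriv ^^ k) (\<lambda>z. \<Sum>n. a n * z ^ n)) z = deriv (\<lambda>z. \<Sum>n. (diffs ^^ k) a n * z ^ n) z"
  proof (rule deriv_cong_ev)
    have "eventually (\<lambda>w. w \<in> ball 0 \<rho>) (nhds z)" using Suc.prems by (intro eventually_nhds_in_open) auto
    then show "eventually (\<lambda>w. (deriv ^^ k) (\<lambda>z. \<Sum>n. a n * z ^ n) w = (\<Sum>n. (diffs ^^ k) a n * w ^ n)) (nhds z)"
      by eventually_elim (use Suc.IH in auto)
  qed simp
  also have "\<dots> = (\<Sum>n. diffs ((diffs ^^ k) a) n * z ^ n)"
    by (rule DERIV_imp_deriv, rule termdiffs_strong'[of \<rho>]) (use s Suc.prems in auto)
  finally show ?case using termdiff_converges[OF Suc.prems s] by simp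
qed

text \<open>Pringsheim's theorem: the radius of convergence of a power series with nonnegative coefficients
  is a singularity. The series re-expanded at \<open>\<rho>/2\<close> has nonnegative coefficients again.\<close>

lemma pringsheim:
  fixes a :: "nat \<Rightarrow> real" and g :: "complex \<Rightarrow> complex"
  assumes a: "\<And>n. 0 \<le> a n" and \<rho>: "0 < \<rho>" and sm: "\<And>t. 0 \<le> t \<Longrightarrow> t < \<rho> \<Longrightarrow> summable (\<lambda>n. a n * t ^ n)"
    and g: "g holomorphic_on ball (of_real \<rho>) \<epsilon>" and \<epsilon>: "0 < \<epsilon>"
    and eq: "\<And>t. 0 < t \<Longrightarrow> \<rho> - \<epsilon> < t \<Longrightarrow> t < \<rho> \<Longrightarrow> g (of_real t) = of_real (\<Sum>n. a n * t ^ n)"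
  shows "\<exists>t>\<rho>. summable (\<lambda>n. a n * t ^ n)"
proof -
  define f where "f z = (\<Sum>n. of_real (a n) * z ^ n)" for z :: complex
  have smc: "summable (\<lambda>n. of_real (a n) * z ^ n :: complex)" if "norm z < \<rho>" for z
    by (rule summable_norm_cancel) (use sm[of "norm z"] that a in \<open>simp add: norm_mult norm_power\<close>)
  have f_real: "f (of_real t) = of_real (\<Sum>n. a n * t ^ n)" if "0 \<le> t" "t < \<rho>" for t
  proof -
    have "f (of_real t) = (\<Sum>n. of_real (a n * t ^ n))" by (simp add: f_def)
    also have "\<dots> = of_real (\<Sum>n. a n * t ^ n)" by (rule suminf_of_real[symmetric, OF sm[OF that]])
    finally show ?thesis .
  qed
  have holf: "f holomorphic_on ball 0 \<rho>"
  proof (unfold holomorphic_on_open[OF open_ball], intro ballI exI)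
    fix z :: complex assume "z \<in> ball 0 \<rho>"
    then show "(f has_field_derivative (\<Sum>n. diffs (\<lambda>n. of_real (a n)) n * z ^ n)) (at z)"
      unfolding f_def by (intro termdiffs_strong'[of \<rho>]) (use smc in auto)
  qed
  define I where "I = ball (0::complex) \<rho> \<inter> ball (of_real \<rho>) \<epsilon>"
  \<comment> \<open>The intersection of the two balls is convex, and both functions agree on a real
    interval inside it.\<close>
  have fg: "f z = g z" if "z \<in> I" for z
  proof -
    define s where "s = max (\<rho> - \<epsilon> / 2) (\<rho> / 2)"
    have s: "0 < s" "s < \<rho>" "\<rho> - \<epsilon> < s" using \<rho> \<epsilon> by (auto simp: s_def)
    let ?U = "complex_of_real ` {s<..<\<rho>}"
    have UI: "?U \<subseteq> I" using s by (auto simp: I_def dist_norm norm_minus_commute simp flip: of_real_diff)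
    define m where "m = (s + \<rho>) / 2"
    have mem: "of_real m \<in> ?U" using s by (intro imageI) (auto simp: m_def)
    have "f z - g z = 0"
    proof (rule analytic_continuation[where f = "\<lambda>z. f z - g z" and U = ?U and \<xi> = "of_real m" and S = I])
      show "(\<lambda>z. f z - g z) holomorphic_on I"
        unfolding I_def by (intro holomorphic_intros holomorphic_on_subset[OF holf] holomorphic_on_subset[OF g]) auto
      show "connected I" unfolding I_def by (intro convex_connected convex_Int convex_ball)
      show "of_real m islimpt ?U"
      proof (unfold islimpt_approachable, intro allI impI)
        fix e :: real assume "0 < e"
        define x where "x = m + min (e / 2) ((\<rho> - s) / 4)"
        have "s < x" "x < \<rho>" "m < x" "x < m + e"
          using \<open>0 < e\<close> s by (auto simp: x_def m_def min_def field_simps)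
        then show "\<exists>x'\<in>?U. x' \<noteq> of_real m \<and> dist x' (of_real m) < e"
          by (intro bexI[of _ "of_real x"]) (auto simp: dist_of_real dist_real_def)
      qed
      show "\<And>z. z \<in> ?U \<Longrightarrow> f z - g z = 0" using f_real eq s by auto
    qed (use UI mem that in \<open>auto simp: I_def\<close>)
    then show ?thesis by simp
  qed
  define h where "h z = (if z \<in> ball 0 \<rho> then f z else g z)" for z
  have holh: "h holomorphic_on (ball 0 \<rho> \<union> ball (of_real \<rho>) \<epsilon>)"
  proof (rule holomorphic_on_Un)
    show "h holomorphic_on ball 0 \<rho>" using holf by (rule holomorphic_transform) (simp add: h_def)
    show "h holomorphic_on ball (of_real \<rho>) \<epsilon>"
      using g by (rule holomorphic_transform) (use fg in \<open>auto simp: h_def I_def\<close>)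
  qed auto
  define p where "p = \<rho> / 2"
  \<comment> \<open>With \<open>p = \<rho> / 2\<close>, a point with \<open>|z| >= \<rho>\<close>
    and \<open>|z - p| < p + \<delta>\<close> satisfies
    \<open>|z - \<rho>|^2 < 2 \<rho> \<delta> + 2 \<delta>^2\<close>. The choice bounds each of the
    two terms by a quarter of \<open>\<epsilon>^2\<close>, so the larger ball about \<open>p\<close>
    fits into the union of the two domains.\<close>
  define \<delta> where "\<delta> = min \<rho> (\<epsilon>\<^sup>2 / (8 * \<rho>))"
  have \<delta>: "0 < \<delta>" "2 * \<rho> * \<delta> + 2 * \<delta>\<^sup>2 < \<epsilon>\<^sup>2"
  proof -
    show d0: "0 < \<delta>" using \<rho> \<epsilon> by (simp add: \<delta>_def)
    have "\<delta>\<^sup>2 \<le> \<rho> * \<delta>" using d0 by (simp add: power2_eq_square \<delta>_def)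
    moreover have "\<rho> * \<delta> \<le> \<rho> * (\<epsilon>\<^sup>2 / (8 * \<rho>))" using \<rho> by (intro mult_left_mono) (auto simp: \<delta>_def)
    moreover have "\<rho> * (\<epsilon>\<^sup>2 / (8 * \<rho>)) = \<epsilon>\<^sup>2 / 8" using \<rho> by simp
    moreover have "0 < \<epsilon>\<^sup>2" using \<epsilon> by simp
    ultimately show "2 * \<rho> * \<delta> + 2 * \<delta>\<^sup>2 < \<epsilon>\<^sup>2" by linarith
  qed
  have ball_sub: "ball (of_real p) (p + \<delta>) \<subseteq> ball 0 \<rho> \<union> ball (complex_of_real \<rho>) \<epsilon>"
  proof
    fix z assume z: "z \<in> ball (complex_of_real p) (p + \<delta>)"
    show "z \<in> ball 0 \<rho> \<union> ball (complex_of_real \<rho>) \<epsilon>"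
    proof (cases "norm z < \<rho>")
      case False
      have n: "(norm z)\<^sup>2 = (Re z)\<^sup>2 + (Im z)\<^sup>2" by (rule cmod_power2)
      have "\<rho>\<^sup>2 \<le> (norm z)\<^sup>2" using False \<rho> by (intro power_mono) auto
      then have 1: "\<rho>\<^sup>2 \<le> (Re z)\<^sup>2 + (Im z)\<^sup>2" using n by simp
      have "norm (z - of_real p) < p + \<delta>" using z by (simp add: dist_norm norm_minus_commute)
      then have "(norm (z - of_real p))\<^sup>2 < (p + \<delta>)\<^sup>2" by (intro power_strict_mono) auto
      then have "(Re z - p)\<^sup>2 + (Im z)\<^sup>2 < (p + \<delta>)\<^sup>2" by (simp add: cmod_power2)
      then have 2: "(Re z)\<^sup>2 + (Im z)\<^sup>2 - \<rho> * Re z < \<rho> * \<delta> + \<delta>\<^sup>2"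
        by (simp add: p_def power2_eq_square algebra_simps)
      have "(norm (z - of_real \<rho>))\<^sup>2 = (Re z)\<^sup>2 + (Im z)\<^sup>2 - 2 * (\<rho> * Re z) + \<rho>\<^sup>2"
      proof -
        have "(norm (z - of_real \<rho>))\<^sup>2 = (Re z - \<rho>)\<^sup>2 + (Im z)\<^sup>2" by (simp add: cmod_power2)
        then show ?thesis by (simp add: power2_eq_square algebra_simps)
      qed
      also have "\<dots> < 2 * \<rho> * \<delta> + 2 * \<delta>\<^sup>2" using 1 2 by linarith
      also have "\<dots> < \<epsilon>\<^sup>2" by (rule \<delta>(2))
      finally have "norm (z - of_real \<rho>) < \<epsilon>" using \<epsilon> by (meson power2_less_imp_less less_imp_le)
      then show ?thesis by (simp add: dist_norm norm_minus_commute)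
    qed simp
  qed
  define s where "s = p + \<delta> / 2"
  define c where "c k = (deriv ^^ k) f (of_real p) / fact k" for k
  have pos: "0 < p" "0 < s" "p < \<rho>" "p + s > \<rho>" using \<rho> \<delta> by (auto simp: p_def s_def)
  \<comment> \<open>The Taylor coefficients at \<open>p\<close> are sums of nonnegative real terms;
    this is where the sign of the coefficients enters.\<close>
  have c_eq: "c k = of_real (\<Sum>m. real (binomial (m + k) k) * a (m + k) * p ^ m) \<and>
     summable (\<lambda>m. real (binomial (m + k) k) * a (m + k) * p ^ m)" for k
  proof -
    have t: "(diffs ^^ k) (\<lambda>n. complex_of_real (a n)) n * of_real p ^ n =
        fact k * of_real (real (binomial (n + k) k) * a (n + k) * p ^ n)" for n
      by (simp add: diffs_funpow binomial_fact)
    have hd: "(deriv ^^ k) f (of_real p) = (\<Sum>n. (diffs ^^ k) (\<lambda>n. complex_of_real (a n)) n * of_real p ^ n)"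
      "summable (\<lambda>n. (diffs ^^ k) (\<lambda>n. complex_of_real (a n)) n * of_real p ^ n)"
      using higher_deriv_power_series[of \<rho> "\<lambda>n. complex_of_real (a n)" "of_real p" k] smc pos
      unfolding f_def by auto
    have "summable (\<lambda>n. complex_of_real (real (binomial (n + k) k) * a (n + k) * p ^ n))"
      using hd(2) unfolding t by (subst (asm) summable_cmult_iff) simp
    then have sr: "summable (\<lambda>m. real (binomial (m + k) k) * a (m + k) * p ^ m)"
      by (simp only: summable_of_real_iff)
    have "(deriv ^^ k) f (of_real p) = fact k * of_real (\<Sum>m. real (binomial (m + k) k) * a (m + k) * p ^ m)"
      unfolding hd(1) t using sr by (subst suminf_mult) (auto simp: suminf_of_real summable_of_real simp del: of_real_mult)
    then show ?thesis using sr by (simp add: c_def)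
  qed
  have "(\<lambda>k. (deriv ^^ k) h (of_real p) / fact k * ((of_real p + of_real s) - of_real p) ^ k) sums h (of_real p + of_real s)"
  proof (rule holomorphic_power_series)
    show "h holomorphic_on ball (of_real p) (p + \<delta>)" using holh ball_sub by (rule holomorphic_on_subset)
    show "of_real p + of_real s \<in> ball (complex_of_real p) (p + \<delta>)"
      using pos \<delta> by (simp add: dist_norm s_def del: of_real_add of_real_divide)
  qed
  moreover have "(deriv ^^ k) h (of_real p) = (deriv ^^ k) f (of_real p)" for k
    by (rule higher_deriv_transform_within_open[of _ "ball 0 \<rho>"])
       (use holf holh pos in \<open>auto simp: h_def intro: holomorphic_on_subset\<close>)
  ultimately have "(\<lambda>k. c k * of_real s ^ k) sums h (of_real p + of_real s)" by (simp add: c_def)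
  then have "summable (\<lambda>k. c k * of_real s ^ k)" by (rule sums_summable)
  define b where "b k = (\<Sum>m. real (binomial (m + k) k) * a (m + k) * p ^ m)" for k
  have cb: "c k * of_real s ^ k = of_real (b k * s ^ k)" for k using c_eq by (simp add: b_def)
  have sb: "summable (\<lambda>k. b k * s ^ k)"
    using \<open>summable (\<lambda>k. c k * of_real s ^ k)\<close> unfolding cb by (simp only: summable_of_real_iff)
  have b0: "0 \<le> b k" for k unfolding b_def using c_eq a pos by (intro suminf_nonneg) auto
  \<comment> \<open>Expanding \<open>(p + s) ^ n\<close> by the binomial theorem and summing by
    powers of \<open>s\<close> bounds each partial sum by the Taylor series at \<open>p\<close>,
    which converges although \<open>p + s > \<rho>\<close>.\<close>
  have "(\<Sum>n<N. a n * (p + s) ^ n) \<le> (\<Sum>k. b k * s ^ k)" for N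
  proof -
    have "(\<Sum>n<N. a n * (p + s) ^ n) = (\<Sum>n<N. \<Sum>k\<le>n. real (binomial n k) * a n * p ^ (n - k) * s ^ k)"
    proof -
      have "(p + s) ^ n = (\<Sum>k\<le>n. real (binomial n k) * s ^ k * p ^ (n - k))" for n
        using binomial_ring[of s p n] by (simp add: add.commute)
      then show ?thesis by (simp add: sum_distrib_left algebra_simps)
    qed
    also have "\<dots> = (\<Sum>n<N. \<Sum>k<N. if k \<le> n then real (binomial n k) * a n * p ^ (n - k) * s ^ k else 0)"
    proof (rule sum.cong[OF refl])
      fix n assume n: "n \<in> {..<N}"
      have "(\<Sum>k<N. if k \<le> n then real (binomial n k) * a n * p ^ (n - k) * s ^ k else 0) =
        (\<Sum>k\<in>{k\<in>{..<N}. k \<le> n}. real (binomial n k) * a n * p ^ (n - k) * s ^ k)"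
        by (rule sum.inter_filter[symmetric]) simp
      also have "{k\<in>{..<N}. k \<le> n} = {..n}" using n by auto
      finally show "(\<Sum>k\<le>n. real (binomial n k) * a n * p ^ (n - k) * s ^ k) =
        (\<Sum>k<N. if k \<le> n then real (binomial n k) * a n * p ^ (n - k) * s ^ k else 0)" by simp
    qed
    also have "\<dots> = (\<Sum>k<N. \<Sum>n<N. if k \<le> n then real (binomial n k) * a n * p ^ (n - k) * s ^ k else 0)"
      by (rule sum.swap)
    also have "\<dots> \<le> (\<Sum>k<N. b k * s ^ k)"
    proof (rule sum_mono)
      fix k assume k: "k \<in> {..<N}"
      have "(\<Sum>n<N. if k \<le> n then real (binomial n k) * a n * p ^ (n - k) * s ^ k else 0) =
        (\<Sum>n\<in>{n\<in>{..<N}. k \<le> n}. real (binomial n k) * a n * p ^ (n - k) * s ^ k)"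
        by (rule sum.inter_filter[symmetric]) simp
      also have "{n\<in>{..<N}. k \<le> n} = (\<lambda>m. m + k) ` {..<N - k}"
      proof (intro equalityI subsetI)
        fix n assume "n \<in> {n\<in>{..<N}. k \<le> n}"
        then show "n \<in> (\<lambda>m. m + k) ` {..<N - k}" by (intro image_eqI[of _ _ "n - k"]) auto
      qed auto
      also have "(\<Sum>n\<in>(\<lambda>m. m + k) ` {..<N - k}. real (binomial n k) * a n * p ^ (n - k) * s ^ k) =
        (\<Sum>m<N - k. real (binomial (m + k) k) * a (m + k) * p ^ m * s ^ k)"
        by (subst sum.reindex) auto
      also have "\<dots> = (\<Sum>m<N - k. real (binomial (m + k) k) * a (m + k) * p ^ m) * s ^ k"
        by (simp add: sum_distrib_right)
      also have "\<dots> \<le> b k * s ^ k" unfolding b_def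
        using c_eq a pos by (intro mult_right_mono sum_le_suminf) auto
      finally show "(\<Sum>n<N. if k \<le> n then real (binomial n k) * a n * p ^ (n - k) * s ^ k else 0) \<le> b k * s ^ k" .
    qed
    also have "\<dots> \<le> (\<Sum>k. b k * s ^ k)"
      using sb b0 pos by (intro sum_le_suminf) auto
    finally show ?thesis .
  qed
  then have "summable (\<lambda>n. a n * (p + s) ^ n)"
    by (intro summableI_nonneg_bounded) (use a pos in auto)
  then show ?thesis using pos(4) by blast
qed

text \<open>The simplified Newton map \<open>G z w = w - E z w / D\<close>, with the derivative
  frozen at the base point, is a contraction near \<open>w0\<close>. Its iterates are holomorphic in
  \<open>z\<close> by \<open>comp\<close> and converge uniformly; contraction also gives uniqueness
  of the zero.\<close>

lemma holomorphic_implicit_function: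
  fixes E :: "complex \<Rightarrow> complex \<Rightarrow> complex"
  assumes r: "0 < r"
    and cont: "continuous_on (ball z0 r \<times> ball w0 r) (\<lambda>(z, w). E z w)"
    and hol: "\<And>z. z \<in> ball z0 r \<Longrightarrow> E z holomorphic_on ball w0 r"
    and comp: "\<And>X g. open X \<Longrightarrow> X \<subseteq> ball z0 r \<Longrightarrow> g holomorphic_on X \<Longrightarrow> g ` X \<subseteq> ball w0 r \<Longrightarrow>
      (\<lambda>z. E z (g z)) holomorphic_on X"
    and E0: "E z0 w0 = 0" and D0: "deriv (E z0) w0 \<noteq> 0"
  obtains \<epsilon> \<delta> g where "0 < \<epsilon>" "\<epsilon> \<le> r" "0 < \<delta>" "\<delta> \<le> r" "g holomorphic_on ball z0 \<epsilon>"
    "\<And>z w. z \<in> ball z0 \<epsilon> \<Longrightarrow> w \<in> ball w0 \<delta> \<Longrightarrow> E z w = 0 \<Longrightarrow> w = g z"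
    "\<And>z. z \<in> ball z0 \<epsilon> \<Longrightarrow> g z \<in> ball w0 \<delta>"
proof -
  define D where "D = deriv (E z0) w0"
  have D: "D \<noteq> 0" using D0 by (simp add: D_def)
  define G where "G z w = w - E z w / D" for z w
  have "continuous_on (ball w0 r) (deriv (E z0))"
    using hol[of z0] r by (intro holomorphic_on_imp_continuous_on holomorphic_deriv) auto
  then have "continuous (at w0) (deriv (E z0))" using r by (simp add: continuous_on_eq_continuous_at)
  then obtain d where d: "0 < d" "\<And>w. dist w w0 < d \<Longrightarrow> dist (deriv (E z0) w) D < norm D / 4"
    unfolding continuous_at_eps_delta D_def[symmetric] using D
    by (metis D_def zero_less_divide_iff zero_less_norm_iff zero_less_numeral)
  \<comment> \<open>Cauchy's estimate is applied on balls of radius \<open>\<delta>\<close> about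
    points of \<open>ball w0 \<delta>\<close>, so \<open>E\<close> is controlled up to distance
    \<open>2 * \<delta>\<close>.\<close>
  define \<delta> where "\<delta> = min (d / 2) (r / 4)"
  have \<delta>: "0 < \<delta>" "\<delta> < d" "2 * \<delta> < r" using d r by (auto simp: \<delta>_def)
  let ?K = "cball z0 (r/2) \<times> cball w0 (2 * \<delta>)"
  have K: "?K \<subseteq> ball z0 r \<times> ball w0 r" using r \<delta> by auto
  have "uniformly_continuous_on ?K (\<lambda>(z, w). E z w)"
    by (rule compact_uniformly_continuous[OF continuous_on_subset[OF cont K]]) (intro compact_Times compact_cball)
  then obtain e where e: "0 < e" "\<And>x y. x \<in> ?K \<Longrightarrow> y \<in> ?K \<Longrightarrow> dist y x < e \<Longrightarrow>
      dist ((\<lambda>(z, w). E z w) y) ((\<lambda>(z, w). E z w) x) < norm D * \<delta> / 4"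
    unfolding uniformly_continuous_on_def using D \<delta>
    by (metis mult_pos_pos zero_less_divide_iff zero_less_norm_iff zero_less_numeral)
  have close: "norm (E z w - E z0 w) < norm D * \<delta> / 4" if "z \<in> ball z0 (min e (r/2))" "w \<in> cball w0 (2 * \<delta>)" for z w
    using e(2)[of "(z0, w)" "(z, w)"] that r by (auto simp: dist_norm dist_Pair_Pair norm_minus_commute)
  define \<epsilon> where "\<epsilon> = min e (r/2)"
  have \<epsilon>: "0 < \<epsilon>" "\<epsilon> \<le> r" using e r by (auto simp: \<epsilon>_def)
  have zr: "z \<in> ball z0 r" if "z \<in> ball z0 \<epsilon>" for z using that \<epsilon> by auto
  \<comment> \<open>One quarter comes from moving \<open>w\<close> at fixed \<open>z0\<close>
    (continuity of the derivative), another from moving \<open>z\<close> (Cauchy's estimate for the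
    difference); together they give the contraction factor 1/2.\<close>
  have derivG: "norm (1 - deriv (E z) w / D) \<le> 1 / 2" if z: "z \<in> ball z0 \<epsilon>" and w: "w \<in> ball w0 \<delta>" for z w
  proof -
    have sub: "cball w \<delta> \<subseteq> cball w0 (2 * \<delta>)"
    proof
      fix x assume "x \<in> cball w \<delta>"
      then show "x \<in> cball w0 (2 * \<delta>)" using w dist_triangle[of w0 x w] by auto
    qed
    have sub2: "cball w \<delta> \<subseteq> ball w0 r"
    proof
      fix x assume "x \<in> cball w \<delta>"
      then have "x \<in> cball w0 (2 * \<delta>)" using sub by blast
      then show "x \<in> ball w0 r" using \<delta> by auto
    qed
    have h: "(\<lambda>w. E z w - E z0 w) holomorphic_on ball w0 r"
      using hol[OF zr[OF z]] hol[of z0] r by (intro holomorphic_intros) auto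
    have "norm ((deriv ^^ 1) (\<lambda>w. E z w - E z0 w) w) \<le> fact 1 * (norm D * \<delta> / 4) / \<delta> ^ 1"
    proof (rule Cauchy_higher_deriv_bound[where y = 0])
      show "(\<lambda>w. E z w - E z0 w) holomorphic_on ball w \<delta>"
        using h sub2 by (meson ball_subset_cball holomorphic_on_subset order_trans)
      show "continuous_on (cball w \<delta>) (\<lambda>w. E z w - E z0 w)"
        using holomorphic_on_imp_continuous_on[OF h] sub2 by (rule continuous_on_subset)
      show "E z x - E z0 x \<in> ball 0 (norm D * \<delta> / 4)" if "x \<in> ball w \<delta>" for x
      proof -
        have "x \<in> cball w0 (2 * \<delta>)" using sub that ball_subset_cball by blast
        then show ?thesis using close[of z x] z unfolding \<epsilon>_def[symmetric] by (simp add: norm_minus_commute)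
      qed
    qed (use \<delta> in auto)
    then have "norm (deriv (\<lambda>w. E z w - E z0 w) w) \<le> norm D / 4" using \<delta> by simp
    moreover have wr: "w \<in> ball w0 r" using w \<delta> by auto
    have "E z field_differentiable at w" "E z0 field_differentiable at w"
      using hol[OF zr[OF z]] hol[of z0] r wr by (auto intro: holomorphic_on_imp_differentiable_at)
    then have "deriv (\<lambda>w. E z w - E z0 w) w = deriv (E z) w - deriv (E z0) w" by (rule deriv_diff)
    moreover have "norm (deriv (E z0) w - D) < norm D / 4"
      using d(2)[of w] w \<delta> by (auto simp: dist_norm norm_minus_commute)
    ultimately have "norm ((deriv (E z) w - deriv (E z0) w) + (deriv (E z0) w - D)) \<le> norm D / 4 + norm D / 4"
      by (intro norm_triangle_mono) auto
    then have *: "norm (deriv (E z) w - D) \<le> norm D / 2" by simp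
    have eq: "1 - deriv (E z) w / D = - ((deriv (E z) w - D) / D)" using D by (simp add: field_simps)
    show ?thesis unfolding eq norm_minus_cancel norm_divide using D * by (simp add: divide_le_eq)
  qed
  have lip: "norm (G z w - G z w') \<le> 1/2 * norm (w - w')"
    if z: "z \<in> ball z0 \<epsilon>" and w: "w \<in> ball w0 \<delta>" "w' \<in> ball w0 \<delta>" for z w w'
  proof (rule field_differentiable_bound[where S = "ball w0 \<delta>" and f' = "\<lambda>w. 1 - deriv (E z) w / D"])
    fix x assume x: "x \<in> ball w0 \<delta>"
    then have "x \<in> ball w0 r" using \<delta> by auto
    then have "(E z has_field_derivative deriv (E z) x) (at x)"
      using hol[OF zr[OF z]] by (intro holomorphic_derivI[where S = "ball w0 r"]) auto
    from DERIV_diff[OF DERIV_ident DERIV_cdivide[OF this, of D]]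
    have "((\<lambda>w. w - E z w / D) has_field_derivative 1 - deriv (E z) x / D) (at x)" .
    moreover have "G z = (\<lambda>w. w - E z w / D)" by (auto simp: G_def)
    ultimately show "(G z has_field_derivative 1 - deriv (E z) x / D) (at x within ball w0 \<delta>)"
      by (simp add: has_field_derivative_at_within)
    show "norm (1 - deriv (E z) x / D) \<le> 1 / 2" using derivG[OF z x] .
  qed (use w in auto)
  have G0: "norm (G z w0 - w0) \<le> \<delta> / 4" if z: "z \<in> ball z0 \<epsilon>" for z
    using close[of z w0] z \<delta> E0 D by (simp add: G_def \<epsilon>_def norm_divide field_simps)
  define it where "it n z = ((G z) ^^ n) w0" for n z
  have it_Suc: "it (Suc n) z = G z (it n z)" and it_0: "it 0 z = w0" for n z by (auto simp: it_def)
  have itb: "norm (it n z - w0) \<le> \<delta> / 2" if z: "z \<in> ball z0 \<epsilon>" for n z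
  proof (induction n)
    case 0
    then show ?case using \<delta> by (simp add: it_0)
  next
    case (Suc n)
    have "it n z \<in> ball w0 \<delta>" using Suc \<delta> by (simp add: dist_norm norm_minus_commute)
    then have "norm (G z (it n z) - G z w0) \<le> 1/2 * norm (it n z - w0)" using lip[OF z] \<delta> by auto
    then have "norm ((G z (it n z) - G z w0) + (G z w0 - w0)) \<le> \<delta> / 4 + \<delta> / 4"
      using G0[OF z] Suc by (intro norm_triangle_mono) auto
    then show ?case by (simp add: it_Suc)
  qed
  have inb: "it n z \<in> ball w0 \<delta>" if "z \<in> ball z0 \<epsilon>" for n z
    using itb[OF that, of n] \<delta> by (simp add: dist_norm norm_minus_commute)
  have step: "norm (it (Suc n) z - it n z) \<le> \<delta> * (1/2) ^ n" if z: "z \<in> ball z0 \<epsilon>" for n z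
  proof (induction n)
    case 0
    then show ?case using G0[OF z] \<delta> by (simp add: it_Suc it_0)
  next
    case (Suc n)
    have "norm (G z (it (Suc n) z) - G z (it n z)) \<le> 1/2 * norm (it (Suc n) z - it n z)"
      by (rule lip[OF z inb[OF z] inb[OF z]])
    then show ?case using Suc by (simp add: it_Suc)
  qed
  define g where "g z = w0 + (\<Sum>n. it (Suc n) z - it n z)" for z
  have ul: "uniform_limit (ball z0 \<epsilon>) it g sequentially"
  proof -
    have sm: "summable (\<lambda>n. \<delta> * (1/2) ^ n)" by (intro summable_mult summable_geometric) simp
    have "uniform_limit (ball z0 \<epsilon>) (\<lambda>n z. \<Sum>i<n. it (Suc i) z - it i z) (\<lambda>z. \<Sum>i. it (Suc i) z - it i z) sequentially"
    proof (rule Weierstrass_m_test[OF _ sm])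
      fix n z assume "z \<in> ball z0 \<epsilon>"
      then show "norm (it (Suc n) z - it n z) \<le> \<delta> * (1/2) ^ n" by (rule step)
    qed
    then have "uniform_limit (ball z0 \<epsilon>) (\<lambda>n z. w0 + (\<Sum>i<n. it (Suc i) z - it i z))
      (\<lambda>z. w0 + (\<Sum>i. it (Suc i) z - it i z)) sequentially"
      by (intro uniform_limit_intros)
    moreover have "w0 + (\<Sum>i<n. it (Suc i) z - it i z) = it n z" for n z
      using sum_lessThan_telescope[of "\<lambda>i. it i z" n] by (simp add: it_0)
    ultimately show ?thesis by (simp add: g_def[abs_def])
  qed
  have holit: "it n holomorphic_on ball z0 \<epsilon>" for n
  proof (induction n)
    case (Suc n)
    have "(\<lambda>z. E z (it n z)) holomorphic_on ball z0 \<epsilon>"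
    proof (rule comp)
      show "it n ` ball z0 \<epsilon> \<subseteq> ball w0 r"
      proof
        fix x assume "x \<in> it n ` ball z0 \<epsilon>"
        then have "x \<in> ball w0 \<delta>" using inb by blast
        then show "x \<in> ball w0 r" using \<delta> by auto
      qed
    qed (use Suc \<epsilon> in auto)
    then have "(\<lambda>z. it n z - E z (it n z) / D) holomorphic_on ball z0 \<epsilon>"
      using Suc D by (intro holomorphic_intros) auto
    then show ?case by (rule holomorphic_transform) (simp add: it_Suc G_def)
  qed (simp add: it_def)
  have holg: "g holomorphic_on ball z0 \<epsilon>"
  proof (rule holomorphic_uniform_sequence[OF open_ball holit])
    fix x assume "x \<in> ball z0 \<epsilon>"
    then obtain d where "0 < d" "cball x d \<subseteq> ball z0 \<epsilon>" by (meson open_ball open_contains_cball)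
    then show "\<exists>d>0. cball x d \<subseteq> ball z0 \<epsilon> \<and> uniform_limit (cball x d) it g sequentially"
      using uniform_limit_on_subset[OF ul] by blast
  qed
  have gl: "(\<lambda>n. it n z) \<longlonglongrightarrow> g z" if "z \<in> ball z0 \<epsilon>" for z
    using tendsto_uniform_limitI[OF ul that] .
  have gb: "g z \<in> ball w0 \<delta>" if z: "z \<in> ball z0 \<epsilon>" for z
  proof -
    have "g z \<in> cball w0 (\<delta> / 2)"
      by (rule closed_sequentially[OF closed_cball _ gl[OF z]]) (use itb[OF z] in \<open>auto simp: dist_norm norm_minus_commute\<close>)
    then show ?thesis using \<delta> by auto
  qed
  have fix_g: "G z (g z) = g z" if z: "z \<in> ball z0 \<epsilon>" for z
  proof -
    have "g z \<in> ball w0 r" using gb[OF z] \<delta> by auto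
    then have "continuous (at (g z)) (E z)"
      using holomorphic_on_imp_continuous_on[OF hol[OF zr[OF z]]] by (simp add: continuous_on_eq_continuous_at)
    then have "(\<lambda>n. E z (it n z)) \<longlonglongrightarrow> E z (g z)" using gl[OF z] by (rule isCont_tendsto_compose)
    then have "(\<lambda>n. G z (it n z)) \<longlonglongrightarrow> G z (g z)" unfolding G_def using gl[OF z] D by (intro tendsto_intros)
    then have "(\<lambda>n. it (Suc n) z) \<longlonglongrightarrow> G z (g z)" by (simp add: it_Suc)
    then show ?thesis using LIMSEQ_Suc[OF gl[OF z]] LIMSEQ_unique by blast
  qed
  show ?thesis
  proof (rule that[of \<epsilon> \<delta> g])
    fix z w assume z: "z \<in> ball z0 \<epsilon>" and w: "w \<in> ball w0 \<delta>" and "E z w = 0"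
    then have "G z w = w" by (simp add: G_def)
    then have "norm (w - g z) \<le> 1/2 * norm (w - g z)" using lip[OF z w gb[OF z]] fix_g[OF z] by simp
    then have "norm (w - g z) = 0" using norm_ge_zero[of "w - g z"] by linarith
    then show "w = g z" by simp
  qed (use \<epsilon> \<delta> holg gb in auto)
qed

subsection \<open>Power series in two variables with nonnegative coefficients\<close>

definition series2 :: "(nat \<Rightarrow> real poly) \<Rightarrow> complex \<Rightarrow> complex \<Rightarrow> complex" where
  "series2 p \<alpha> \<beta> = (\<Sum>n. poly (map_poly of_real (p n)) \<alpha> * \<beta> ^ n)"

definition nonneg_coeffs :: "real poly \<Rightarrow> bool" where
  "nonneg_coeffs p \<longleftrightarrow> (\<forall>k. 0 \<le> coeff p k)"

lemma poly_nonneg: "nonneg_coeffs p \<Longrightarrow> 0 \<le> x \<Longrightarrow> 0 \<le> poly p x"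
  unfolding poly_altdef nonneg_coeffs_def by (intro sum_nonneg) auto

lemma poly_mono: "nonneg_coeffs p \<Longrightarrow> 0 \<le> x \<Longrightarrow> x \<le> y \<Longrightarrow> poly p x \<le> poly p y"
  unfolding poly_altdef nonneg_coeffs_def by (intro sum_mono mult_left_mono power_mono) auto

lemma poly_map_of_real: "poly (map_poly of_real p) (of_real x) = (of_real (poly p x) :: complex)"
  by (induction p) (auto simp: map_poly_pCons)

lemma degree_map_of_real: "degree (map_poly of_real p :: complex poly) = degree p"
  by (rule degree_map_poly) simp

lemma norm_poly_le:
  assumes "nonneg_coeffs p" "norm \<alpha> \<le> A"
  shows "norm (poly (map_poly of_real p) (\<alpha> :: complex)) \<le> poly p A"
proof -
  have c: "coeff (map_poly of_real p) i = complex_of_real (coeff p i)" for i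
    by (simp add: coeff_map_poly)
  have "norm (poly (map_poly of_real p) \<alpha>) \<le> (\<Sum>i\<le>degree p. norm (of_real (coeff p i) * \<alpha> ^ i))"
    unfolding poly_altdef degree_map_of_real c by (rule norm_sum)
  also have "\<dots> \<le> (\<Sum>i\<le>degree p. coeff p i * A ^ i)"
    using assms unfolding nonneg_coeffs_def
    by (intro sum_mono) (auto simp: norm_mult norm_power intro!: mult_mono power_mono)
  finally show ?thesis by (simp add: poly_altdef)
qed

lemma series2_term_le:
  fixes \<alpha> \<beta> :: complex
  assumes "nonneg_coeffs (p n)" "norm \<alpha> \<le> A" "norm \<beta> \<le> B"
  shows "norm (poly (map_poly of_real (p n)) \<alpha> * \<beta> ^ n) \<le> poly (p n) A * B ^ n"
proof -
  have "0 \<le> A" using assms(2) norm_ge_zero order_trans by blast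
  then show ?thesis unfolding norm_mult norm_power
    using assms by (intro mult_mono norm_poly_le power_mono poly_nonneg) auto
qed

context
  fixes p :: "nat \<Rightarrow> real poly" and A B :: real
  assumes nonneg: "\<And>n. nonneg_coeffs (p n)"
    and summable: "summable (\<lambda>n. poly (p n) A * B ^ n)"
begin

text \<open>The value at \<open>(A, B)\<close> dominates all terms on the polydisc, so the
  polynomial partial sums converge uniformly.\<close>

lemma series2_holomorphic:
  assumes "open X" "\<alpha> holomorphic_on X" "\<beta> holomorphic_on X"
    and "\<And>z. z \<in> X \<Longrightarrow> norm (\<alpha> z) \<le> A" "\<And>z. z \<in> X \<Longrightarrow> norm (\<beta> z) \<le> B"
  shows "(\<lambda>z. series2 p (\<alpha> z) (\<beta> z)) holomorphic_on X"
proof (rule holomorphic_uniform_sequence[OF assms(1)])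
  show "(\<lambda>z. \<Sum>n<N. poly (map_poly of_real (p n)) (\<alpha> z) * \<beta> z ^ n) holomorphic_on X" for N
    unfolding poly_altdef using assms by (intro holomorphic_intros)
  have ul: "uniform_limit X (\<lambda>N z. \<Sum>n<N. poly (map_poly of_real (p n)) (\<alpha> z) * \<beta> z ^ n)
      (\<lambda>z. series2 p (\<alpha> z) (\<beta> z)) sequentially"
    unfolding series2_def
    by (rule Weierstrass_m_test[OF _ summable]) (use assms nonneg series2_term_le in blast)
  fix x assume "x \<in> X"
  then obtain d where "0 < d" "cball x d \<subseteq> X" using assms(1) by (meson open_contains_cball)
  then show "\<exists>d>0. cball x d \<subseteq> X \<and> uniform_limit (cball x d)
      (\<lambda>N z. \<Sum>n<N. poly (map_poly of_real (p n)) (\<alpha> z) * \<beta> z ^ n) (\<lambda>z. series2 p (\<alpha> z) (\<beta> z)) sequentially"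
    using uniform_limit_on_subset[OF ul] by blast
qed

lemma series2_continuous:
  fixes \<alpha> \<beta> :: "'a :: topological_space \<Rightarrow> complex"
  assumes "continuous_on X \<alpha>" "continuous_on X \<beta>"
    and "\<And>z. z \<in> X \<Longrightarrow> norm (\<alpha> z) \<le> A" "\<And>z. z \<in> X \<Longrightarrow> norm (\<beta> z) \<le> B"
  shows "continuous_on X (\<lambda>z. series2 p (\<alpha> z) (\<beta> z))"
proof (rule uniform_limit_theorem)
  show "uniform_limit X (\<lambda>N z. \<Sum>n<N. poly (map_poly of_real (p n)) (\<alpha> z) * \<beta> z ^ n)
      (\<lambda>z. series2 p (\<alpha> z) (\<beta> z)) sequentially"
    unfolding series2_def
    by (rule Weierstrass_m_test[OF _ summable]) (use assms nonneg series2_term_le in blast)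
  show "\<forall>\<^sub>F N in sequentially. continuous_on X (\<lambda>z. \<Sum>n<N. poly (map_poly of_real (p n)) (\<alpha> z) * \<beta> z ^ n)"
    using assms by (intro always_eventually allI continuous_intros)
qed simp

lemma summable_series2_real:
  assumes "\<bar>a\<bar> \<le> A" "\<bar>b\<bar> \<le> B"
  shows "summable (\<lambda>n. poly (p n) a * b ^ n)"
proof (rule summable_comparison_test'[OF summable, of 0])
  fix n
  have "norm (poly (map_poly of_real (p n)) (of_real a) * (of_real b) ^ n :: complex) \<le> poly (p n) A * B ^ n"
    using assms nonneg by (intro series2_term_le) auto
  then show "norm (poly (p n) a * b ^ n) \<le> poly (p n) A * B ^ n"
    by (simp add: poly_map_of_real norm_mult norm_power abs_mult power_abs)
qed

lemma series2_of_real: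
  assumes "\<bar>a\<bar> \<le> A" "\<bar>b\<bar> \<le> B"
  shows "series2 p (of_real a) (of_real b) = of_real (\<Sum>n. poly (p n) a * b ^ n)"
  unfolding series2_def suminf_of_real[OF summable_series2_real[OF assms]]
  by (simp add: poly_map_of_real)

end


subsection \<open>Holomorphic functions of two variables\<close>

text \<open>Holomorphy in two variables is tested along holomorphic curves. This is stable under
  arithmetic and under insertion into \<open>series2\<close>, and it is what the iteration behind
  the implicit function theorem uses.\<close>

definition holomorphic2_on :: "(complex \<Rightarrow> complex \<Rightarrow> complex) \<Rightarrow> (complex \<times> complex) set \<Rightarrow> bool" where
  "holomorphic2_on F N \<longleftrightarrow> continuous_on N (\<lambda>(z, w). F z w) \<and>
     (\<forall>X \<phi> \<psi>. open X \<longrightarrow> \<phi> holomorphic_on X \<longrightarrow> \<psi> holomorphic_on X \<longrightarrow> (\<forall>s\<in>X. (\<phi> s, \<psi> s) \<in> N) \<longrightarrow>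
        (\<lambda>s. F (\<phi> s) (\<psi> s)) holomorphic_on X)"

lemma holomorphic2I:
  assumes "continuous_on N (\<lambda>x. F (fst x) (snd x))"
    and "\<And>X \<phi> \<psi>. open X \<Longrightarrow> \<phi> holomorphic_on X \<Longrightarrow> \<psi> holomorphic_on X \<Longrightarrow>
      (\<And>s. s \<in> X \<Longrightarrow> (\<phi> s, \<psi> s) \<in> N) \<Longrightarrow> (\<lambda>s. F (\<phi> s) (\<psi> s)) holomorphic_on X"
  shows "holomorphic2_on F N"
  using assms by (simp add: holomorphic2_on_def case_prod_unfold)

lemma holomorphic2_curve:
  assumes "holomorphic2_on F N" "open X" "\<phi> holomorphic_on X" "\<psi> holomorphic_on X" "\<And>s. s \<in> X \<Longrightarrow> (\<phi> s, \<psi> s) \<in> N"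
  shows "(\<lambda>s. F (\<phi> s) (\<psi> s)) holomorphic_on X"
  using assms by (simp add: holomorphic2_on_def)

lemma holomorphic2_continuous: "holomorphic2_on F N \<Longrightarrow> continuous_on N (\<lambda>x. F (fst x) (snd x))"
  by (simp add: holomorphic2_on_def case_prod_unfold)

lemma holomorphic2_subset:
  assumes "holomorphic2_on F N" "M \<subseteq> N"
  shows "holomorphic2_on F M"
proof (rule holomorphic2I)
  show "continuous_on M (\<lambda>x. F (fst x) (snd x))"
    using holomorphic2_continuous[OF assms(1)] assms(2) by (rule continuous_on_subset)
  fix X \<phi> \<psi> assume *: "open X" "\<phi> holomorphic_on X" "\<psi> holomorphic_on X" "\<And>s. s \<in> X \<Longrightarrow> (\<phi> s, \<psi> s) \<in> M"
  show "(\<lambda>s. F (\<phi> s) (\<psi> s)) holomorphic_on X"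
    by (rule holomorphic2_curve[OF assms(1) *(1-3)]) (use *(4) assms(2) in auto)
qed

lemma holomorphic2_const: "holomorphic2_on (\<lambda>_ _. c) N"
  by (rule holomorphic2I) (auto intro!: holomorphic_intros continuous_intros)

lemma holomorphic2_fst: "holomorphic2_on (\<lambda>z _. z) N"
  by (rule holomorphic2I) (auto intro!: continuous_intros)

lemma holomorphic2_snd: "holomorphic2_on (\<lambda>_ w. w) N"
  by (rule holomorphic2I) (auto intro!: continuous_intros)

lemma holomorphic2_add:
  assumes F: "holomorphic2_on F N" and G: "holomorphic2_on G N"
  shows "holomorphic2_on (\<lambda>z w. F z w + G z w) N"
proof (rule holomorphic2I)
  show "continuous_on N (\<lambda>x. F (fst x) (snd x) + G (fst x) (snd x))"
    by (rule continuous_on_add[OF holomorphic2_continuous[OF F] holomorphic2_continuous[OF G]])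
  fix X \<phi> \<psi> assume *: "open X" "\<phi> holomorphic_on X" "\<psi> holomorphic_on X" "\<And>s. s \<in> X \<Longrightarrow> (\<phi> s, \<psi> s) \<in> N"
  show "(\<lambda>s. F (\<phi> s) (\<psi> s) + G (\<phi> s) (\<psi> s)) holomorphic_on X"
    by (rule holomorphic_on_add[OF holomorphic2_curve[OF F *] holomorphic2_curve[OF G *]])
qed

lemma holomorphic2_diff:
  assumes F: "holomorphic2_on F N" and G: "holomorphic2_on G N"
  shows "holomorphic2_on (\<lambda>z w. F z w - G z w) N"
proof (rule holomorphic2I)
  show "continuous_on N (\<lambda>x. F (fst x) (snd x) - G (fst x) (snd x))"
    by (rule continuous_on_diff[OF holomorphic2_continuous[OF F] holomorphic2_continuous[OF G]])
  fix X \<phi> \<psi> assume *: "open X" "\<phi> holomorphic_on X" "\<psi> holomorphic_on X" "\<And>s. s \<in> X \<Longrightarrow> (\<phi> s, \<psi> s) \<in> N"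
  show "(\<lambda>s. F (\<phi> s) (\<psi> s) - G (\<phi> s) (\<psi> s)) holomorphic_on X"
    by (rule holomorphic_on_diff[OF holomorphic2_curve[OF F *] holomorphic2_curve[OF G *]])
qed

lemma holomorphic2_mult:
  assumes F: "holomorphic2_on F N" and G: "holomorphic2_on G N"
  shows "holomorphic2_on (\<lambda>z w. F z w * G z w) N"
proof (rule holomorphic2I)
  show "continuous_on N (\<lambda>x. F (fst x) (snd x) * G (fst x) (snd x))"
    by (rule continuous_on_mult[OF holomorphic2_continuous[OF F] holomorphic2_continuous[OF G]])
  fix X \<phi> \<psi> assume *: "open X" "\<phi> holomorphic_on X" "\<psi> holomorphic_on X" "\<And>s. s \<in> X \<Longrightarrow> (\<phi> s, \<psi> s) \<in> N"
  show "(\<lambda>s. F (\<phi> s) (\<psi> s) * G (\<phi> s) (\<psi> s)) holomorphic_on X"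
    by (rule holomorphic_on_mult[OF holomorphic2_curve[OF F *] holomorphic2_curve[OF G *]])
qed

lemma holomorphic2_divide:
  assumes F: "holomorphic2_on F N" and G: "holomorphic2_on G N" and G0: "\<And>z w. (z, w) \<in> N \<Longrightarrow> G z w \<noteq> 0"
  shows "holomorphic2_on (\<lambda>z w. F z w / G z w) N"
proof (rule holomorphic2I)
  show "continuous_on N (\<lambda>x. F (fst x) (snd x) / G (fst x) (snd x))"
    by (intro continuous_on_divide holomorphic2_continuous F G) (use G0 in auto)
  fix X \<phi> \<psi> assume *: "open X" "\<phi> holomorphic_on X" "\<psi> holomorphic_on X" "\<And>s. s \<in> X \<Longrightarrow> (\<phi> s, \<psi> s) \<in> N"
  show "(\<lambda>s. F (\<phi> s) (\<psi> s) / G (\<phi> s) (\<psi> s)) holomorphic_on X"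
    by (intro holomorphic_on_divide holomorphic2_curve[OF F *] holomorphic2_curve[OF G *]) (use G0 * in auto)
qed

lemma holomorphic2_compose:
  assumes f: "f holomorphic_on A" and A: "\<And>z w. (z, w) \<in> N \<Longrightarrow> z \<in> A"
  shows "holomorphic2_on (\<lambda>z _. f z) N"
proof (rule holomorphic2I)
  have "fst ` N \<subseteq> A" using A by auto
  then show "continuous_on N (\<lambda>x. f (fst x))"
    by (intro continuous_on_compose2[OF holomorphic_on_imp_continuous_on[OF f]] continuous_intros)
  fix X \<phi> \<psi> assume *: "open X" "\<phi> holomorphic_on X" "\<psi> holomorphic_on X" "\<And>s. s \<in> X \<Longrightarrow> (\<phi> s, \<psi> s) \<in> N"
  have "\<phi> ` X \<subseteq> A" using *(4) A by auto
  then have "(f \<circ> \<phi>) holomorphic_on X" by (rule holomorphic_on_compose_gen[OF *(2) f])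
  then show "(\<lambda>s. f (\<phi> s)) holomorphic_on X" by (simp add: o_def)
qed

lemma holomorphic2_series2:
  assumes p: "\<And>n. nonneg_coeffs (p n)" "summable (\<lambda>n. poly (p n) A * B ^ n)"
    and \<alpha>: "holomorphic2_on \<alpha> N" and \<beta>: "holomorphic2_on \<beta> N"
    and bound: "\<And>z w. (z, w) \<in> N \<Longrightarrow> norm (\<alpha> z w) \<le> A \<and> norm (\<beta> z w) \<le> B"
  shows "holomorphic2_on (\<lambda>z w. series2 p (\<alpha> z w) (\<beta> z w)) N"
proof (rule holomorphic2I)
  show "continuous_on N (\<lambda>x. series2 p (\<alpha> (fst x) (snd x)) (\<beta> (fst x) (snd x)))"
    by (rule series2_continuous[OF p holomorphic2_continuous[OF \<alpha>] holomorphic2_continuous[OF \<beta>]])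
       (use bound in auto)
  fix X \<phi> \<psi> assume *: "open X" "\<phi> holomorphic_on X" "\<psi> holomorphic_on X" "\<And>s. s \<in> X \<Longrightarrow> (\<phi> s, \<psi> s) \<in> N"
  show "(\<lambda>s. series2 p (\<alpha> (\<phi> s) (\<psi> s)) (\<beta> (\<phi> s) (\<psi> s))) holomorphic_on X"
    by (rule series2_holomorphic[OF p *(1) holomorphic2_curve[OF \<alpha> *] holomorphic2_curve[OF \<beta> *]])
       (use bound *(4) in auto)
qed

lemma open_Collect_less_open:
  fixes f :: "'a :: topological_space \<Rightarrow> real"
  assumes "open N" "continuous_on N f"
  shows "open {x \<in> N. f x < c}"
  using open_Collect_less_Int[OF assms(2) continuous_on_const[of N c]] assms(1) open_Int by metis

lemma open_holomorphic2_less: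
  assumes "open N" "holomorphic2_on F N"
  shows "open {(z, w) \<in> N. norm (F z w) < c}"
proof -
  have "continuous_on N (\<lambda>x. norm (F (fst x) (snd x)))"
    by (intro continuous_on_norm holomorphic2_continuous assms(2))
  from open_Collect_less_open[OF assms(1) this, of c]
  show ?thesis by (simp add: case_prod_unfold)
qed

lemma implicit_function2:
  assumes N: "open N" "(z0, w0) \<in> N" and E: "holomorphic2_on E N"
    and "E z0 w0 = 0" "deriv (E z0) w0 \<noteq> 0"
  obtains \<epsilon> \<delta> g where "0 < \<epsilon>" "0 < \<delta>" "g holomorphic_on ball z0 \<epsilon>"
    "\<And>z w. z \<in> ball z0 \<epsilon> \<Longrightarrow> w \<in> ball w0 \<delta> \<Longrightarrow> E z w = 0 \<Longrightarrow> w = g z"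
    "\<And>z. z \<in> ball z0 \<epsilon> \<Longrightarrow> g z \<in> ball w0 \<delta> \<and> (z, g z) \<in> N"
proof -
  obtain A B where AB: "open A" "open B" "z0 \<in> A" "w0 \<in> B" "A \<times> B \<subseteq> N"
    using N by (rule open_prod_elim) auto
  obtain r1 where r1: "0 < r1" "ball z0 r1 \<subseteq> A" using AB open_contains_ball by metis
  obtain r2 where r2: "0 < r2" "ball w0 r2 \<subseteq> B" using AB open_contains_ball by metis
  define r where "r = min r1 r2"
  have "ball z0 r \<subseteq> A" "ball w0 r \<subseteq> B" using r1 r2 by (auto simp: r_def)
  then have sub: "ball z0 r \<times> ball w0 r \<subseteq> N" using AB by blast
  have r: "0 < r" using r1 r2 by (simp add: r_def)
  note E' = holomorphic2_subset[OF E sub]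
  show ?thesis
  proof (rule holomorphic_implicit_function[OF r])
    show "continuous_on (ball z0 r \<times> ball w0 r) (\<lambda>(z, w). E z w)"
      using holomorphic2_continuous[OF E'] by (simp add: case_prod_unfold)
    show "E z holomorphic_on ball w0 r" if "z \<in> ball z0 r" for z
      by (rule holomorphic2_curve[OF E' open_ball holomorphic_on_const[of z] holomorphic_on_ident[unfolded id_def]])
         (use that in auto)
    show "(\<lambda>z. E z (g z)) holomorphic_on X" if "open X" "X \<subseteq> ball z0 r" "g holomorphic_on X" "g ` X \<subseteq> ball w0 r" for X g
      by (rule holomorphic2_curve[OF E' that(1) holomorphic_on_ident[unfolded id_def] that(3)]) (use that in auto)
    fix \<epsilon> \<delta> g assume *: "0 < \<epsilon>" "\<epsilon> \<le> r" "0 < \<delta>" "\<delta> \<le> r" "g holomorphic_on ball z0 \<epsilon>"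
      "\<And>z w. z \<in> ball z0 \<epsilon> \<Longrightarrow> w \<in> ball w0 \<delta> \<Longrightarrow> E z w = 0 \<Longrightarrow> w = g z"
      "\<And>z. z \<in> ball z0 \<epsilon> \<Longrightarrow> g z \<in> ball w0 \<delta>"
    have "(z, g z) \<in> N" if "z \<in> ball z0 \<epsilon>" for z
    proof -
      have "g z \<in> ball w0 r" using *(7)[OF that] *(4) by auto
      moreover have "z \<in> ball z0 r" using that *(2) by auto
      ultimately show ?thesis using sub by blast
    qed
    then show thesis using that[OF *(1,3,5,6)] *(7) by blast
  qed (use assms in auto)
qed

section \<open>Power series with polynomial coefficients\<close>

definition conv2 :: "(nat \<Rightarrow> real poly) \<Rightarrow> real \<Rightarrow> real \<Rightarrow> bool" where
  "conv2 p A B \<longleftrightarrow> summable (\<lambda>n. poly (p n) A * B ^ n)"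

definition val2 :: "(nat \<Rightarrow> real poly) \<Rightarrow> real \<Rightarrow> real \<Rightarrow> real" where
  "val2 p A B = (\<Sum>n. poly (p n) A * B ^ n)"

context
  fixes p :: "nat \<Rightarrow> real poly" and A B :: real
  assumes nonneg: "\<And>n. nonneg_coeffs (p n)" and conv: "conv2 p A B"
begin

lemma conv2_abs: "\<bar>a\<bar> \<le> A \<Longrightarrow> \<bar>b\<bar> \<le> B \<Longrightarrow> conv2 p a b"
  using summable_series2_real[OF nonneg conv[unfolded conv2_def]] by (simp add: conv2_def)

lemma conv2_mono: "0 \<le> a \<Longrightarrow> a \<le> A \<Longrightarrow> 0 \<le> b \<Longrightarrow> b \<le> B \<Longrightarrow> conv2 p a b"
  by (rule conv2_abs) auto

lemma val2_mono:
  assumes "0 \<le> a" "a \<le> A" "0 \<le> b" "b \<le> B"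
  shows "val2 p a b \<le> val2 p A B"
  unfolding val2_def
proof (rule suminf_le)
  show "poly (p n) a * b ^ n \<le> poly (p n) A * B ^ n" for n
    using assms nonneg by (intro mult_mono poly_mono power_mono poly_nonneg) auto
qed (use conv2_mono[OF assms] conv in \<open>auto simp: conv2_def\<close>)

lemma series2_val2: "\<bar>a\<bar> \<le> A \<Longrightarrow> \<bar>b\<bar> \<le> B \<Longrightarrow> series2 p (of_real a) (of_real b) = of_real (val2 p a b)"
  using series2_of_real[OF nonneg conv[unfolded conv2_def]] by (simp add: val2_def)

lemma norm_series2_le:
  assumes "norm \<alpha> \<le> A" "norm \<beta> \<le> B"
  shows "norm (series2 p \<alpha> \<beta>) \<le> val2 p A B"
  unfolding series2_def val2_def
  by (rule norm_suminf_le) (use assms nonneg series2_term_le conv in \<open>auto simp: conv2_def\<close>)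

end

lemma val2_continuous_on:
  assumes p: "\<And>n. nonneg_coeffs (p n)" "conv2 p A B" and "continuous_on T \<alpha>" "continuous_on T \<beta>"
    and bound: "\<And>t. t \<in> T \<Longrightarrow> \<bar>\<alpha> t\<bar> \<le> A \<and> \<bar>\<beta> t\<bar> \<le> B"
  shows "continuous_on T (\<lambda>t. val2 p (\<alpha> t) (\<beta> t))"
proof -
  have "continuous_on T (\<lambda>t. series2 p (of_real (\<alpha> t)) (of_real (\<beta> t)))"
    by (rule series2_continuous[OF p[unfolded conv2_def]]) (use assms in \<open>auto intro!: continuous_intros\<close>)
  then have "continuous_on T (\<lambda>t. Re (series2 p (of_real (\<alpha> t)) (of_real (\<beta> t))))" by (rule continuous_on_Re)
  then show ?thesis
    by (rule continuous_on_eq) (use bound series2_val2[OF p] in auto)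
qed

lemma val2_ge_term:
  assumes "\<And>n. nonneg_coeffs (p n)" "conv2 p A B" "0 \<le> A" "0 \<le> B"
  shows "poly (p n) A * B ^ n \<le> val2 p A B"
proof -
  have "(\<Sum>k\<in>{n}. poly (p k) A * B ^ k) \<le> val2 p A B"
    unfolding val2_def using assms
    by (intro sum_le_suminf) (auto simp: conv2_def intro!: mult_nonneg_nonneg poly_nonneg)
  then show ?thesis by simp
qed

lemma nonneg_kappa: "nonneg_coeffs (kappa n)"
  by (simp add: nonneg_coeffs_def coeff_kappa_nonneg)

text \<open>Phrased for an arbitrary derivative \<open>D\<close> so that \<open>D \<noteq> 0\<close>
  can follow from a growth estimate, without computing the derivative of a kernel series.\<close>

lemma implicit_function2_D:
  assumes N: "open N" "(z0, w0) \<in> N" and E: "holomorphic2_on E N" and E0: "E z0 w0 = 0"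
    and D: "\<And>D. (E z0 has_field_derivative D) (at w0) \<Longrightarrow> D \<noteq> 0"
  obtains \<epsilon> \<delta> g where "0 < \<epsilon>" "0 < \<delta>" "g holomorphic_on ball z0 \<epsilon>"
    "\<And>z w. z \<in> ball z0 \<epsilon> \<Longrightarrow> w \<in> ball w0 \<delta> \<Longrightarrow> E z w = 0 \<Longrightarrow> w = g z"
    "\<And>z. z \<in> ball z0 \<epsilon> \<Longrightarrow> g z \<in> ball w0 \<delta> \<and> (z, g z) \<in> N"
proof -
  let ?X = "Pair z0 -` N"
  have X: "open ?X" by (rule open_vimage[OF N(1)]) (intro continuous_intros)
  have "(\<lambda>w. E z0 w) holomorphic_on ?X"
    by (rule holomorphic2_curve[OF E X]) (auto intro!: holomorphic_intros)
  then have "(E z0 has_field_derivative deriv (E z0) w0) (at w0)"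
    using holomorphic_derivI[OF _ X] N(2) by simp
  then have d: "deriv (E z0) w0 \<noteq> 0" by (rule D)
  show thesis
  proof (rule implicit_function2[OF N E E0 d])
    fix \<epsilon> \<delta> g assume *: "0 < \<epsilon>" "0 < \<delta>" "g holomorphic_on ball z0 \<epsilon>"
      "\<And>z w. z \<in> ball z0 \<epsilon> \<Longrightarrow> w \<in> ball w0 \<delta> \<Longrightarrow> E z w = 0 \<Longrightarrow> w = g z"
      "\<And>z. z \<in> ball z0 \<epsilon> \<Longrightarrow> g z \<in> ball w0 \<delta> \<and> (z, g z) \<in> N"
    show thesis by (rule that[of \<epsilon> \<delta> g]) (fact *)+
  qed
qed

text \<open>Local solution \<open>q\<close> of the kernel equation with \<open>1 - a\<close> and
  \<open>u\<close> replaced by functions \<open>c\<close> and \<open>d\<close> of one parameter. The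
  parameter is \<open>t\<close> near the start of the curve, and \<open>u\<close> itself near the
  radius at fixed \<open>a\<close>.\<close>

lemma K_implicit:
  fixes c d :: "complex \<Rightarrow> complex"
  assumes cd: "c holomorphic_on ball z0 R" "d holomorphic_on ball z0 R" and R: "0 < R" and q0: "q0 \<noteq> 0"
    and conv: "conv2 kappa V X" and VX: "norm (1 - c z0 / q0) < V" "norm (d z0 * q0\<^sup>2) < X"
    and E: "E = (\<lambda>z q. q - 1 - 2 * series2 kappa (1 - c z / q) (d z * q\<^sup>2))"
    and E0: "E z0 q0 = 0" "\<And>D. (E z0 has_field_derivative D) (at q0) \<Longrightarrow> D \<noteq> 0"
  obtains \<epsilon> \<delta> g where "0 < \<epsilon>" "0 < \<delta>" "g holomorphic_on ball z0 \<epsilon>"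
    "\<And>z w. z \<in> ball z0 \<epsilon> \<Longrightarrow> w \<in> ball q0 \<delta> \<Longrightarrow> E z w = 0 \<Longrightarrow> w = g z"
proof -
  define N0 where "N0 = ball z0 R \<times> (UNIV - {0 :: complex})"
  have N0: "open N0" unfolding N0_def by (intro open_Times) auto
  let ?\<alpha> = "\<lambda>z q. 1 - c z / q" and ?\<beta> = "\<lambda>z q. d z * (q * q)"
  have hc: "holomorphic2_on (\<lambda>z q. c z) N0" "holomorphic2_on (\<lambda>z q. d z) N0"
    by (rule holomorphic2_compose[OF cd(1)] holomorphic2_compose[OF cd(2)]; simp add: N0_def)+
  have h\<alpha>: "holomorphic2_on ?\<alpha> N0"
    by (intro holomorphic2_diff holomorphic2_const holomorphic2_divide hc holomorphic2_snd) (simp add: N0_def)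
  have h\<beta>: "holomorphic2_on ?\<beta> N0"
    by (intro holomorphic2_mult hc holomorphic2_snd)
  define N where "N = {(z, w) \<in> N0. norm (?\<alpha> z w) < V} \<inter> {(z, w) \<in> N0. norm (?\<beta> z w) < X}"
  have N: "open N" unfolding N_def
    by (intro open_Int open_holomorphic2_less[OF N0] h\<alpha> h\<beta>)
  have sub: "N \<subseteq> N0" by (auto simp: N_def)
  have "holomorphic2_on (\<lambda>z q. series2 kappa (?\<alpha> z q) (?\<beta> z q)) N"
    by (rule holomorphic2_series2[OF nonneg_kappa conv[unfolded conv2_def]
          holomorphic2_subset[OF h\<alpha> sub] holomorphic2_subset[OF h\<beta> sub]]) (auto simp: N_def)
  then have "holomorphic2_on (\<lambda>z q. q - 1 - 2 * series2 kappa (?\<alpha> z q) (?\<beta> z q)) N"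
    by (intro holomorphic2_diff holomorphic2_mult holomorphic2_const holomorphic2_snd)
  then have hE: "holomorphic2_on E N" by (simp add: E power2_eq_square)
  have zq: "(z0, q0) \<in> N" using R q0 VX by (auto simp: N_def N0_def power2_eq_square)
  show ?thesis
  proof (rule implicit_function2_D[OF N zq hE E0])
    fix \<epsilon> \<delta> g assume *: "0 < \<epsilon>" "0 < \<delta>" "g holomorphic_on ball z0 \<epsilon>"
      "\<And>z w. z \<in> ball z0 \<epsilon> \<Longrightarrow> w \<in> ball q0 \<delta> \<Longrightarrow> E z w = 0 \<Longrightarrow> w = g z"
    show thesis by (rule that[OF *(1,2,3)]) (rule *(4))
  qed
qed

lemma poly_scale_le:
  assumes "nonneg_coeffs p" "degree p \<le> m" "1 \<le> l" "0 \<le> b"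
  shows "poly p (l * b) \<le> l ^ m * poly p b"
proof -
  have "poly p (l * b) = (\<Sum>i\<le>degree p. coeff p i * (l ^ i * b ^ i))"
    by (simp add: poly_altdef power_mult_distrib)
  also have "\<dots> \<le> (\<Sum>i\<le>degree p. coeff p i * (l ^ m * b ^ i))"
    using assms by (intro sum_mono mult_left_mono mult_right_mono power_increasing) (auto simp: nonneg_coeffs_def)
  also have "\<dots> = l ^ m * poly p b" by (simp add: poly_altdef sum_distrib_left algebra_simps)
  finally show ?thesis .
qed

section \<open>The curve \<open>a = - S_prim t\<close>\<close>

text \<open>The polynomials \<open>P n\<close> are the coefficients of \<open>Q\<close> in the
  variable \<open>b = 1 + a\<close>; on the curve \<open>b = 1 - S_prim t\<close> is nonnegative, so
  all terms are.\<close>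

locale parallel_stacks =
  fixes P :: "nat \<Rightarrow> real poly" and tc :: real
  assumes P_nonneg: "\<And>n. nonneg_coeffs (P n)"
    and P_eq: "\<And>n a. poly (Q_coeff n) a = poly (P n) (1 + a)"
    and P_degree: "\<And>n. degree (P n) \<le> 2 * n"
    and tc_pos: "0 < tc" and tc: "conv_radius s_coeff = ereal tc"
begin

definition S :: "real \<Rightarrow> real" where
  "S t = (\<Sum>n. s_coeff n * t ^ n)"

abbreviation y :: "real \<Rightarrow> real" where
  "y \<equiv> S_prim"

definition u :: "real \<Rightarrow> real" where
  "u t = t / (1 + y t)\<^sup>2"

definition rho :: "real \<Rightarrow> ereal" where
  "rho b = conv_radius (\<lambda>n. poly (P n) b)"

lemma rho_Q_eq: "rho_Q a = rho (1 + a)"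
  by (simp add: rho_Q_def rho_def P_eq)

lemma summable_s: "0 \<le> t \<Longrightarrow> t < tc \<Longrightarrow> summable (\<lambda>n. s_coeff n * t ^ n)"
  by (rule summable_in_conv_radius) (simp add: tc)

lemma summable_sp: "0 \<le> t \<Longrightarrow> t < tc \<Longrightarrow> summable (\<lambda>n. s_prim_coeff n * t ^ n)"
  by (rule summable_s_prim[OF _ summable_s])

lemma S_ge_1: "0 \<le> t \<Longrightarrow> t < tc \<Longrightarrow> 1 \<le> S t"
proof -
  assume t: "0 \<le> t" "t < tc"
  have "(\<Sum>n\<in>{0}. s_coeff n * t ^ n) \<le> S t"
    unfolding S_def using t by (intro sum_le_suminf summable_s) (auto simp: s_coeff_nonneg)
  then show "1 \<le> S t" by (simp add: s_coeff_bounds)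
qed

lemma y_S: "0 \<le> t \<Longrightarrow> t < tc \<Longrightarrow> y t = 1 - 1 / S t"
  using S_eq_S_prim[of t "S t"] summable_s[of t] S_ge_1[of t] by (simp add: S_def field_simps)

lemma y_bounds: "0 \<le> t \<Longrightarrow> t < tc \<Longrightarrow> 0 \<le> y t \<and> y t < 1"
  using y_S[of t] S_ge_1[of t] by simp

lemma S_y: "0 \<le> t \<Longrightarrow> t < tc \<Longrightarrow> S t = 1 / (1 - y t)"
  using y_S[of t] S_ge_1[of t] by simp

lemma twice_S: "0 \<le> t \<Longrightarrow> t < tc \<Longrightarrow> 2 * S t - 1 = (1 + y t) / (1 - y t)"
  using S_y[of t] y_bounds[of t] by (simp add: field_simps)

lemma one_plus_y: "0 \<le> t \<Longrightarrow> t < tc \<Longrightarrow> (1 + y t) / (2 * S t - 1) = 1 - y t"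
  using twice_S[of t] y_bounds[of t] by simp

text \<open>All terms of the series increase with \<open>t\<close>, and the one for
  \<open>n = 1\<close>, the single arch, already does so with slope at least 1.\<close>

lemma y_diff:
  assumes "0 \<le> t" "t \<le> t'" "t' < tc"
  shows "t' - t \<le> y t' - y t"
proof -
  have s: "summable (\<lambda>n. s_prim_coeff n * t' ^ n)" "summable (\<lambda>n. s_prim_coeff n * t ^ n)"
    using assms by (auto intro: summable_sp)
  have "t' - t \<le> (\<Sum>n\<in>{1}. s_prim_coeff n * t' ^ n - s_prim_coeff n * t ^ n)"
    using s_coeff_bounds(3) assms mult_right_mono[of 1 "s_prim_coeff 1" "t' - t"] by (simp add: algebra_simps)
  also have "\<dots> \<le> (\<Sum>n. s_prim_coeff n * t' ^ n - s_prim_coeff n * t ^ n)"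
    using assms s by (intro sum_le_suminf summable_diff)
      (auto intro!: mult_left_mono power_mono simp: s_prim_coeff_nonneg)
  also have "\<dots> = y t' - y t" unfolding S_prim_def using s by (rule suminf_diff[symmetric])
  finally show ?thesis .
qed

lemma y_strict_mono: "0 \<le> t \<Longrightarrow> t < t' \<Longrightarrow> t' < tc \<Longrightarrow> y t < y t'"
  using y_diff[of t t'] by simp

lemma y_mono: "0 \<le> t \<Longrightarrow> t \<le> t' \<Longrightarrow> t' < tc \<Longrightarrow> y t \<le> y t'"
  using y_diff[of t t'] by simp

lemma y_0: "y 0 = 0"
  using y_S[of 0] tc_pos by (simp add: S_def powser_zero s_coeff_bounds)

lemma S_mono: "0 \<le> t \<Longrightarrow> t < t' \<Longrightarrow> t' < tc \<Longrightarrow> S t < S t'"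
  using S_y[of t] S_y[of t'] y_strict_mono[of t t'] y_bounds[of t'] by (simp add: frac_less2)

text \<open>Besides the value, this supplies the points at which the kernel is known to converge;
  all later boxes of convergence are taken from here.\<close>

lemma K_S:
  assumes t: "0 \<le> t" "t < tc"
  shows "conv2 kappa (y t) (t * (S t)\<^sup>2)" "val2 kappa (y t) (t * (S t)\<^sup>2) = S t - 1"
proof -
  have "(\<lambda>n. poly (kappa n) (1 - 1 / S t) * (t * (S t)\<^sup>2) ^ n) sums (S t - 1)"
    by (rule S_functional_equation[OF t(1) summable_s[OF t] S_def]) (use S_ge_1[OF t] in simp)
  then have s: "(\<lambda>n. poly (kappa n) (y t) * (t * (S t)\<^sup>2) ^ n) sums (S t - 1)" using y_S[OF t] by simp
  show "conv2 kappa (y t) (t * (S t)\<^sup>2)" unfolding conv2_def by (rule sums_summable[OF s])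
  show "val2 kappa (y t) (t * (S t)\<^sup>2) = S t - 1" unfolding val2_def by (rule sums_unique[OF s, symmetric])
qed

lemma x_strict_mono: "0 \<le> t \<Longrightarrow> t < t' \<Longrightarrow> t' < tc \<Longrightarrow> t * (S t)\<^sup>2 < t' * (S t')\<^sup>2"
  using S_mono[of t t'] S_ge_1[of t]
  by (intro mult_strict_mono power_strict_mono) auto

text \<open>Together with \<open>one_plus_y\<close> this explains the form of the curve: at
  \<open>a = - y t\<close> and \<open>u = u t\<close>, the candidate \<open>q = 2 * S t - 1\<close>
  sends the equation of \<open>Q\<close> to the same kernel point as the equation of
  \<open>S\<close>.\<close>

lemma u_q: "0 \<le> t \<Longrightarrow> t < tc \<Longrightarrow> u t * (2 * S t - 1)\<^sup>2 = t * (S t)\<^sup>2"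
proof -
  assume t: "0 \<le> t" "t < tc"
  have "u t * (2 * S t - 1)\<^sup>2 = t * ((2 * S t - 1) / (1 + y t))\<^sup>2"
    by (simp add: u_def power_divide)
  also have "(2 * S t - 1) / (1 + y t) = S t" using twice_S[OF t] S_y[OF t] y_bounds[OF t] by simp
  finally show ?thesis .
qed

lemma u_bounds: "0 \<le> t \<Longrightarrow> t < tc \<Longrightarrow> 0 \<le> u t \<and> u t \<le> t"
proof -
  assume t: "0 \<le> t" "t < tc"
  have "1 \<le> (1 + y t)\<^sup>2" using y_bounds[OF t] by (simp add: one_le_power)
  then have "t / (1 + y t)\<^sup>2 \<le> t / 1" using t by (intro divide_left_mono) auto
  then show ?thesis using t by (simp add: u_def)
qed

lemma u_pos: "0 < t \<Longrightarrow> t < tc \<Longrightarrow> 0 < u t"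
  using y_bounds[of t] by (simp add: u_def)

text \<open>The coefficients are packed as constant polynomials, so that the results on
  \<open>series2\<close> also cover this one-variable series; the first argument 0 is a
  dummy.\<close>

definition yc :: "complex \<Rightarrow> complex" where
  "yc z = series2 (\<lambda>n. [:s_prim_coeff n:]) 0 z"

lemma nonneg_sp: "nonneg_coeffs [:s_prim_coeff n:]"
  by (auto simp: nonneg_coeffs_def coeff_pCons s_prim_coeff_nonneg split: nat.splits)

lemma conv_sp: "0 \<le> t \<Longrightarrow> t < tc \<Longrightarrow> conv2 (\<lambda>n. [:s_prim_coeff n:]) 0 t"
  using summable_sp by (simp add: conv2_def)

lemma val_sp: "val2 (\<lambda>n. [:s_prim_coeff n:]) 0 t = y t"
  by (simp add: val2_def S_prim_def)

lemma yc_holomorphic: "yc holomorphic_on ball 0 tc"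
proof -
  have "yc holomorphic_on (\<Union>r\<in>{0<..<tc}. ball 0 r)"
  proof (rule holomorphic_on_UN_open)
    fix r assume r: "r \<in> {0<..<tc}"
    show "yc holomorphic_on ball 0 r" unfolding yc_def
      by (rule series2_holomorphic[OF nonneg_sp conv_sp[unfolded conv2_def, of r]])
         (use r in \<open>auto intro!: holomorphic_intros\<close>)
  qed auto
  moreover have "ball 0 tc \<subseteq> (\<Union>r\<in>{0<..<tc}. ball (0::complex) r)"
  proof
    fix z :: complex assume z: "z \<in> ball 0 tc"
    then have "z \<in> ball 0 ((norm z + tc) / 2)" "(norm z + tc) / 2 \<in> {0<..<tc}" using add_nonneg_pos[OF norm_ge_zero[of z] tc_pos] by auto
    then show "z \<in> (\<Union>r\<in>{0<..<tc}. ball (0::complex) r)" by blast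
  qed
  ultimately show ?thesis by (rule holomorphic_on_subset)
qed

lemma yc_real: "0 \<le> t \<Longrightarrow> t < tc \<Longrightarrow> yc (of_real t) = of_real (y t)"
  using series2_val2[OF nonneg_sp conv_sp, of t 0 t] val_sp by (simp add: yc_def)

lemma norm_yc: "norm z < tc \<Longrightarrow> norm (yc z) < 1"
  using norm_series2_le[OF nonneg_sp conv_sp, of "norm z" 0 z] val_sp[of "norm z"] y_bounds[of "norm z"]
  by (simp add: yc_def)

lemma one_pm_yc: "norm z < tc \<Longrightarrow> 1 + yc z \<noteq> 0" "norm z < tc \<Longrightarrow> 1 - yc z \<noteq> 0"
proof -
  assume z: "norm z < tc"
  show "1 + yc z \<noteq> 0"
  proof
    assume "1 + yc z = 0"
    then have "yc z = - 1" by (simp add: add_eq_0_iff)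
    then show False using norm_yc[OF z] by simp
  qed
  show "1 - yc z \<noteq> 0" using norm_yc[OF z] by auto
qed

definition uc :: "complex \<Rightarrow> complex" where
  "uc z = z / (1 + yc z)\<^sup>2"

lemma uc_holomorphic: "uc holomorphic_on ball 0 tc"
  unfolding uc_def by (intro holomorphic_intros yc_holomorphic) (use one_pm_yc in auto)

lemma uc_real: "0 \<le> t \<Longrightarrow> t < tc \<Longrightarrow> uc (of_real t) = of_real (u t)"
  by (simp add: uc_def u_def yc_real)

lemma y_continuous: "continuous_on {0..<tc} y"
proof -
  have "continuous_on {0..<tc} (\<lambda>t. Re (yc (of_real t)))"
    by (intro continuous_intros continuous_on_compose2[OF holomorphic_on_imp_continuous_on[OF yc_holomorphic]]) auto
  then show ?thesis by (rule continuous_on_eq) (simp add: yc_real)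
qed

lemma u_continuous: "continuous_on {0..<tc} u"
  unfolding u_def by (intro continuous_intros y_continuous) (use y_bounds in force)

lemma S_continuous: "continuous_on {0..<tc} S"
proof -
  have "continuous_on {0..<tc} (\<lambda>t. 1 / (1 - y t))"
    by (intro continuous_intros y_continuous) (use y_bounds in force)
  then show ?thesis by (rule continuous_on_eq) (simp add: S_y)
qed

section \<open>Convergence and monotonicity of \<open>Q\<close> in the variables \<open>b\<close>
  and \<open>u\<close>\<close>

lemma conv_P: "0 \<le> x \<Longrightarrow> ereal x < rho b \<Longrightarrow> conv2 P b x"
  unfolding conv2_def rho_def by (rule summable_in_conv_radius) simp

lemma rho_ge: "conv2 P b x \<Longrightarrow> 0 \<le> x \<Longrightarrow> ereal x \<le> rho b"
  unfolding conv2_def rho_def using conv_radius_geI[of "\<lambda>n. poly (P n) b" x] by simp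

lemma rho_antimono:
  assumes "0 \<le> b" "b \<le> b'"
  shows "rho b' \<le> rho b"
proof (rule ccontr)
  assume "\<not> ?thesis"
  then have lt: "rho b < rho b'" by simp
  have "0 \<le> rho b" unfolding rho_def by (rule conv_radius_nonneg)
  obtain x where x: "rho b < ereal x" "ereal x < rho b'" using ereal_dense2[OF lt] by blast
  then have "0 \<le> x" using \<open>0 \<le> rho b\<close> by (metis ereal_less_eq(5) less_imp_le order_trans)
  then have "conv2 P b x" using conv2_mono[OF P_nonneg conv_P[OF _ x(2)]] assms by blast
  then show False using rho_ge[of b x] \<open>0 \<le> x\<close> x(1) by simp
qed

text \<open>The degree bound makes the region of convergence open.\<close>

lemma conv_P_expand:
  assumes b: "0 < b" and x: "0 \<le> x" "ereal x < rho b"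
  shows "\<exists>b'>b. \<exists>x'>x. conv2 P b' x'"
proof -
  obtain r where r: "ereal x < ereal r" "ereal r < rho b" using ereal_dense2[OF x(2)] by blast
  then have xr: "x < r" by simp
  define x' where "x' = (x + r) / 2"
  \<comment> \<open>Scaling \<open>b\<close> by \<open>l\<close> costs at most
    \<open>l ^ (2 * n)\<close> in the coefficient of index \<open>n\<close>, because its degree is
    at most \<open>2 * n\<close>; with \<open>l\<^sup>2 * x' = r\<close> this is paid by lowering
    \<open>r\<close> to \<open>x'\<close>.\<close>
  define l where "l = sqrt (r / x')"
  have x': "x < x'" "x' < r" "0 < x'" using xr x by (auto simp: x'_def)
  have l: "1 < l" "l\<^sup>2 = r / x'" using x' by (auto simp: l_def real_less_rsqrt)
  have "conv2 P (l * b) x'" unfolding conv2_def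
  proof (rule summable_comparison_test'[where N = 0])
    show "summable (\<lambda>n. poly (P n) b * r ^ n)" using conv_P[OF _ r(2)] xr x by (simp add: conv2_def)
    fix n
    have nn: "0 \<le> poly (P n) (l * b)" using P_nonneg b l by (intro poly_nonneg) auto
    have "poly (P n) (l * b) * x' ^ n \<le> (l ^ (2 * n) * poly (P n) b) * x' ^ n"
      using P_nonneg P_degree l b x' by (intro mult_right_mono poly_scale_le) auto
    also have "\<dots> = poly (P n) b * (l\<^sup>2 * x') ^ n" by (simp add: power_mult power_mult_distrib)
    also have "l\<^sup>2 * x' = r" using l x' by simp
    finally show "norm (poly (P n) (l * b) * x' ^ n) \<le> poly (P n) b * r ^ n"
      using nn x' by (simp add: abs_mult)
  qed
  moreover have "b < l * b" using l b by simp
  ultimately show ?thesis using x' by blast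
qed

lemma poly_P_0: "poly (P 0) b = 1"
proof -
  have "{w. balanced w \<and> length w = 2 * 0} = {[]}" by auto
  then have "poly (Q_coeff 0) (b - 1) = 1" unfolding poly_Q_coeff by simp
  then show ?thesis by (simp add: P_eq)
qed

lemma val_P_ge_1: "0 \<le> b \<Longrightarrow> 0 \<le> x \<Longrightarrow> conv2 P b x \<Longrightarrow> 1 \<le> val2 P b x"
  using val2_ge_term[of P b x 0] P_nonneg by (simp add: poly_P_0)

lemma val_P_0: "val2 P b 0 = 1"
  by (simp add: val2_def powser_zero poly_P_0)

lemma val_P_mono_x:
  assumes "0 \<le> b" "0 \<le> x" "x \<le> x'" "conv2 P b x'"
  shows "val2 P b x \<le> val2 P b x'"
  by (rule val2_mono[OF P_nonneg assms(4)]) (use assms in auto)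

lemma Q_eq:
  assumes "0 \<le> b" "b \<le> 1" "0 \<le> x" "x < 1 / 16"
  shows "conv2 P b x" "val2 P b x - 1 = 2 * val2 kappa (1 - (2 - b) / val2 P b x) (x * (val2 P b x)\<^sup>2)"
proof -
  have a: "\<bar>b - 1\<bar> \<le> 1" using assms by simp
  have v: "val2 P b x = (\<Sum>n. poly (Q_coeff n) (b - 1) * x ^ n)" by (simp add: val2_def P_eq)
  show c: "conv2 P b x" using sums_Q_coeff(2)[OF a assms(3,4)] by (simp add: conv2_def P_eq)
  have "val2 P b x \<noteq> 0" using val_P_ge_1[OF assms(1,3) c] by simp
  from Q_functional_equation[OF a assms(3,4) v this]
  have s: "(\<lambda>n. 2 * poly (kappa n) (1 - (2 - b) / val2 P b x) * (x * (val2 P b x)\<^sup>2) ^ n) sums (val2 P b x - 1)"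
    by simp
  have "(\<lambda>n. poly (kappa n) (1 - (2 - b) / val2 P b x) * (x * (val2 P b x)\<^sup>2) ^ n) sums ((val2 P b x - 1) / 2)"
    using sums_divide[OF s, of 2] by (simp add: mult.assoc)
  then have "val2 kappa (1 - (2 - b) / val2 P b x) (x * (val2 P b x)\<^sup>2) = (val2 P b x - 1) / 2"
    unfolding val2_def[of kappa] by (rule sums_unique[symmetric])
  then show "val2 P b x - 1 = 2 * val2 kappa (1 - (2 - b) / val2 P b x) (x * (val2 P b x)\<^sup>2)" by simp
qed

lemma rho_pos:
  assumes "0 \<le> b" "b \<le> 1"
  shows "0 < rho b"
proof -
  have "conv2 P b (1/17)" using Q_eq(1)[OF assms] by simp
  then have "ereal (1/17) \<le> rho b" by (rule rho_ge) simp
  moreover have "0 < ereal (1/17)" by simp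
  ultimately show ?thesis by (rule less_le_trans[rotated])
qed

text \<open>Continuation in \<open>x\<close> from \<open>x < 1/16\<close>, inside the open set where
  \<open>Q\<close> has no zero and both kernel arguments lie in the box. As \<open>Q\<close> runs
  between 1 and \<open>qb\<close>, the first argument runs between \<open>-(1 - b)\<close> and
  \<open>1 - (2 - b) / qb\<close>, which explains the two conditions on \<open>V\<close>.\<close>

lemma K_equation:
  assumes b: "0 < b" "b \<le> 1" and r: "0 < r" "ereal r < rho b"
    and conv: "conv2 kappa V X" and V: "1 - b < V" "1 - (2 - b) / qb < V" and X: "r * qb\<^sup>2 < X"
    and qb: "\<And>x. 0 \<le> x \<Longrightarrow> x \<le> r \<Longrightarrow> val2 P b x \<le> qb"
    and x: "0 \<le> x" "x \<le> r"
  shows "val2 P b x - 1 = 2 * val2 kappa (1 - (2 - b) / val2 P b x) (x * (val2 P b x)\<^sup>2)"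
proof -
  obtain r' where r': "r < r'" "conv2 P b r'"
  proof -
    obtain z where "ereal r < ereal z" "ereal z < rho b" using ereal_dense2[OF r(2)] by blast
    then show ?thesis using that[of z] conv_P[of z b] r(1) by simp
  qed
  define f where "f z = series2 P (of_real b) z" for z
  have f_real: "f (of_real x) = of_real (val2 P b x)" if "0 \<le> x" "x \<le> r'" for x
    unfolding f_def by (rule series2_val2[OF P_nonneg r'(2)]) (use that b in auto)
  have holf: "f holomorphic_on ball 0 r'" unfolding f_def
    by (rule series2_holomorphic[OF P_nonneg r'(2)[unfolded conv2_def]]) (use b in \<open>auto intro!: holomorphic_intros\<close>)
  have bnd: "1 \<le> val2 P b x \<and> \<bar>1 - (2 - b) / val2 P b x\<bar> < V \<and> \<bar>x * (val2 P b x)\<^sup>2\<bar> < X" if x: "0 \<le> x" "x \<le> r" for x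
  proof -
    have c: "conv2 P b x" by (rule conv2_mono[OF P_nonneg r'(2)]) (use x b r' in auto)
    have 1: "1 \<le> val2 P b x" using val_P_ge_1 b x c by simp
    have 2: "val2 P b x \<le> qb" using qb x by simp
    have "(2 - b) / qb \<le> (2 - b) / val2 P b x" using 1 2 b by (intro divide_left_mono) auto
    moreover have "(2 - b) / val2 P b x \<le> (2 - b) / 1" using 1 b by (intro divide_left_mono) auto
    ultimately have 3: "\<bar>1 - (2 - b) / val2 P b x\<bar> < V" using V by auto
    have "x * (val2 P b x)\<^sup>2 \<le> r * qb\<^sup>2" using x 1 2 r by (intro mult_mono power_mono) auto
    then have "\<bar>x * (val2 P b x)\<^sup>2\<bar> < X" using X x by simp
    then show ?thesis using 1 3 by simp
  qed
  define A0 where "A0 = {z \<in> ball 0 r'. f z \<noteq> 0}"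
  have A0: "open A0"
  proof -
    have "A0 = ball 0 r' \<inter> f -` (- {0})" by (auto simp: A0_def)
    then show ?thesis
      using continuous_open_preimage[OF holomorphic_on_imp_continuous_on[OF holf] open_ball, of "- {0}"] by (simp add: open_Compl)
  qed
  have holf0: "f holomorphic_on A0" using holf by (rule holomorphic_on_subset) (auto simp: A0_def)
  have hv: "(\<lambda>z. 1 - of_real (2 - b) / f z) holomorphic_on A0"
    by (intro holomorphic_intros holf0) (auto simp: A0_def)
  have hx: "(\<lambda>z. z * (f z)\<^sup>2) holomorphic_on A0"
    by (intro holomorphic_intros holf0)
  define A where "A = {z \<in> A0. norm (1 - of_real (2 - b) / f z) < V} \<inter> {z \<in> A0. norm (z * (f z)\<^sup>2) < X}"
  have A: "open A" unfolding A_def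
    by (intro open_Int open_Collect_less_open[OF A0] continuous_on_norm holomorphic_on_imp_continuous_on hv hx)
  have sub: "A \<subseteq> A0" by (auto simp: A_def)
  let ?g = "\<lambda>z. 1 + 2 * series2 kappa (1 - of_real (2 - b) / f z) (z * (f z)\<^sup>2)"
  have holg: "?g holomorphic_on A"
  proof (intro holomorphic_intros)
    show "(\<lambda>z. series2 kappa (1 - of_real (2 - b) / f z) (z * (f z)\<^sup>2)) holomorphic_on A"
      by (rule series2_holomorphic[OF nonneg_kappa conv[unfolded conv2_def] A
            holomorphic_on_subset[OF hv sub] holomorphic_on_subset[OF hx sub]]) (auto simp: A_def)
  qed
  have g_real: "?g (of_real x) = of_real (1 + 2 * val2 kappa (1 - (2 - b) / val2 P b x) (x * (val2 P b x)\<^sup>2))"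
    if "0 \<le> x" "x \<le> r" for x
  proof -
    have "series2 kappa (of_real (1 - (2 - b) / val2 P b x)) (of_real (x * (val2 P b x)\<^sup>2)) =
        of_real (val2 kappa (1 - (2 - b) / val2 P b x) (x * (val2 P b x)\<^sup>2))"
      by (rule series2_val2[OF nonneg_kappa conv]) (use bnd[OF that] in auto)
    moreover have "f (of_real x) = of_real (val2 P b x)" by (rule f_real) (use that r' in auto)
    ultimately show ?thesis by simp
  qed
  have "f (of_real x) = ?g (of_real x)"
  proof (rule holomorphic_eq_on_segment[of A f ?g r "1/16"])
    show "f holomorphic_on A" using holf0 sub by (rule holomorphic_on_subset)
    show "of_real ` {0..r} \<subseteq> A"
    proof
      fix z assume "z \<in> complex_of_real ` {0..r}"
      then obtain x where x: "z = of_real x" "0 \<le> x" "x \<le> r" by auto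
      have fx: "f z = of_real (val2 P b x)" using f_real[of x] x r' by simp
      have 1: "1 - of_real (2 - b) / f z = of_real (1 - (2 - b) / val2 P b x)"
        "z * (f z)\<^sup>2 = of_real (x * (val2 P b x)\<^sup>2)" unfolding fx by (simp_all add: x(1))
      have "norm z < r'" "f z \<noteq> 0" using x r' fx bnd[OF x(2,3)] by auto
      moreover have "norm (1 - of_real (2 - b) / f z) < V" "norm (z * (f z)\<^sup>2) < X"
        unfolding 1 norm_of_real using bnd[OF x(2,3)] by auto
      ultimately show "z \<in> A" by (simp add: A_def A0_def)
    qed
    show "f (of_real t) = ?g (of_real t)" if "0 < t" "t < 1/16" "t \<le> r" for t
    proof -
      have "val2 P b t = 1 + 2 * val2 kappa (1 - (2 - b) / val2 P b t) (t * (val2 P b t)\<^sup>2)"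
        using Q_eq(2)[of b t] b that by simp
      then show ?thesis using g_real[of t] f_real[of t] that r' by simp
    qed
  qed (use A holg r x in auto)
  then have "val2 P b x = 1 + 2 * val2 kappa (1 - (2 - b) / val2 P b x) (x * (val2 P b x)\<^sup>2)"
    using g_real[OF x] f_real[of x] x r' by (simp only: of_real_eq_iff)
  then show ?thesis by simp
qed

end

lemma series2_kappa_0: "series2 kappa \<alpha> 0 = 0"
  by (simp add: series2_def powser_zero kappa_0)

section \<open>Monotonicity and convexity of the kernel\<close>

text \<open>Since \<open>kappa 0 = 0\<close>, the quotient \<open>K(v, x) / x\<close> is again a
  series with nonnegative coefficients and so increases in both variables; denominators are
  cleared.\<close>

lemma val2_kappa_scale:
  assumes conv: "conv2 kappa v0 x0" and v: "0 \<le> v1" "v1 \<le> v0" and x: "0 \<le> x1" "x1 \<le> x0"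
  shows "val2 kappa v1 x1 * x0 \<le> val2 kappa v0 x0 * x1"
proof -
  have c1: "conv2 kappa v1 x1" by (rule conv2_mono[OF nonneg_kappa conv]) (use v x in auto)
  have "(\<Sum>n. poly (kappa n) v1 * x1 ^ n * x0) \<le> (\<Sum>n. poly (kappa n) v0 * x0 ^ n * x1)"
  proof (rule suminf_le)
    show "poly (kappa n) v1 * x1 ^ n * x0 \<le> poly (kappa n) v0 * x0 ^ n * x1" for n
    proof (cases n)
      case (Suc m)
      have "poly (kappa n) v1 * x1 ^ m \<le> poly (kappa n) v0 * x0 ^ m"
        using v x by (intro mult_mono poly_mono power_mono poly_nonneg nonneg_kappa) auto
      then have "poly (kappa n) v1 * x1 ^ m * (x0 * x1) \<le> poly (kappa n) v0 * x0 ^ m * (x0 * x1)"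
        using x by (intro mult_right_mono) auto
      then show ?thesis using Suc by (simp add: algebra_simps)
    qed (simp add: kappa_0)
  qed (use c1 conv in \<open>auto simp: conv2_def intro: summable_mult2\<close>)
  then show ?thesis using c1 conv by (simp add: val2_def conv2_def suminf_mult2)
qed

text \<open>The term for \<open>n = 1\<close> is exactly \<open>x\<close>, because
  \<open>kappa 1 = 1\<close>, and the other terms are increasing in \<open>x\<close>.\<close>

lemma val2_kappa_diff_ge:
  assumes conv: "conv2 kappa v x'" and v: "0 \<le> v" and x: "0 \<le> x" "x \<le> x'"
  shows "x' - x \<le> val2 kappa v x' - val2 kappa v x"
proof -
  have c: "conv2 kappa v x" by (rule conv2_mono[OF nonneg_kappa conv]) (use v x in auto)
  have s: "summable (\<lambda>n. poly (kappa n) v * x' ^ n)" "summable (\<lambda>n. poly (kappa n) v * x ^ n)"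
    using c conv by (auto simp: conv2_def)
  have "(\<Sum>n\<in>{1}. poly (kappa n) v * x' ^ n - poly (kappa n) v * x ^ n) \<le>
      (\<Sum>n. poly (kappa n) v * x' ^ n - poly (kappa n) v * x ^ n)"
    using s v x by (intro sum_le_suminf summable_diff)
      (auto intro!: mult_left_mono power_mono poly_nonneg nonneg_kappa)
  also have "\<dots> = val2 kappa v x' - val2 kappa v x"
    unfolding val2_def by (rule suminf_diff[OF s, symmetric])
  finally show ?thesis by (simp add: kappa_1 One_nat_def[symmetric] del: One_nat_def)
qed

text \<open>Convexity of the power: from a common left end, the shorter chord is no steeper than the
  longer one.\<close>

lemma power_diff_le:
  fixes x y z :: real
  assumes "0 \<le> x" "x \<le> y" "y \<le> z"
  shows "(z - x) * (y ^ n - x ^ n) \<le> (y - x) * (z ^ n - x ^ n)"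
proof -
  have "(\<Sum>i<n. x ^ (n - Suc i) * y ^ i) \<le> (\<Sum>i<n. x ^ (n - Suc i) * z ^ i)"
    using assms by (intro sum_mono mult_left_mono power_mono) auto
  then have "((z - x) * (y - x)) * (\<Sum>i<n. x ^ (n - Suc i) * y ^ i) \<le>
      ((z - x) * (y - x)) * (\<Sum>i<n. x ^ (n - Suc i) * z ^ i)"
    using assms by (intro mult_left_mono) auto
  then show ?thesis unfolding power_diff_sumr2[of y n x] power_diff_sumr2[of z n x]
    by (simp add: algebra_simps)
qed

text \<open>By convexity in \<open>x\<close>, the chord from \<open>x\<close> to \<open>x'\<close>
  is no steeper than the one from \<open>x\<close> to \<open>X\<close>, whose rise is at most
  \<open>K(V, X)\<close>. This bounds the variation of the kernel without its derivative.\<close>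

lemma val2_kappa_diff_le:
  assumes conv: "conv2 kappa V X" and v: "0 \<le> v" "v \<le> V" and x: "0 \<le> x" "x \<le> x'" "x' < X"
  shows "(X - x) * (val2 kappa v x' - val2 kappa v x) \<le> (x' - x) * val2 kappa V X"
proof -
  have s: "summable (\<lambda>n. poly (kappa n) v * x' ^ n)" "summable (\<lambda>n. poly (kappa n) v * x ^ n)"
    "summable (\<lambda>n. poly (kappa n) V * X ^ n)"
    using conv conv2_mono[OF nonneg_kappa conv, of v x'] conv2_mono[OF nonneg_kappa conv, of v x] v x
    by (auto simp: conv2_def)
  have "(\<Sum>n. (X - x) * (poly (kappa n) v * x' ^ n - poly (kappa n) v * x ^ n)) \<le>
      (\<Sum>n. (x' - x) * (poly (kappa n) V * X ^ n))"
  proof (rule suminf_le)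
    fix n
    have p: "0 \<le> poly (kappa n) v" using v by (intro poly_nonneg nonneg_kappa)
    have "(X - x) * (poly (kappa n) v * x' ^ n - poly (kappa n) v * x ^ n) =
        poly (kappa n) v * ((X - x) * (x' ^ n - x ^ n))" by (simp add: algebra_simps)
    also have "\<dots> \<le> poly (kappa n) v * ((x' - x) * (X ^ n - x ^ n))"
      using x p by (intro mult_left_mono power_diff_le) auto
    also have "\<dots> \<le> poly (kappa n) v * ((x' - x) * X ^ n)"
      using x p by (intro mult_left_mono) auto
    also have "\<dots> \<le> poly (kappa n) V * ((x' - x) * X ^ n)"
      using x v by (intro mult_right_mono poly_mono nonneg_kappa) auto
    finally show "(X - x) * (poly (kappa n) v * x' ^ n - poly (kappa n) v * x ^ n) \<le>
      (x' - x) * (poly (kappa n) V * X ^ n)" by (simp add: algebra_simps)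
  qed (use s in \<open>auto intro!: summable_mult summable_diff\<close>)
  then show ?thesis unfolding val2_def
    using s by (simp add: suminf_mult summable_diff suminf_diff[symmetric])
qed

text \<open>The mean of the products exceeds the product of the means by a quarter of
  \<open>(f3 - f1) * (g3 - g1)\<close>, which is nonnegative as both sequences increase.\<close>

lemma midpoint_mult:
  fixes f1 f2 f3 g1 g2 g3 :: real
  assumes "f2 \<le> (f1 + f3) / 2" "g2 \<le> (g1 + g3) / 2" "0 \<le> f2" "0 \<le> g2" "f1 \<le> f3" "g1 \<le> g3"
  shows "f2 * g2 \<le> (f1 * g1 + f3 * g3) / 2"
proof -
  have "f2 * g2 \<le> ((f1 + f3) / 2) * ((g1 + g3) / 2)" using assms by (intro mult_mono) auto
  moreover have "0 \<le> (f3 - f1) * (g3 - g1)" using assms by simp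
  ultimately show ?thesis by (simp add: algebra_simps)
qed

lemma midpoint_power:
  fixes f1 f2 f3 :: real
  assumes "f2 \<le> (f1 + f3) / 2" "0 \<le> f1" "0 \<le> f2" "f1 \<le> f3"
  shows "f2 ^ n \<le> (f1 ^ n + f3 ^ n) / 2"
proof (induction n)
  case (Suc n)
  have "f2 * f2 ^ n \<le> (f1 * f1 ^ n + f3 * f3 ^ n) / 2"
    by (rule midpoint_mult) (use Suc assms in \<open>auto intro: power_mono\<close>)
  then show ?case by simp
qed simp

text \<open>In the variable \<open>q\<close> the summands are \<open>x\<^sup>n (q - c)\<^sup>b q\<^sup>2\<^sup>n\<^sup>-\<^sup>b\<close>, which are convex for \<open>q \<ge> c\<close>,
  and the summand for \<open>n = 1\<close> is \<open>x q\<^sup>2\<close>.\<close>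

lemma kappa_midpoint:
  assumes c: "0 < c" "c \<le> q1" "q1 \<le> q3" and x: "0 \<le> x" and conv: "conv2 kappa (1 - c / q3) (x * q3\<^sup>2)"
    and q2: "q2 = (q1 + q3) / 2"
  shows "val2 kappa (1 - c / q2) (x * q2\<^sup>2) \<le>
    (val2 kappa (1 - c / q1) (x * q1\<^sup>2) + val2 kappa (1 - c / q3) (x * q3\<^sup>2)) / 2 - x * ((q3 - q1) / 2)\<^sup>2"
proof -
  let ?T = "\<lambda>q n. poly (kappa n) (1 - c / q) * (x * q\<^sup>2) ^ n"
  have conv': "summable (?T q)" if q: "c \<le> q" "q \<le> q3" for q
  proof -
    have "c / q3 \<le> c / q" using q c by (intro divide_left_mono) auto
    moreover have "c / q \<le> 1" using q c by simp
    moreover have "x * q\<^sup>2 \<le> x * q3\<^sup>2" using q c x by (intro mult_left_mono power_mono) auto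
    ultimately have "conv2 kappa (1 - c / q) (x * q\<^sup>2)"
      using x by (intro conv2_mono[OF nonneg_kappa conv]) auto
    then show ?thesis by (simp add: conv2_def)
  qed
  have le: "c \<le> q2" "q2 \<le> q3" "q1 \<le> q2" using c q2 by auto
  have T: "?T q n = x ^ n * (\<Sum>w | (irreducible_word w \<and> hd w = In Stack1) \<and> length w = 2 * n.
      (q - c) ^ mismatches w * q ^ (2 * n - mismatches w))" if "c \<le> q" for q n
  proof -
    have q: "q \<noteq> 0" using that c by simp
    have "?T q n = (\<Sum>w | (irreducible_word w \<and> hd w = In Stack1) \<and> length w = 2 * n.
      x ^ n * ((1 - c / q) ^ mismatches w * q ^ (2 * n)))"
    proof -
      have "(x * q\<^sup>2) ^ n = x ^ n * q ^ (2 * n)" by (simp add: power_mult_distrib power_mult)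
      then show ?thesis by (simp add: poly_kappa sum_distrib_left mult_ac)
    qed
    also have "\<dots> = (\<Sum>w | (irreducible_word w \<and> hd w = In Stack1) \<and> length w = 2 * n.
      x ^ n * ((q - c) ^ mismatches w * q ^ (2 * n - mismatches w)))"
    proof (rule sum.cong[OF refl])
      fix w assume "w \<in> {w. (irreducible_word w \<and> hd w = In Stack1) \<and> length w = 2 * n}"
      then have m: "2 * n = mismatches w + (2 * n - mismatches w)" using mismatches_le_length[of w] by simp
      have "q ^ (2 * n) = q ^ mismatches w * q ^ (2 * n - mismatches w)" by (subst m) (rule power_add)
      moreover have "(1 - c / q) ^ mismatches w * q ^ mismatches w = (q - c) ^ mismatches w"
        using q by (simp add: power_mult_distrib[symmetric] field_simps)
      ultimately show "x ^ n * ((1 - c / q) ^ mismatches w * q ^ (2 * n)) =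
        x ^ n * ((q - c) ^ mismatches w * q ^ (2 * n - mismatches w))" by (metis mult.assoc)
    qed
    also have "\<dots> = x ^ n * (\<Sum>w | (irreducible_word w \<and> hd w = In Stack1) \<and> length w = 2 * n.
      (q - c) ^ mismatches w * q ^ (2 * n - mismatches w))" by (simp add: sum_distrib_left)
    finally show ?thesis .
  qed
  have mid: "?T q2 n \<le> (?T q1 n + ?T q3 n) / 2" for n
  proof -
    have "(q2 - c) ^ b * q2 ^ d \<le> ((q1 - c) ^ b * q1 ^ d + (q3 - c) ^ b * q3 ^ d) / 2" for b d
      using c le q2 by (intro midpoint_mult midpoint_power power_mono zero_le_power) auto
    then have "x ^ n * (\<Sum>w | (irreducible_word w \<and> hd w = In Stack1) \<and> length w = 2 * n.
        (q2 - c) ^ mismatches w * q2 ^ (2 * n - mismatches w)) \<le>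
      x ^ n * (\<Sum>w | (irreducible_word w \<and> hd w = In Stack1) \<and> length w = 2 * n.
        ((q1 - c) ^ mismatches w * q1 ^ (2 * n - mismatches w) + (q3 - c) ^ mismatches w * q3 ^ (2 * n - mismatches w)) / 2)"
      using x by (intro mult_left_mono sum_mono) auto
    also have "\<dots> = (?T q1 n + ?T q3 n) / 2"
      using T[of q1 n] T[of q3 n] c by (simp add: sum_divide_distrib[symmetric] sum.distrib distrib_left)
    finally show ?thesis using T[of q2 n] le by simp
  qed
  \<comment> \<open>The exact gap in the midpoint inequality for the summand
    \<open>x * q\<^sup>2\<close>; the other summands contribute at least 0. It makes the convexity
    quantitative.\<close>
  define Z where "Z n = (if n = 1 then x * ((q3 - q1) / 2)\<^sup>2 else 0)" for n :: nat
  have Z: "Z sums (x * ((q3 - q1) / 2)\<^sup>2)"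
    unfolding Z_def using sums_single[of 1 "\<lambda>_. x * ((q3 - q1) / 2)\<^sup>2"] by simp
  have "(\<Sum>n. ?T q2 n + Z n) \<le> (\<Sum>n. (?T q1 n + ?T q3 n) / 2)"
  proof (rule suminf_le)
    show "?T q2 n + Z n \<le> (?T q1 n + ?T q3 n) / 2" for n
    proof (cases "n = 1")
      case True
      have "x * q2\<^sup>2 + x * ((q3 - q1) / 2)\<^sup>2 = (x * q1\<^sup>2 + x * q3\<^sup>2) / 2"
        unfolding q2 by (simp add: power2_eq_square field_simps)
      then show ?thesis using True by (simp add: Z_def kappa_1 One_nat_def[symmetric] del: One_nat_def)
    qed (use mid in \<open>simp add: Z_def\<close>)
    show "summable (\<lambda>n. ?T q2 n + Z n)" using conv'[of q2] le sums_summable[OF Z] by (intro summable_add) auto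
    show "summable (\<lambda>n. (?T q1 n + ?T q3 n) / 2)"
      using conv'[of q1] conv'[of q3] c by (intro summable_divide summable_add) auto
  qed
  moreover have "(\<Sum>n. ?T q2 n + Z n) = val2 kappa (1 - c / q2) (x * q2\<^sup>2) + x * ((q3 - q1) / 2)\<^sup>2"
    using suminf_add[OF conv'[of q2] sums_summable[OF Z]] le sums_unique[OF Z] by (simp add: val2_def)
  moreover have "(\<Sum>n. (?T q1 n + ?T q3 n) / 2) =
      (val2 kappa (1 - c / q1) (x * q1\<^sup>2) + val2 kappa (1 - c / q3) (x * q3\<^sup>2)) / 2"
    using suminf_add[OF conv'[of q1] conv'[of q3]] suminf_divide[of "\<lambda>n. ?T q1 n + ?T q3 n" 2]
      summable_add[OF conv'[of q1] conv'[of q3]] c by (simp add: val2_def)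
  ultimately show ?thesis by linarith
qed

text \<open>Each partial sum is continuous in \<open>x\<close> and bounded by \<open>C\<close> below
  \<open>r\<close>, hence also at \<open>r\<close>; nonnegative terms then converge.\<close>

lemma summable_at_boundary:
  fixes a :: "nat \<Rightarrow> real"
  assumes a: "\<And>n. 0 \<le> a n" and r: "0 < r"
    and bound: "\<And>x. 0 < x \<Longrightarrow> x < r \<Longrightarrow> summable (\<lambda>n. a n * x ^ n) \<and> (\<Sum>n. a n * x ^ n) \<le> C"
  shows "summable (\<lambda>n. a n * r ^ n)" "(\<Sum>n. a n * r ^ n) \<le> C"
proof -
  have le: "(\<Sum>n<N. a n * r ^ n) \<le> C" for N
  proof (rule tendsto_upperbound)
    show "((\<lambda>x. \<Sum>n<N. a n * x ^ n) \<longlongrightarrow> (\<Sum>n<N. a n * r ^ n)) (at_left r)"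
      by (intro tendsto_intros)
    have "eventually (\<lambda>x. x \<in> {0<..<r}) (at_left r)"
      using r by (intro eventually_at_leftI[of 0]) auto
    then show "eventually (\<lambda>x. (\<Sum>n<N. a n * x ^ n) \<le> C) (at_left r)"
    proof eventually_elim
      case (elim x)
      have "(\<Sum>n<N. a n * x ^ n) \<le> (\<Sum>n. a n * x ^ n)"
        using elim bound[of x] a by (intro sum_le_suminf) auto
      then show ?case using bound[of x] elim by simp
    qed
  qed simp
  show s: "summable (\<lambda>n. a n * r ^ n)" using le a r by (intro summableI_nonneg_bounded) auto
  show "(\<Sum>n. a n * r ^ n) \<le> C" using le s by (intro suminf_le_const)
qed

section \<open>The value of \<open>Q\<close> on the curve and the bound 1/3\<close>

context parallel_stacks
begin

definition good :: "real \<Rightarrow> bool" where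
  "good t \<longleftrightarrow> ereal (u t) < rho (1 - y t)"

lemma q_bounds: "0 \<le> t \<Longrightarrow> t < tc \<Longrightarrow> 1 \<le> 2 * S t - 1"
  using S_ge_1[of t] by simp

lemma K_complex_real:
  assumes "conv2 kappa V X" "\<bar>1 - c / q\<bar> \<le> V" "\<bar>d * q\<^sup>2\<bar> \<le> X"
  shows "of_real q - 1 - 2 * series2 kappa (1 - of_real c / of_real q) (of_real d * (of_real q)\<^sup>2) =
    complex_of_real (q - 1 - 2 * val2 kappa (1 - c / q) (d * q\<^sup>2))"
  using series2_val2[OF nonneg_kappa assms] by simp

lemma continuous_on_near_0:
  fixes f :: "real \<Rightarrow> real"
  assumes "continuous_on {0..r} f" "0 < r" "0 < e"
  obtains d where "0 < d" "\<And>t. 0 \<le> t \<Longrightarrow> t < d \<Longrightarrow> t \<le> r \<Longrightarrow> \<bar>f t - f 0\<bar> < e"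
proof -
  have "\<exists>d>0. \<forall>t\<in>{0..r}. dist t 0 < d \<longrightarrow> dist (f t) (f 0) < e"
    using assms(1)[unfolded continuous_on_iff, rule_format, of 0 e] assms(2,3) by simp
  then obtain d where d: "0 < d" "\<forall>t\<in>{0..r}. dist t 0 < d \<longrightarrow> dist (f t) (f 0) < e" by blast
  show thesis by (rule that[OF d(1)]) (use d(2) in \<open>simp add: dist_real_def\<close>)
qed

lemma continuous_on_near_end:
  fixes f :: "real \<Rightarrow> real"
  assumes "continuous_on {a..b} f" "a \<le> b" "0 < e"
  obtains d where "0 < d" "\<And>t. a \<le> t \<Longrightarrow> t \<le> b \<Longrightarrow> b - d < t \<Longrightarrow> \<bar>f t - f b\<bar> < e"
proof -
  have "\<exists>d>0. \<forall>t\<in>{a..b}. dist t b < d \<longrightarrow> dist (f t) (f b) < e"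
    using assms(1)[unfolded continuous_on_iff, rule_format, of b e] assms(2,3) by simp
  then obtain d where d: "0 < d" "\<forall>t\<in>{a..b}. dist t b < d \<longrightarrow> dist (f t) (f b) < e" by blast
  show thesis by (rule that[OF d(1)]) (use d(2) in \<open>simp add: dist_real_def\<close>)
qed

text \<open>At \<open>t = 0\<close> the kernel equation reduces to \<open>q = 1\<close>, so the
  implicit function theorem gives a single solution near 1 for small \<open>t\<close>. Both
  \<open>Q\<close> on the curve and \<open>2 * S t - 1\<close> are such solutions by
  continuity.\<close>

lemma q_identity_near_0:
  "\<exists>e>0. \<forall>t. 0 < t \<and> t < e \<longrightarrow> t < tc \<and> val2 P (1 - y t) (u t) = 2 * S t - 1"
proof -
  define t1 where "t1 = tc / 2"
  have t1: "0 < t1" "t1 < tc" using tc_pos by (auto simp: t1_def)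
  define V X where "V = y t1" and "X = t1 * (S t1)\<^sup>2"
  have conv: "conv2 kappa V X" unfolding V_def X_def using K_S(1)[of t1] t1 by simp
  have VX: "0 < V" "0 < X"
    using y_strict_mono[of 0 t1] y_0 S_ge_1[of t1] t1 by (auto simp: V_def X_def)
  define E where "E = (\<lambda>z q. q - 1 - 2 * series2 kappa (1 - (1 + yc z) / q) (uc z * q\<^sup>2))"
  have yc0: "yc 0 = 0" "uc 0 = 0" using yc_real[of 0] uc_real[of 0] y_0 tc_pos by (auto simp: u_def)
  have E0: "E 0 = (\<lambda>q. q - 1)" by (auto simp: E_def yc0 series2_kappa_0)
  obtain \<epsilon> \<delta> g where g: "0 < \<epsilon>" "0 < \<delta>"
    "\<And>z w. z \<in> ball 0 \<epsilon> \<Longrightarrow> w \<in> ball 1 \<delta> \<Longrightarrow> E z w = 0 \<Longrightarrow> w = g z"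
  proof (rule K_implicit[of "\<lambda>z. 1 + yc z" 0 tc uc 1 V X E])
    show "(\<lambda>z. 1 + yc z) holomorphic_on ball 0 tc" by (intro holomorphic_intros yc_holomorphic)
    show "D \<noteq> 0" if "(E 0 has_field_derivative D) (at 1)" for D
    proof -
      have "((\<lambda>q. q - 1) has_field_derivative 1) (at (1 :: complex))" by (auto intro!: derivative_eq_intros)
      then show ?thesis using that unfolding E0 by (metis DERIV_unique zero_neq_one)
    qed
    fix \<epsilon> \<delta> g assume *: "0 < \<epsilon>" "0 < \<delta>" "\<And>z w. z \<in> ball 0 \<epsilon> \<Longrightarrow> w \<in> ball 1 \<delta> \<Longrightarrow> E z w = 0 \<Longrightarrow> w = g z"
    show thesis by (rule that[of \<epsilon> \<delta> g]) (fact *)+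
  qed (use uc_holomorphic tc_pos conv VX yc0 in \<open>auto simp: E0 E_def series2_kappa_0\<close>)
  \<comment> \<open>Room around \<open>b = 1\<close>, \<open>u = 0\<close> covers the start of the
    curve and makes \<open>Q\<close> continuous there.\<close>
  obtain b' x' where bx: "1 < b'" "0 < x'" "conv2 P b' x'"
    using conv_P_expand[of 1 0] rho_pos[of 1] by (auto simp: zero_ereal_def)
  define r where "r = min x' t1"
  have r: "0 < r" "r \<le> t1" "r \<le> x'" "r < tc" using bx t1 by (auto simp: r_def)
  have yr: "0 \<le> y t" "y t < 1" "0 \<le> u t" "u t \<le> x'" "u t \<le> t" if "0 \<le> t" "t \<le> r" for t
    using y_bounds[of t] u_bounds[of t] that r by auto
  define w where "w t = val2 P (1 - y t) (u t)" for t
  have cy: "continuous_on {0..r} y" and cu: "continuous_on {0..r} u" and cS: "continuous_on {0..r} S"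
    using r by (auto intro: continuous_on_subset[OF y_continuous] continuous_on_subset[OF u_continuous]
        continuous_on_subset[OF S_continuous])
  have cw: "continuous_on {0..r} w" unfolding w_def
    by (rule val2_continuous_on[OF P_nonneg bx(3)]) (use cy cu yr bx in \<open>auto intro!: continuous_intros simp: less_imp_le\<close>,
        use yr bx in fastforce)
  have w0: "w 0 = 1" by (simp add: w_def y_0 u_def val_P_0)
  have w1: "1 \<le> w t" if "0 \<le> t" "t \<le> r" for t
  proof -
    have "conv2 P (1 - y t) (u t)"
      by (rule conv2_mono[OF P_nonneg bx(3)]) (use yr[OF that] bx in auto)
    then show ?thesis unfolding w_def using yr[OF that] by (intro val_P_ge_1) auto
  qed
  have c1: "continuous_on {0..r} (\<lambda>t. 1 - (1 + y t) / w t)"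
    using w1 by (intro continuous_intros cy cw) force
  have c2: "continuous_on {0..r} (\<lambda>t. u t * (w t)\<^sup>2)" by (intro continuous_intros cu cw)
  have c3: "continuous_on {0..r} (\<lambda>t. 2 * S t - 1)" by (intro continuous_intros cS)
  have S0: "S 0 = 1" using S_y[of 0] y_0 tc_pos by simp
  obtain d1 where d1: "0 < d1" "\<And>t. 0 \<le> t \<Longrightarrow> t < d1 \<Longrightarrow> t \<le> r \<Longrightarrow> \<bar>w t - w 0\<bar> < \<delta>"
    by (rule continuous_on_near_0[OF cw r(1) g(2)]) (rule that)
  obtain d2 where d2: "0 < d2" "\<And>t. 0 \<le> t \<Longrightarrow> t < d2 \<Longrightarrow> t \<le> r \<Longrightarrow>
      \<bar>(1 - (1 + y t) / w t) - (1 - (1 + y 0) / w 0)\<bar> < V"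
    by (rule continuous_on_near_0[OF c1 r(1) VX(1)]) (rule that)
  obtain d3 where d3: "0 < d3" "\<And>t. 0 \<le> t \<Longrightarrow> t < d3 \<Longrightarrow> t \<le> r \<Longrightarrow> \<bar>u t * (w t)\<^sup>2 - u 0 * (w 0)\<^sup>2\<bar> < X"
    by (rule continuous_on_near_0[OF c2 r(1) VX(2)]) (rule that)
  obtain d4 where d4: "0 < d4" "\<And>t. 0 \<le> t \<Longrightarrow> t < d4 \<Longrightarrow> t \<le> r \<Longrightarrow> \<bar>(2 * S t - 1) - (2 * S 0 - 1)\<bar> < \<delta>"
    by (rule continuous_on_near_0[OF c3 r(1) g(2)]) (rule that)
  have u0: "u 0 = 0" by (simp add: u_def)
  define e where "e = Min {d1, d2, d3, d4, \<epsilon>, r, 1/16}"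
  have e: "0 < e" "e \<le> d1" "e \<le> d2" "e \<le> d3" "e \<le> d4" "e \<le> \<epsilon>" "e \<le> r" "e \<le> 1/16"
  proof -
    show "0 < e" unfolding e_def
      by (subst Min_gr_iff) (simp_all add: d1(1) d2(1) d3(1) d4(1) g(1) r(1))
    have le: "e \<le> k" if "k \<in> {d1, d2, d3, d4, \<epsilon>, r, 1/16}" for k
      unfolding e_def by (rule Min_le[OF _ that]) simp
    show "e \<le> d1" "e \<le> d2" "e \<le> d3" "e \<le> d4" "e \<le> \<epsilon>" "e \<le> r" "e \<le> 1/16" by (rule le, simp)+
  qed
  have "t < tc \<and> val2 P (1 - y t) (u t) = 2 * S t - 1" if t: "0 < t" "t < e" for t
  proof -
    have tr: "0 \<le> t" "t \<le> r" "t < tc" "t \<le> t1" using t e r by auto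
    have q: "1 \<le> 2 * S t - 1" using q_bounds tr by simp
    have Ew: "E (of_real t) (of_real w') = of_real (w' - 1 - 2 * val2 kappa (1 - (1 + y t) / w') (u t * w'\<^sup>2))"
      if "\<bar>1 - (1 + y t) / w'\<bar> \<le> V" "\<bar>u t * w'\<^sup>2\<bar> \<le> X" for w'
      unfolding E_def yc_real[OF tr(1,3)] uc_real[OF tr(1,3)]
      using K_complex_real[OF conv that] by simp
    have "w t - 1 = 2 * val2 kappa (1 - (1 + y t) / w t) (u t * (w t)\<^sup>2)"
      unfolding w_def using Q_eq(2)[of "1 - y t" "u t"] yr[OF tr(1,2)] t e by simp
    then have E1: "E (of_real t) (of_real (w t)) = 0"
      using Ew[of "w t"] d2(2)[of t] d3(2)[of t] tr t e w0 y_0 u0 by simp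
    have v: "1 - (1 + y t) / (2 * S t - 1) = y t" using one_plus_y[of t] tr by simp
    have "y t \<le> V" "t * (S t)\<^sup>2 \<le> X"
      using y_mono[of t t1] x_strict_mono[of t t1] tr t1 unfolding V_def X_def
      by (simp, cases "t = t1", auto simp: less_imp_le)
    then have E2: "E (of_real t) (of_real (2 * S t - 1)) = 0"
      using Ew[of "2 * S t - 1"] K_S(2)[of t] tr yr[OF tr(1,2)] unfolding v u_q[OF tr(1,3)] by simp
    have "of_real t \<in> ball (0::complex) \<epsilon>" using t e by simp
    moreover have "of_real (w t) \<in> ball (1::complex) \<delta>" "of_real (2 * S t - 1) \<in> ball (1::complex) \<delta>"
      using d1(2)[of t] d4(2)[of t] tr t e w0 S0 dist_of_real[of 1 "w t", where 'a = complex]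
        dist_of_real[of 1 "2 * S t - 1", where 'a = complex]
      by (simp_all add: dist_real_def abs_minus_commute del: of_real_diff of_real_mult)
    ultimately have "complex_of_real (w t) = complex_of_real (2 * S t - 1)"
      using g(3) E1 E2 by metis
    then have "w t = 2 * S t - 1" by (simp only: of_real_eq_iff)
    then show ?thesis using tr by (simp add: w_def)
  qed
  then show ?thesis using e(1) by blast
qed

text \<open>Continuation in \<open>t\<close>. The convergence domain of \<open>Q\<close> is
  exhausted by boxes, and the complexified curve is followed on the union of their preimages;
  goodness ensures that each real point has a box with room. On the other side
  \<open>2 / (1 - yc z) - 1\<close> extends \<open>2 * S t - 1\<close>.\<close>

lemma q_identity:
  assumes r: "0 < r" "r < tc" and gd: "\<And>t. 0 \<le> t \<Longrightarrow> t \<le> r \<Longrightarrow> good t" and t: "0 \<le> t" "t \<le> r"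
  shows "val2 P (1 - y t) (u t) = 2 * S t - 1"
proof -
  define A where "A = (\<lambda>(b', x'). {z \<in> ball 0 tc. norm (1 - yc z) < b'} \<inter> {z \<in> ball 0 tc. norm (uc z) < x'})"
  define I where "I = {(b', x'). conv2 P b' x'}"
  have oA: "open (A i)" for i
    unfolding A_def case_prod_unfold
    by (intro open_Int open_Collect_less_open open_ball continuous_on_norm continuous_intros
        holomorphic_on_imp_continuous_on yc_holomorphic uc_holomorphic)
  have sub: "A i \<subseteq> ball 0 tc" for i by (auto simp: A_def)
  let ?f = "\<lambda>z. series2 P (1 - yc z) (uc z)" and ?g = "\<lambda>z. 2 / (1 - yc z) - 1"
  have "?f holomorphic_on (\<Union>i\<in>I. A i)"
  proof (rule holomorphic_on_UN_open[OF _ oA])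
    fix i assume i: "i \<in> I"
    obtain b' x' where bx: "i = (b', x')" "conv2 P b' x'" using i by (auto simp: I_def)
    show "?f holomorphic_on A i"
      by (rule series2_holomorphic[OF P_nonneg bx(2)[unfolded conv2_def] oA])
         (use bx in \<open>auto simp: A_def intro!: holomorphic_intros
            intro: holomorphic_on_subset[OF yc_holomorphic] holomorphic_on_subset[OF uc_holomorphic]\<close>)
  qed
  moreover have "?g holomorphic_on (\<Union>i\<in>I. A i)"
    by (intro holomorphic_intros holomorphic_on_subset[OF yc_holomorphic]) (use sub one_pm_yc in force)+
  moreover obtain e where e: "0 < e"
    "\<And>t. 0 < t \<Longrightarrow> t < e \<Longrightarrow> t < tc \<and> val2 P (1 - y t) (u t) = 2 * S t - 1"
    using q_identity_near_0 by blast
  have box: "\<exists>b' x'. 1 - y t < b' \<and> u t < x' \<and> conv2 P b' x'" if "0 \<le> t" "t \<le> r" for t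
    using conv_P_expand[of "1 - y t" "u t"] gd[OF that] y_bounds[of t] u_bounds[of t] that r
    unfolding good_def by auto
  have f_real: "?f (of_real t) = of_real (val2 P (1 - y t) (u t))" if tt: "0 \<le> t" "t \<le> r" for t
  proof -
    obtain b' x' where bx: "1 - y t < b'" "u t < x'" "conv2 P b' x'" using box[OF tt] by blast
    have "series2 P (of_real (1 - y t)) (of_real (u t)) = of_real (val2 P (1 - y t) (u t))"
      by (rule series2_val2[OF P_nonneg bx(3)]) (use bx y_bounds[of t] u_bounds[of t] tt r in auto)
    then show ?thesis using tt r by (simp add: yc_real uc_real)
  qed
  have g_real: "?g (of_real t) = of_real (2 * S t - 1)" if "0 \<le> t" "t \<le> r" for t
    using that r by (simp add: yc_real S_y)
  have "?f (of_real t) = ?g (of_real t)"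
  proof (rule holomorphic_eq_on_segment[of "\<Union>i\<in>I. A i" ?f ?g r e])
    show "open (\<Union>i\<in>I. A i)" using oA by blast
    show "of_real ` {0..r} \<subseteq> (\<Union>i\<in>I. A i)"
    proof
      fix z assume "z \<in> complex_of_real ` {0..r}"
      then obtain t where t: "z = of_real t" "0 \<le> t" "t \<le> r" by auto
      obtain b' x' where bx: "1 - y t < b'" "u t < x'" "conv2 P b' x'" using box[OF t(2,3)] by blast
      have "norm (1 - yc z) = 1 - y t"
        using t r y_bounds[of t] norm_of_real[of "1 - y t", where 'a = complex] by (simp add: yc_real)
      moreover have "norm (uc z) = u t" using t r u_bounds[of t] by (simp add: uc_real)
      ultimately have "z \<in> A (b', x')" using bx t r by (simp add: A_def)
      then show "z \<in> (\<Union>i\<in>I. A i)" using bx by (auto simp: I_def)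
    qed
    show "?f (of_real t) = ?g (of_real t)" if "0 < t" "t < e" "t \<le> r" for t
      using e(2)[of t] f_real[of t] g_real[of t] that by simp
  qed (use calculation e r t in auto)
  then show ?thesis using f_real[OF t] g_real[OF t] by (simp only: of_real_eq_iff)
qed

text \<open>A later point of the curve, still below \<open>tc\<close>, yields a convergence box that
  is strictly larger in both variables.\<close>

lemma K_box:
  assumes t: "0 \<le> t" "t < tc"
  obtains V X where "conv2 kappa V X" "y t < V" "t * (S t)\<^sup>2 < X"
proof -
  define t1 where "t1 = (t + tc) / 2"
  have "t < t1" "t1 < tc" using t by (auto simp: t1_def)
  then show ?thesis using that[of "y t1" "t1 * (S t1)\<^sup>2"] K_S(1)[of t1] y_strict_mono[of t t1] x_strict_mono[of t t1] t
    by auto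
qed

text \<open>A value \<open>y t > 1/3\<close> means \<open>q > 2\<close>. Comparing the kernel
  equation at \<open>u t\<close> with a slightly smaller first argument then gives opposite
  inequalities: one from the kernel, the other from \<open>(q - 1) / q\<^sup>2\<close>
  alone.\<close>

lemma y_le_third:
  assumes t: "0 \<le> t" "t < tc" and gd: "\<And>s. 0 \<le> s \<Longrightarrow> s \<le> t \<Longrightarrow> good s"
  shows "y t \<le> 1/3"
proof (rule ccontr)
  assume n: "\<not> ?thesis"
  then have t0: "0 < t" using t y_0 by (cases "t = 0") auto
  define q where "q = 2 * S t - 1"
  define b where "b = 1 - y t"
  have yb: "0 \<le> y t" "y t < 1" using y_bounds t by auto
  have b: "0 < b" "b \<le> 1" "2 - b = 1 + y t" using yb by (auto simp: b_def)
  have "2 < (1 + y t) / (1 - y t)" using n yb by (simp add: pos_less_divide_eq)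
  then have q2: "2 < q" unfolding q_def twice_S[OF t] .
  have val: "val2 P b (u t) = q" unfolding b_def q_def by (rule q_identity[OF t0 t(2) gd]) (use t in auto)
  have u0: "0 < u t" using u_pos t0 t by simp
  have gt: "ereal (u t) < rho b" using gd[of t] t by (simp add: good_def b_def)
  have convu: "conv2 P b (u t)" using conv_P gt u0 by simp
  obtain V X where VX: "conv2 kappa V X" "y t < V" "t * (S t)\<^sup>2 < X" using K_box[OF t] .
  have qb: "val2 P b x \<le> q" if "0 \<le> x" "x \<le> u t" for x
    using val_P_mono_x[of b x "u t"] that b convu val by simp
  have uq: "u t * q\<^sup>2 = t * (S t)\<^sup>2" unfolding q_def by (rule u_q[OF t])
  have v: "1 - (2 - b) / q = y t" unfolding q_def b(3) using one_plus_y[OF t] by simp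
  have K: "val2 P b x - 1 = 2 * val2 kappa (1 - (2 - b) / val2 P b x) (x * (val2 P b x)\<^sup>2)"
    if "0 \<le> x" "x \<le> u t" for x
  proof (rule K_equation[OF b(1,2) u0 gt VX(1), of q])
    show "1 - b < V" using VX by (simp add: b_def)
    show "1 - (2 - b) / q < V" using VX v by simp
    show "u t * q\<^sup>2 < X" using VX uq by simp
  qed (use that qb in auto)
  have cf: "continuous_on {0..u t} (val2 P b)"
    by (rule val2_continuous_on[OF P_nonneg convu]) (use b in \<open>auto intro!: continuous_intros\<close>)
  obtain d where d: "0 < d" "\<And>x. 0 \<le> x \<Longrightarrow> x \<le> u t \<Longrightarrow> u t - d < x \<Longrightarrow> \<bar>val2 P b x - val2 P b (u t)\<bar> < q - 2"
  proof (rule continuous_on_near_end[OF cf, of "q - 2"])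
    fix d assume *: "0 < d" "\<And>x. 0 \<le> x \<Longrightarrow> x \<le> u t \<Longrightarrow> u t - d < x \<Longrightarrow> \<bar>val2 P b x - val2 P b (u t)\<bar> < q - 2"
    show thesis by (rule that[of d]) (fact *)+
  qed (use u0 q2 in auto)
  \<comment> \<open>So close to \<open>u t\<close> that the value \<open>q1\<close> of
    \<open>Q\<close> still exceeds 2.\<close>
  define x where "x = max (u t / 2) (u t - d / 2)"
  have x: "0 < x" "x < u t" "u t - d < x" using u0 d by (auto simp: x_def)
  define q1 where "q1 = val2 P b x"
  have q1: "2 < q1" "q1 \<le> q" using d(2)[of x] x qb[of x] val by (auto simp: q1_def)
  have "val2 kappa (1 - (2 - b) / q1) (x * q1\<^sup>2) * (u t * q\<^sup>2) \<le> val2 kappa (1 - (2 - b) / q) (u t * q\<^sup>2) * (x * q1\<^sup>2)"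
  proof (rule val2_kappa_scale)
    show "conv2 kappa (1 - (2 - b) / q) (u t * q\<^sup>2)" unfolding v uq by (rule K_S(1)[OF t])
    show "0 \<le> 1 - (2 - b) / q1" using q1 b yb by (simp add: field_simps)
    have "(2 - b) / q \<le> (2 - b) / q1" using q1 b by (intro divide_left_mono) auto
    then show "1 - (2 - b) / q1 \<le> 1 - (2 - b) / q" by simp
    show "x * q1\<^sup>2 \<le> u t * q\<^sup>2" using x q1 by (intro mult_mono power_mono) auto
  qed (use x in auto)
  then have "(q1 - 1) / 2 * (u t * q\<^sup>2) \<le> (q - 1) / 2 * (x * q1\<^sup>2)"
    using K[of x] K[of "u t"] x u0 val by (simp add: q1_def)
  then have "(q1 - 1) * (u t * q\<^sup>2) \<le> (q - 1) * (x * q1\<^sup>2)" by simp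
  then have 1: "(q1 - 1) * q\<^sup>2 * u t \<le> (q - 1) * q1\<^sup>2 * x" by (simp only: mult_ac)
  \<comment> \<open>This product equals \<open>(q1 - 1) * q\<^sup>2 - (q - 1) * q1\<^sup>2\<close>;
    its second factor is positive because both values exceed 2.\<close>
  have "0 \<le> (q - q1) * (q * q1 - q - q1)"
  proof (intro mult_nonneg_nonneg)
    have "0 \<le> (q - 2) * (q1 - 1) + (q1 - 2)" using q1 q2 by (intro add_nonneg_nonneg mult_nonneg_nonneg) auto
    then show "0 \<le> q * q1 - q - q1" by (simp add: algebra_simps)
  qed (use q1 in simp)
  then have 2: "(q - 1) * q1\<^sup>2 \<le> (q1 - 1) * q\<^sup>2" by (simp add: power2_eq_square algebra_simps)
  have "(q - 1) * q1\<^sup>2 * x < (q - 1) * q1\<^sup>2 * u t" using q1 q2 x by (intro mult_strict_left_mono) auto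
  also have "\<dots> \<le> (q1 - 1) * q\<^sup>2 * u t" using 2 u0 by (intro mult_right_mono) auto
  finally show False using 1 by simp
qed

end

section \<open>Behaviour at the first singularity\<close>

text \<open>A vanishing derivative makes \<open>F\<close> small of higher order near
  \<open>w0\<close>; linear growth along any points tending to \<open>w0\<close> already excludes
  this, so real test points suffice.\<close>

lemma derivative_nonzeroI:
  fixes F :: "complex \<Rightarrow> complex"
  assumes F: "(F has_field_derivative D) (at w0)" "F w0 = 0" and m: "0 < m"
    and lower: "\<And>e. 0 < e \<Longrightarrow> \<exists>w. w \<noteq> w0 \<and> norm (w - w0) < e \<and> m * norm (w - w0) \<le> norm (F w)"
  shows "D \<noteq> 0"
proof
  assume "D = 0"
  then have "(F has_derivative (\<lambda>h. 0)) (at w0)"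
    using F(1) by (simp add: has_field_derivative_def lambda_zero)
  then have "\<forall>e>0. \<exists>d>0. \<forall>w. norm (w - w0) < d \<longrightarrow> norm (F w - F w0 - 0) \<le> e * norm (w - w0)"
    unfolding has_derivative_at_alt by blast
  then obtain d where d: "0 < d" "\<And>w. norm (w - w0) < d \<Longrightarrow> norm (F w - F w0 - 0) \<le> m / 2 * norm (w - w0)"
    using half_gt_zero[OF m] by blast
  obtain w where w: "w \<noteq> w0" "norm (w - w0) < d" "m * norm (w - w0) \<le> norm (F w)"
    using lower[OF d(1)] by blast
  have "m * norm (w - w0) \<le> m / 2 * norm (w - w0)" using d(2)[OF w(2)] w(3) F(2) by simp
  then show False using m w(1) by simp
qed

text \<open>Termwise, \<open>r ^ (n + 1) - x ^ (n + 1)\<close> is at most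
  \<open>(n + 1) * r ^ n * (r - x)\<close>. A finite derivative at the radius thus gives a Lipschitz
  bound up to the radius.\<close>

lemma suminf_diff_le_diffs:
  fixes a :: "nat \<Rightarrow> real"
  assumes a: "\<And>n. 0 \<le> a n" and x: "0 \<le> x" "x \<le> r"
    and s: "summable (\<lambda>n. a n * r ^ n)" "summable (\<lambda>n. diffs a n * r ^ n)"
  shows "(\<Sum>n. a n * r ^ n) - (\<Sum>n. a n * x ^ n) \<le> (\<Sum>n. diffs a n * r ^ n) * (r - x)"
proof -
  have sx: "summable (\<lambda>n. a n * x ^ n)"
    by (rule summable_comparison_test'[OF s(1), of 0])
       (use a x in \<open>auto simp: abs_mult intro!: mult_left_mono power_mono\<close>)
  have sd: "summable (\<lambda>n. a n * r ^ n - a n * x ^ n)" using s(1) sx by (rule summable_diff)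
  have "(\<Sum>n. a n * r ^ n) - (\<Sum>n. a n * x ^ n) = (\<Sum>n. a n * r ^ n - a n * x ^ n)"
    using s(1) sx by (rule suminf_diff)
  also have "\<dots> = (\<Sum>n. a (Suc n) * r ^ Suc n - a (Suc n) * x ^ Suc n)"
    using suminf_split_head[OF sd] by simp
  also have "\<dots> \<le> (\<Sum>n. diffs a n * r ^ n * (r - x))"
  proof (rule suminf_le)
    fix n
    have "(\<Sum>i<Suc n. r ^ (n - i) * x ^ i) \<le> (\<Sum>i<Suc n. r ^ n)"
    proof (rule sum_mono)
      fix i assume "i \<in> {..<Suc n}"
      then have "r ^ n = r ^ (n - i) * r ^ i" by (simp add: power_add[symmetric])
      then show "r ^ (n - i) * x ^ i \<le> r ^ n" using x by (simp add: mult_left_mono power_mono)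
    qed
    then have "(r - x) * (\<Sum>i<Suc n. r ^ (n - i) * x ^ i) \<le> (r - x) * (real (Suc n) * r ^ n)"
      using x by (intro mult_left_mono) auto
    moreover have "r ^ Suc n - x ^ Suc n = (r - x) * (\<Sum>i<Suc n. r ^ (n - i) * x ^ i)"
      using power_diff_sumr2[of x "Suc n" r]
      by (simp add: left_diff_distrib del: power_Suc sum.lessThan_Suc)
    ultimately have "r ^ Suc n - x ^ Suc n \<le> (r - x) * (real (Suc n) * r ^ n)" by simp
    from mult_left_mono[OF this a[of "Suc n"]]
    show "a (Suc n) * r ^ Suc n - a (Suc n) * x ^ Suc n \<le> diffs a n * r ^ n * (r - x)"
      by (simp add: diffs_def algebra_simps)
  next
    show "summable (\<lambda>n. a (Suc n) * r ^ Suc n - a (Suc n) * x ^ Suc n)"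
      using sd by (subst summable_Suc_iff[of "\<lambda>n. a n * r ^ n - a n * x ^ n"])
    show "summable (\<lambda>n. diffs a n * r ^ n * (r - x))" using s(2) by (rule summable_mult2)
  qed
  also have "\<dots> = (\<Sum>n. diffs a n * r ^ n) * (r - x)" using s(2) by (rule suminf_mult2[symmetric])
  finally show ?thesis .
qed

context parallel_stacks
begin

text \<open>Along the curve \<open>b\<close> decreases, so the radius can only grow, while
  \<open>u\<close> is continuous and needs time to catch up.\<close>

lemma good_persists:
  assumes t: "0 \<le> t" "t < tc" "good t"
  obtains e where "0 < e" "\<And>t'. t \<le> t' \<Longrightarrow> t' < t + e \<Longrightarrow> t' < tc \<Longrightarrow> good t'"
proof -
  obtain r where r: "ereal (u t) < ereal r" "ereal r < rho (1 - y t)"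
    using t(3) ereal_dense2 unfolding good_def by blast
  have "\<exists>d>0. \<forall>t'\<in>{0..<tc}. dist t' t < d \<longrightarrow> dist (u t') (u t) < r - u t"
    using u_continuous[unfolded continuous_on_iff, rule_format, of t "r - u t"] t r(1) by simp
  then obtain d where d: "0 < d" "\<And>t'. t' \<in> {0..<tc} \<Longrightarrow> dist t' t < d \<Longrightarrow> dist (u t') (u t) < r - u t"
    by blast
  show thesis
  proof (rule that[OF d(1)])
    fix t' assume t': "t \<le> t'" "t' < t + d" "t' < tc"
    have "u t' < r" using d(2)[of t'] t t' by (simp add: dist_real_def abs_less_iff)
    moreover have "rho (1 - y t) \<le> rho (1 - y t')"
      using y_mono[of t t'] y_bounds[of t'] t t' by (intro rho_antimono) auto
    ultimately show "good t'" unfolding good_def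
      using r(2) by (meson ereal_less(2) less_ereal.simps(1) less_le_trans order_less_trans)
  qed
qed

text \<open>Let \<open>E z q\<close> be the defect of the kernel equation and \<open>f\<close> the
  function \<open>Q(a, .)\<close>. Moving the first argument of \<open>E x (f x) = 0\<close> from
  \<open>x\<close> to \<open>\<rho>\<close> costs at least \<open>2 (\<rho> - x)\<close>, whereas
  the finite derivative bounds \<open>f \<rho> - f x\<close> by a multiple of
  \<open>\<rho> - x\<close>; so \<open>E \<rho>\<close> has non-zero slope at
  \<open>f \<rho>\<close>. From \<open>x0\<close> on, the first kernel argument is nonnegative, as
  monotonicity of the kernel requires.\<close>

lemma singular_contradiction:
  assumes b: "0 < b" "b \<le> 1" and \<rho>: "0 < \<rho>" "rho b = ereal \<rho>"
    and conv: "conv2 kappa V X" and V: "1 - b < V" "1 - (2 - b) / qb < V" and X: "\<rho> * qb\<^sup>2 < X"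
    and qb: "\<And>x. 0 \<le> x \<Longrightarrow> x < \<rho> \<Longrightarrow> val2 P b x \<le> qb"
    and x0: "0 \<le> x0" "x0 < \<rho>" "2 - b \<le> val2 P b x0"
    and deriv: "Q_deriv_u (b - 1) (ereal \<rho>) < \<infinity>"
  shows False
proof -
  define a where "a n = poly (P n) b" for n
  define f where "f x = val2 P b x" for x
  have a: "0 \<le> a n" for n unfolding a_def using P_nonneg b by (intro poly_nonneg) auto
  have lt: "ereal x < rho b" if "x < \<rho>" for x using that \<rho> by simp
  have below: "summable (\<lambda>n. a n * x ^ n) \<and> (\<Sum>n. a n * x ^ n) \<le> qb" if "0 < x" "x < \<rho>" for x
    using conv_P[of x b] lt[of x] qb[of x] that by (simp add: a_def conv2_def val2_def)
  have sum\<rho>: "summable (\<lambda>n. a n * \<rho> ^ n)" and f\<rho>: "f \<rho> \<le> qb"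
    using summable_at_boundary[OF a \<rho>(1) below] by (simp_all add: f_def val2_def a_def)
  have conv\<rho>: "conv2 P b \<rho>" using sum\<rho> by (simp add: conv2_def a_def)
  have fc: "continuous_on {0..\<rho>} f" unfolding f_def
    by (rule val2_continuous_on[OF P_nonneg conv\<rho>]) (use b in \<open>auto intro!: continuous_intros\<close>)
  have f1: "1 \<le> f x" if "0 \<le> x" "x \<le> \<rho>" for x
    unfolding f_def using that b by (intro val_P_ge_1 conv2_mono[OF P_nonneg conv\<rho>]) auto
  have fm: "f x \<le> f x'" if "0 \<le> x" "x \<le> x'" "x' \<le> \<rho>" for x x'
    unfolding f_def using that b by (intro val_P_mono_x conv2_mono[OF P_nonneg conv\<rho>]) auto
  have fq: "f x \<le> qb" if "0 \<le> x" "x \<le> \<rho>" for x using fm[of x \<rho>] f\<rho> that by simp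
  have bnd: "\<bar>1 - (2 - b) / f x\<bar> < V" "\<bar>z * (f x)\<^sup>2\<bar> < X" if x: "0 \<le> x" "x \<le> \<rho>" "0 \<le> z" "z \<le> \<rho>" for x z
  proof -
    have "(2 - b) / qb \<le> (2 - b) / f x"
      using f1[OF x(1,2)] fq[OF x(1,2)] b by (intro divide_left_mono) auto
    moreover have "(2 - b) / f x \<le> (2 - b) / 1" using f1[OF x(1,2)] b by (intro divide_left_mono) auto
    ultimately show "\<bar>1 - (2 - b) / f x\<bar> < V" using V by auto
    have "z * (f x)\<^sup>2 \<le> \<rho> * qb\<^sup>2"
      using f1[OF x(1,2)] fq[OF x(1,2)] x by (intro mult_mono power_mono) auto
    then show "\<bar>z * (f x)\<^sup>2\<bar> < X" using X x by simp
  qed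
  define E where "E z q = q - 1 - 2 * val2 kappa (1 - (2 - b) / q) (z * q\<^sup>2)" for z q
  have E_below: "E x (f x) = 0" if x: "0 \<le> x" "x < \<rho>" for x
  proof -
    define r where "r = (x + \<rho>) / 2"
    have r: "0 < r" "x \<le> r" "r < \<rho>" using x by (auto simp: r_def)
    have "val2 P b x - 1 = 2 * val2 kappa (1 - (2 - b) / val2 P b x) (x * (val2 P b x)\<^sup>2)"
    proof (rule K_equation[OF b r(1) lt[OF r(3)] conv V])
      have "r * qb\<^sup>2 \<le> \<rho> * qb\<^sup>2" using r by (intro mult_right_mono) auto
      then show "r * qb\<^sup>2 < X" using X by simp
    qed (use x r qb in auto)
    then show ?thesis by (simp add: E_def f_def)
  qed
  have E\<rho>: "E \<rho> (f \<rho>) = 0"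
  proof (rule continuous_constant_on_closure[of "{0..<\<rho>}" "\<lambda>x. E x (f x)" 0 \<rho>])
    have "continuous_on {0..\<rho>} (\<lambda>x. val2 kappa (1 - (2 - b) / f x) (x * (f x)\<^sup>2))"
    proof (rule val2_continuous_on[OF nonneg_kappa conv])
      show "continuous_on {0..\<rho>} (\<lambda>x. 1 - (2 - b) / f x)"
        using f1 by (intro continuous_intros fc) force
      show "continuous_on {0..\<rho>} (\<lambda>x. x * (f x)\<^sup>2)" by (intro continuous_intros fc)
    qed (use bnd in \<open>auto simp: less_imp_le\<close>)
    then have "continuous_on {0..\<rho>} (\<lambda>x. E x (f x))" unfolding E_def by (intro continuous_intros fc)
    then show "continuous_on (closure {0..<\<rho>}) (\<lambda>x. E x (f x))" using \<rho> by (simp add: closure_atLeastLessThan)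
  qed (use E_below \<rho> in \<open>auto simp: closure_atLeastLessThan\<close>)
  define M where "M = (\<Sum>n. diffs a n * \<rho> ^ n)"
  have diffs_a: "diffs (\<lambda>k. poly (Q_coeff k) (b - 1)) = diffs a" by (simp add: diffs_def a_def P_eq)
  have diffs_nonneg: "0 \<le> diffs a n * \<rho> ^ n" for n using a \<rho> by (simp add: diffs_def)
  have "(\<Sum>n. ereal (diffs a n * \<rho> ^ n)) < \<infinity>"
    using deriv unfolding Q_deriv_u_def diffs_a by simp
  then have sumd: "summable (\<lambda>n. diffs a n * \<rho> ^ n)"
    by (intro summable_ereal[OF diffs_nonneg]) auto
  have M0: "0 \<le> M" unfolding M_def by (rule suminf_nonneg[OF sumd diffs_nonneg])
  have fM: "f \<rho> - f x \<le> M * (\<rho> - x)" if "0 \<le> x" "x \<le> \<rho>" for x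
    using suminf_diff_le_diffs[OF a that sum\<rho> sumd] by (simp add: M_def f_def val2_def a_def)
  \<comment> \<open>Only the term \<open>n = 1\<close> of the kernel is used: it grows by
    \<open>(\<rho> - x) * (f x)\<^sup>2\<close>, which is at least \<open>\<rho> - x\<close> as
    \<open>f x >= 1\<close>.\<close>
  have E_le: "E \<rho> (f x) \<le> - 2 * (\<rho> - x)" if x: "x0 \<le> x" "x < \<rho>" for x
  proof -
    have x': "0 \<le> x" "x \<le> \<rho>" using x x0 by auto
    have v: "0 \<le> 1 - (2 - b) / f x" using fm[of x0 x] x x0 b f1[OF x'] by (simp add: f_def)
    have "1 \<le> (f x)\<^sup>2" using f1[OF x'] by (simp add: one_le_power)
    then have "\<rho> - x \<le> (\<rho> - x) * (f x)\<^sup>2" using x mult_left_mono[of 1 "(f x)\<^sup>2" "\<rho> - x"] by simp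
    also have "\<dots> = \<rho> * (f x)\<^sup>2 - x * (f x)\<^sup>2" by (simp add: algebra_simps)
    also have "\<dots> \<le> val2 kappa (1 - (2 - b) / f x) (\<rho> * (f x)\<^sup>2) - val2 kappa (1 - (2 - b) / f x) (x * (f x)\<^sup>2)"
    proof (rule val2_kappa_diff_ge)
      show "conv2 kappa (1 - (2 - b) / f x) (\<rho> * (f x)\<^sup>2)"
        using bnd(1)[OF x' x'] bnd(2)[OF x', of \<rho>] \<rho> by (intro conv2_abs[OF nonneg_kappa conv]) auto
    qed (use v x' in \<open>auto intro: mult_right_mono\<close>)
    finally show ?thesis using E_below[OF x'(1) x(2)] by (simp add: E_def)
  qed
  define Ec where "Ec = (\<lambda>z q. q - 1 - 2 * series2 kappa (1 - of_real (2 - b) / q) (z * q\<^sup>2))"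
  have Ec: "Ec (of_real z) (of_real (f x)) = of_real (E z (f x))" if "0 \<le> x" "x \<le> \<rho>" "0 \<le> z" "z \<le> \<rho>" for x z
    unfolding Ec_def E_def using bnd[OF that] by (intro K_complex_real[OF conv]) auto
  obtain \<epsilon> \<delta> g where g: "0 < \<epsilon>" "0 < \<delta>" "g holomorphic_on ball (of_real \<rho>) \<epsilon>"
    "\<And>z w. z \<in> ball (of_real \<rho>) \<epsilon> \<Longrightarrow> w \<in> ball (of_real (f \<rho>)) \<delta> \<Longrightarrow> Ec z w = 0 \<Longrightarrow> w = g z"
  proof (rule K_implicit[of "\<lambda>z. of_real (2 - b)" "of_real \<rho>" 1 "\<lambda>z. z" "of_real (f \<rho>)" V X Ec])
    show "norm (1 - of_real (2 - b) / complex_of_real (f \<rho>)) < V"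
      using bnd(1)[of \<rho> \<rho>] \<rho> norm_of_real[of "1 - (2 - b) / f \<rho>", where 'a = complex] by simp
    show "norm (complex_of_real \<rho> * (of_real (f \<rho>))\<^sup>2) < X"
      using bnd(2)[of \<rho> \<rho>] \<rho> norm_of_real[of "\<rho> * (f \<rho>)\<^sup>2", where 'a = complex]
      by (simp add: norm_mult norm_power)
    show Ec0: "Ec (of_real \<rho>) (of_real (f \<rho>)) = 0" using Ec[of \<rho> \<rho>] E\<rho> \<rho> by simp
    show "D \<noteq> 0" if D: "(Ec (of_real \<rho>) has_field_derivative D) (at (of_real (f \<rho>)))" for D
    proof (rule derivative_nonzeroI[OF D Ec0])
      \<comment> \<open>The slope is the loss \<open>2 (\<rho> - x)\<close> over the Lipschitz bound
        \<open>M (\<rho> - x)\<close>; adding 1 to \<open>M\<close> avoids a division by 0.\<close>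
      show "0 < 2 / (M + 1)" using M0 by simp
      fix e :: real assume e: "0 < e"
      obtain d where d: "0 < d" "\<And>x. 0 \<le> x \<Longrightarrow> x \<le> \<rho> \<Longrightarrow> \<rho> - d < x \<Longrightarrow> \<bar>f x - f \<rho>\<bar> < e"
        by (rule continuous_on_near_end[OF fc _ e]) (rule less_imp_le[OF \<rho>(1)], rule that)
      define x where "x = max x0 (\<rho> - d / 2)"
      have x: "x0 \<le> x" "x < \<rho>" "\<rho> - d < x" using d(1) x0 by (auto simp: x_def)
      have x': "0 \<le> x" "x \<le> \<rho>" using x x0 by auto
      have neg: "E \<rho> (f x) \<le> - 2 * (\<rho> - x)" by (rule E_le[OF x(1,2)])
      have "f x \<noteq> f \<rho>" using neg E\<rho> x by auto
      moreover have "\<bar>f x - f \<rho>\<bar> < e" using d(2) x x' by simp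
      moreover have "2 / (M + 1) * \<bar>f x - f \<rho>\<bar> \<le> \<bar>E \<rho> (f x)\<bar>"
      proof -
        have "\<bar>f x - f \<rho>\<bar> = f \<rho> - f x" using fm[of x \<rho>] x' by simp
        also have "\<dots> \<le> M * (\<rho> - x)" by (rule fM[OF x'])
        also have "\<dots> \<le> (M + 1) * (\<rho> - x)" using x by (intro mult_right_mono) auto
        finally have "2 / (M + 1) * \<bar>f x - f \<rho>\<bar> \<le> 2 / (M + 1) * ((M + 1) * (\<rho> - x))"
          using M0 by (intro mult_left_mono) auto
        also have "\<dots> = 2 * (\<rho> - x)" using M0 by simp
        also have "\<dots> \<le> \<bar>E \<rho> (f x)\<bar>" using neg by simp
        finally show ?thesis .
      qed
      ultimately have "complex_of_real (f x) \<noteq> of_real (f \<rho>) \<and> norm (complex_of_real (f x) - of_real (f \<rho>)) < e \<and>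
          2 / (M + 1) * norm (complex_of_real (f x) - of_real (f \<rho>)) \<le> norm (Ec (of_real \<rho>) (of_real (f x)))"
        unfolding Ec[OF x' less_imp_le[OF \<rho>(1)] order_refl] of_real_diff[symmetric] norm_of_real by simp
      then show "\<exists>w. w \<noteq> complex_of_real (f \<rho>) \<and> norm (w - of_real (f \<rho>)) < e \<and>
          2 / (M + 1) * norm (w - of_real (f \<rho>)) \<le> norm (Ec (of_real \<rho>) w)" by blast
    qed
    fix \<epsilon> \<delta> g assume *: "0 < \<epsilon>" "0 < \<delta>" "g holomorphic_on ball (of_real \<rho>) \<epsilon>"
      "\<And>z w. z \<in> ball (of_real \<rho>) \<epsilon> \<Longrightarrow> w \<in> ball (of_real (f \<rho>)) \<delta> \<Longrightarrow> Ec z w = 0 \<Longrightarrow> w = g z"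
    show thesis by (rule that[of \<epsilon> \<delta> g]) (fact *)+
  next
    show "complex_of_real (f \<rho>) \<noteq> 0" using f1[of \<rho>] \<rho> by simp
  qed (use conv in \<open>auto simp: Ec_def intro!: holomorphic_intros\<close>)
  obtain d where d: "0 < d" "\<And>x. 0 \<le> x \<Longrightarrow> x \<le> \<rho> \<Longrightarrow> \<rho> - d < x \<Longrightarrow> \<bar>f x - f \<rho>\<bar> < \<delta>"
    by (rule continuous_on_near_end[OF fc _ g(2)]) (rule less_imp_le[OF \<rho>(1)], rule that)
  have "\<exists>t>\<rho>. summable (\<lambda>n. a n * t ^ n)"
  proof (rule pringsheim[OF a \<rho>(1)])
    show "summable (\<lambda>n. a n * t ^ n)" if "0 \<le> t" "t < \<rho>" for t
      using conv_P[OF that(1) lt[OF that(2)]] by (simp add: conv2_def a_def)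
    show "g holomorphic_on ball (of_real \<rho>) (min \<epsilon> d)" using g(3) by (rule holomorphic_on_subset) auto
    show "0 < min \<epsilon> d" using g(1) d(1) by simp
    show "g (of_real t) = of_real (\<Sum>n. a n * t ^ n)" if t: "0 < t" "\<rho> - min \<epsilon> d < t" "t < \<rho>" for t
    proof -
      have "complex_of_real (f t) = g (of_real t)"
      proof (rule g(4))
        show "of_real t \<in> ball (complex_of_real \<rho>) \<epsilon>" using t by (simp add: dist_of_real dist_real_def)
        show "of_real (f t) \<in> ball (complex_of_real (f \<rho>)) \<delta>"
          using d(2)[of t] t by (simp add: dist_of_real dist_real_def abs_minus_commute)
        show "Ec (of_real t) (of_real (f t)) = 0" using Ec[of t t] E_below[of t] t by simp
      qed
      then show ?thesis by (simp add: f_def val2_def a_def)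
    qed
  qed
  then obtain t where t: "\<rho> < t" "conv2 P b t" by (auto simp: conv2_def a_def)
  then show False using rho_ge[of b t] \<rho> by simp
qed

end

section \<open>No contact with the radius of convergence before \<open>tc\<close>\<close>

context parallel_stacks
begin

lemma below_bad:
  assumes ts: "0 < ts" "ts \<le> tc" and gd: "\<And>s. 0 \<le> s \<Longrightarrow> s < ts \<Longrightarrow> good s" and t: "0 \<le> t" "t < ts"
  shows "val2 P (1 - y t) (u t) = 2 * S t - 1" "y t \<le> 1/3"
proof -
  show "val2 P (1 - y t) (u t) = 2 * S t - 1"
    \<comment> \<open>The continuation needs a segment of positive length, also when
      \<open>t = 0\<close>.\<close>
    by (rule q_identity[of "max t (ts / 2)"]) (use ts t gd in auto)
  show "y t \<le> 1/3" by (rule y_le_third) (use ts t gd in auto)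
qed

text \<open>If \<open>Q\<close> left the strip below \<open>qb\<close>, then convexity in \<open>q\<close> of the right hand side of the kernel equation
  would force a gain of order \<open>\<eta>\<^sup>2\<close>, which is more than \<open>u\<close> can vary on the way to \<open>Y\<close>.\<close>

lemma val_P_bounded:
  assumes t: "0 < t" "t < tc" and val: "val2 P (1 - y t) (u t) = 2 * S t - 1"
    and \<rho>: "rho (1 - y t) = ereal \<rho>" "u t < \<rho>" "\<rho> \<le> Y"
    and conv: "conv2 kappa V X" and \<eta>: "0 < \<eta>" "qb = 2 * S t - 1 + \<eta>" "qb \<le> qm"
    and V: "y t < V" "1 - (1 + y t) / qb < V" and X: "Y * qm\<^sup>2 < X"
    and small: "4 * ((Y - u t) * qm\<^sup>2 * val2 kappa V X) < u t * \<eta>\<^sup>2 * (X - Y * qm\<^sup>2)"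
    and x: "0 \<le> x" "x < \<rho>"
  shows "val2 P (1 - y t) x \<le> qb"
proof (rule ccontr)
  assume not_le: "\<not> ?thesis"
  define b where "b = 1 - y t"
  define c where "c = 1 + y t"
  define q1 where "q1 = 2 * S t - 1"
  define q2 where "q2 = q1 + \<eta> / 2"
  define f where "f z = val2 P b z" for z
  define k where "k z q = val2 kappa (1 - c / q) (z * q\<^sup>2)" for z q
  have yb: "0 \<le> y t" "y t < 1" using y_bounds t by auto
  have b: "0 < b" "b \<le> 1" "2 - b = c" using yb by (auto simp: b_def c_def)
  have q1: "1 \<le> q1" using q_bounds t by (simp add: q1_def)
  have "c / q1 = 1 - y t" using one_plus_y[of t] t by (simp add: c_def q1_def)
  then have "c \<le> q1" using q1 yb by (simp add: divide_eq_eq mult_left_le_one_le)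
  then have c: "0 < c" "c \<le> q1" using yb by (auto simp: c_def)
  have qs: "q1 < q2" "q2 < qb" "q2 = (q1 + qb) / 2" "qb - q1 = \<eta>" using \<eta> by (auto simp: q2_def q1_def)
  have u0: "0 < u t" using u_pos t by simp
  have fu: "f (u t) = q1" using val by (simp add: f_def b_def q1_def)
  have fx: "qb < f x" using not_le by (simp add: f_def b_def)
  have lt: "ereal z < rho b" if "z < \<rho>" for z using that \<rho> by (simp add: b_def)
  have mono: "f z \<le> f z'" if "0 \<le> z" "z \<le> z'" "z' < \<rho>" for z z'
    unfolding f_def using that b conv_P[OF _ lt[of z']] by (intro val_P_mono_x) auto
  have ux: "u t < x"
  proof (rule ccontr)
    assume "\<not> u t < x"
    then have "f x \<le> f (u t)" using mono[of x "u t"] x \<rho> by simp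
    then show False using fx fu qs by simp
  qed
  have convx: "conv2 P b x" by (rule conv_P[OF x(1) lt[OF x(2)]])
  have fc: "continuous_on {0..x} f" unfolding f_def
    by (rule val2_continuous_on[OF P_nonneg convx]) (use b in \<open>auto intro!: continuous_intros\<close>)
  \<comment> \<open>If \<open>Q\<close> exceeds \<open>qb\<close> before \<open>\<rho>\<close>, it
    takes the value \<open>qb\<close> at some \<open>x3\<close> and the midpoint value
    \<open>q2\<close> at some earlier \<open>x2\<close>; up to \<open>x3\<close> the kernel equation
    is still valid.\<close>
  obtain x3 where x3: "u t \<le> x3" "x3 \<le> x" "f x3 = qb"
    using IVT'[of f "u t" qb x] continuous_on_subset[OF fc, of "{u t..x}"] fu fx qs ux u0 by auto
  obtain x2 where x2: "u t \<le> x2" "x2 \<le> x3" "f x2 = q2"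
    using IVT'[of f "u t" q2 x3] continuous_on_subset[OF fc, of "{u t..x3}"] fu qs u0 x3 by auto
  have x3\<rho>: "x3 < \<rho>" "x3 \<le> Y" using x3 x \<rho> by auto
  have qm: "0 < qb" "qb\<^sup>2 \<le> qm\<^sup>2" "q2\<^sup>2 \<le> qm\<^sup>2" using q1 qs \<eta> by (auto intro: power_mono)
  have X3: "x3 * qb\<^sup>2 < X"
  proof -
    have "x3 * qb\<^sup>2 \<le> Y * qm\<^sup>2" using x3\<rho> x3 u0 qm by (intro mult_mono) auto
    then show ?thesis using X by simp
  qed
  have V3: "1 - c / qb < V" using V by (simp add: c_def)
  have K: "f z - 1 = 2 * k z (f z)" if "0 \<le> z" "z \<le> x3" for z
    unfolding f_def k_def b(3)[symmetric]
  proof (rule K_equation[OF b(1,2) _ lt[OF x3\<rho>(1)] conv])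
    show "val2 P b z' \<le> qb" if "0 \<le> z'" "z' \<le> x3" for z'
      using mono[OF that x3\<rho>(1)] x3 by (simp add: f_def)
  qed (use V V3 X3 that x3 u0 in \<open>auto simp: b_def c_def\<close>)
  have conv3: "conv2 kappa (1 - c / qb) (z * qb\<^sup>2)" if "0 \<le> z" "z \<le> x3" for z
  proof (rule conv2_mono[OF nonneg_kappa conv])
    have "z * qb\<^sup>2 \<le> x3 * qb\<^sup>2" using that by (intro mult_right_mono) auto
    then show "z * qb\<^sup>2 \<le> X" using X3 by simp
  qed (use that c qs qm V3 in auto)
  have mid: "k (u t) q2 \<le> (k (u t) q1 + k (u t) qb) / 2 - u t * (\<eta> / 2)\<^sup>2"
    unfolding k_def qs(4)[symmetric]
    by (rule kappa_midpoint) (use c qs u0 conv3[of "u t"] x3 in auto)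
  have k3: "k (u t) qb \<le> k x3 qb" unfolding k_def
    by (rule val2_mono[OF nonneg_kappa conv3[of x3]])
       (use x3 u0 c qs qm in \<open>auto intro: mult_right_mono\<close>)
  \<comment> \<open>The kernel equation holds at \<open>(u t, q1)\<close>, \<open>(x2, q2)\<close>
    and \<open>(x3, qb)\<close>, and \<open>q2\<close> is the mean of the outer values. The
    convexity surplus at fixed \<open>u t\<close> must therefore be supplied by moving the first
    variable from \<open>u t\<close> to \<open>x2\<close>.\<close>
  have gain: "u t * \<eta>\<^sup>2 / 4 \<le> k x2 q2 - k (u t) q2"
  proof -
    have "q1 - 1 = 2 * k (u t) q1" "q2 - 1 = 2 * k x2 q2" "qb - 1 = 2 * k x3 qb"
      using K[of "u t"] K[of x2] K[of x3] fu x2 x3 u0 by auto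
    moreover define W where "W = u t * (\<eta> / 2)\<^sup>2"
    ultimately have "W \<le> k x2 q2 - k (u t) q2" using mid[folded W_def] k3 qs(3) by argo
    then show ?thesis by (simp add: W_def power_divide)
  qed
  have V0: "0 \<le> V" "0 \<le> X"
  proof -
    show "0 \<le> V" using V(1) yb by simp
    show "0 \<le> X" by (rule order_trans[OF _ less_imp_le[OF X3]]) (use x3 u0 in simp)
  qed
  have KVX: "0 \<le> val2 kappa V X"
    using val2_ge_term[of kappa V X 0] nonneg_kappa conv V0 by (simp add: kappa_0)
  have x2q: "x2 * q2\<^sup>2 \<le> Y * qm\<^sup>2" "u t * q2\<^sup>2 \<le> Y * qm\<^sup>2"
    using x2 x3\<rho> u0 qm by (auto intro!: mult_mono)
  have q2v: "0 \<le> 1 - c / q2" "1 - c / q2 \<le> V"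
  proof -
    show "0 \<le> 1 - c / q2" using c qs q1 by simp
    have "c / qb \<le> c / q2" using c qs q1 by (intro divide_left_mono) auto
    then show "1 - c / q2 \<le> V" using V3 by simp
  qed
  \<comment> \<open>Conversely, this move can supply only an amount proportional to
    \<open>x2 - u t\<close>, hence to \<open>Y - u t\<close>, which \<open>small\<close> makes
    insufficient.\<close>
  have loss: "(X - u t * q2\<^sup>2) * (k x2 q2 - k (u t) q2) \<le> (x2 * q2\<^sup>2 - u t * q2\<^sup>2) * val2 kappa V X"
    unfolding k_def
    by (rule val2_kappa_diff_le[OF conv q2v]) (use x2 u0 x2q X in \<open>auto intro: mult_right_mono\<close>)
  have "(X - Y * qm\<^sup>2) * (u t * \<eta>\<^sup>2 / 4) \<le> (X - u t * q2\<^sup>2) * (k x2 q2 - k (u t) q2)"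
    using gain X x2q u0 by (intro mult_mono) auto
  also note loss
  also have "(x2 * q2\<^sup>2 - u t * q2\<^sup>2) * val2 kappa V X \<le> ((Y - u t) * qm\<^sup>2) * val2 kappa V X"
  proof (rule mult_right_mono[OF _ KVX])
    have "(x2 - u t) * q2\<^sup>2 \<le> (Y - u t) * qm\<^sup>2" using x2 x3\<rho> qm by (intro mult_mono) auto
    then show "x2 * q2\<^sup>2 - u t * q2\<^sup>2 \<le> (Y - u t) * qm\<^sup>2" by (simp add: algebra_simps)
  qed
  finally have "(X - Y * qm\<^sup>2) * (u t * \<eta>\<^sup>2 / 4) \<le> (Y - u t) * qm\<^sup>2 * val2 kappa V X" .
  moreover have "(X - Y * qm\<^sup>2) * (u t * \<eta>\<^sup>2 / 4) = (u t * \<eta>\<^sup>2 * (X - Y * qm\<^sup>2)) / 4" by (simp add: mult_ac)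
  ultimately show False using small by linarith
qed

text \<open>The infimum \<open>ts\<close> of the bad times is itself bad by
  \<open>good_persists\<close>. A box of the kernel around the point of the curve at
  \<open>ts\<close> then serves for all nearby earlier times, one of which leads to
  \<open>singular_contradiction\<close>.\<close>

lemma all_good:
  assumes deriv: "\<And>a. -1/3 \<le> a \<Longrightarrow> a \<le> 0 \<Longrightarrow> Q_deriv_u a (rho_Q a) < \<infinity>"
    and t0: "0 \<le> t0" "t0 < tc"
  shows "good t0"
proof (rule ccontr)
  assume bad0: "\<not> good t0"
  define B where "B = {t. 0 \<le> t \<and> t < tc \<and> \<not> good t}"
  define ts where "ts = Inf B"
  have B: "t0 \<in> B" using t0 bad0 by (simp add: B_def)
  have bdd: "bdd_below B" by (rule bdd_belowI[of _ 0]) (simp add: B_def)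
  have ts: "0 \<le> ts" "ts < tc"
  proof -
    show "0 \<le> ts" unfolding ts_def by (rule cInf_greatest) (use B in \<open>auto simp: B_def\<close>)
    show "ts < tc" using cInf_lower[OF B bdd] t0 by (simp add: ts_def)
  qed
  have below: "good t" if "0 \<le> t" "t < ts" for t
  proof (rule ccontr)
    assume "\<not> good t"
    then have "t \<in> B" using that ts by (simp add: B_def)
    then show False using cInf_lower[OF _ bdd, of t] that by (simp add: ts_def)
  qed
  have bad: "\<not> good ts"
  proof
    assume "good ts"
    then obtain e where e: "0 < e" "\<And>t'. ts \<le> t' \<Longrightarrow> t' < ts + e \<Longrightarrow> t' < tc \<Longrightarrow> good t'"
      using good_persists[OF ts] by blast
    have "Inf B < ts + e" using e(1) by (simp add: ts_def)
    then obtain t where t: "t \<in> B" "t < ts + e" using cInf_lessD[of B "ts + e"] B by blast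
    then show False using e(2)[of t] cInf_lower[OF t(1) bdd] by (auto simp: B_def ts_def)
  qed
  have "good 0" using rho_pos[of 1] by (simp add: good_def u_def y_0 zero_ereal_def[symmetric])
  then have ts0: "0 < ts" using bad ts by (cases "ts = 0") auto
  define Y where "Y = u ts"
  define qs where "qs = 2 * S ts - 1"
  have Y: "0 < Y" using u_pos[OF ts0 ts(2)] by (simp add: Y_def)
  \<comment> \<open>By antitonicity of \<open>rho\<close> this upper bound also holds at all earlier
    times, so just before \<open>ts\<close> the radius is squeezed between \<open>u t\<close> and
    \<open>Y\<close>.\<close>
  have rhoY: "rho (1 - y ts) \<le> ereal Y" using bad by (simp add: good_def Y_def)
  obtain V X where VX: "conv2 kappa V X" "y ts < V" "ts * (S ts)\<^sup>2 < X" using K_box[OF ts] .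
  have uq: "Y * qs\<^sup>2 < X" using VX(3) u_q[OF ts] by (simp add: Y_def qs_def)
  \<comment> \<open>Room above the value of \<open>Q\<close>, small enough that both kernel
    arguments stay in the box even at \<open>ts\<close>.\<close>
  obtain \<eta> where \<eta>: "0 < \<eta>" "\<eta> < V - y ts" "Y * (qs + \<eta>)\<^sup>2 < X"
  proof -
    have "((\<lambda>\<eta>. Y * (qs + \<eta>)\<^sup>2) \<longlongrightarrow> Y * (qs + 0)\<^sup>2) (at_right 0)" by (intro tendsto_intros)
    then have "eventually (\<lambda>\<eta>. Y * (qs + \<eta>)\<^sup>2 < X) (at_right 0)"
      using uq by (intro order_tendstoD(2)) auto
    moreover have "eventually (\<lambda>\<eta>. \<eta> \<in> {0<..<V - y ts}) (at_right 0)"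
      using VX(2) by (intro eventually_at_rightI[of 0 "V - y ts"]) auto
    ultimately have "eventually (\<lambda>\<eta>. Y * (qs + \<eta>)\<^sup>2 < X \<and> \<eta> \<in> {0<..<V - y ts}) (at_right 0)"
      by (rule eventually_conj)
    then obtain \<eta> where "Y * (qs + \<eta>)\<^sup>2 < X \<and> \<eta> \<in> {0<..<V - y ts}"
      using eventually_happens'[OF trivial_limit_at_right_real] by blast
    then show thesis by (intro that[of \<eta>]) auto
  qed
  define qm where "qm = qs + \<eta>"
  define A where "A = \<eta>\<^sup>2 * (X - Y * qm\<^sup>2)"
  define C where "C = 4 * (qm\<^sup>2 * val2 kappa V X)"
  have V0: "0 \<le> V" "0 \<le> X"
  proof -
    show "0 \<le> V" using VX(2) y_bounds[OF ts] by simp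
    show "0 \<le> X" by (rule order_trans[OF _ less_imp_le[OF VX(3)]]) (use ts in simp)
  qed
  have C: "0 \<le> C" unfolding C_def
    using val2_ge_term[of kappa V X 0] nonneg_kappa VX(1) V0 by (simp add: kappa_0)
  have A: "0 < A" using \<eta> by (simp add: A_def qm_def)
  \<comment> \<open>Solves the smallness condition: \<open>(Y - u t) * (A + C) < Y * A\<close> is
    equivalent to \<open>(Y - u t) * C < u t * A\<close>, which is the hypothesis
    \<open>small\<close> of \<open>val_P_bounded\<close>.\<close>
  define e where "e = Y * A / (A + C)"
  have e: "0 < e" using Y A C by (simp add: e_def)
  have uc: "continuous_on {0..ts} u" by (rule continuous_on_subset[OF u_continuous]) (use ts in auto)
  obtain d where d: "0 < d" "\<And>t. 0 \<le> t \<Longrightarrow> t \<le> ts \<Longrightarrow> ts - d < t \<Longrightarrow> \<bar>u t - u ts\<bar> < e"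
    by (rule continuous_on_near_end[OF uc ts(1) e]) (rule that)
  define t where "t = max (ts / 2) (ts - d / 2)"
  have t: "0 < t" "t < ts" "ts - d < t" "t < tc" "0 \<le> t" using ts0 d(1) ts by (auto simp: t_def)
  have ut: "0 < u t" "Y - u t < e" using u_pos[of t] d(2)[of t] t by (auto simp: Y_def)
  have val: "val2 P (1 - y t) (u t) = 2 * S t - 1" and third: "y t \<le> 1/3"
    using below_bad[OF ts0 less_imp_le[OF ts(2)] below t(5,2)] by auto
  have yb: "0 \<le> y t" "y t < 1" "y t \<le> y ts" using y_bounds[of t] y_mono[of t ts] t ts by auto
  have "rho (1 - y t) \<le> rho (1 - y ts)" using yb y_bounds[OF ts] by (intro rho_antimono) auto
  then have le: "rho (1 - y t) \<le> ereal Y" using rhoY by (rule order_trans)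
  have gt: "ereal (u t) < rho (1 - y t)" using below[OF t(5,2)] by (simp add: good_def)
  obtain \<rho> where \<rho>: "rho (1 - y t) = ereal \<rho>" "u t < \<rho>" "\<rho> \<le> Y"
    using le gt by (cases "rho (1 - y t)") auto
  define qb where "qb = 2 * S t - 1 + \<eta>"
  have q1: "1 \<le> 2 * S t - 1" using q_bounds t by simp
  have qbm: "qb \<le> qm" using S_mono[OF t(5,2) ts(2)] by (simp add: qb_def qm_def qs_def)
  have "(1 + y t) / (2 * S t - 1) = 1 - y t" using one_plus_y t by simp
  then have "1 + y t = (1 - y t) * (2 * S t - 1)" using q1 by (simp add: divide_eq_eq)
  \<comment> \<open>Raising \<open>Q\<close> by \<open>\<eta>\<close> raises the first kernel
    argument by at most \<open>\<eta>\<close>, so it stays below \<open>V\<close>.\<close>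
  then have "(1 - y t - \<eta>) * qb = 1 + y t - \<eta> * (qb - 1 + y t)" by (simp add: qb_def algebra_simps)
  moreover have "0 \<le> \<eta> * (qb - 1 + y t)" using \<eta>(1) q1 yb by (intro mult_nonneg_nonneg) (auto simp: qb_def)
  ultimately have "1 - y t - \<eta> \<le> (1 + y t) / qb" using q1 \<eta>(1) by (simp add: pos_le_divide_eq qb_def)
  then have Vb: "1 - (1 + y t) / qb < V" using \<eta>(2) yb by simp
  have small: "4 * ((Y - u t) * qm\<^sup>2 * val2 kappa V X) < u t * \<eta>\<^sup>2 * (X - Y * qm\<^sup>2)"
  proof -
    have "(Y - u t) * (A + C) < e * (A + C)" using ut A C by (intro mult_strict_right_mono) auto
    also have "\<dots> = Y * A" using A C by (simp add: e_def)
    finally have "(Y - u t) * C < u t * A" by (simp add: algebra_simps)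
    then show ?thesis by (simp add: A_def C_def mult_ac)
  qed
  have bound: "val2 P (1 - y t) x \<le> qb" if "0 \<le> x" "x < \<rho>" for x
    by (rule val_P_bounded[OF t(1,4) val \<rho> VX(1) \<eta>(1) qb_def qbm _ Vb _ small that])
       (use VX \<eta> yb in \<open>auto simp: qm_def\<close>)
  show False
  proof (rule singular_contradiction[of "1 - y t" \<rho> V X qb "u t"])
    show "rho (1 - y t) = ereal \<rho>" by (rule \<rho>(1))
    have "\<rho> * qb\<^sup>2 \<le> Y * qm\<^sup>2"
      using \<rho> ut qbm q1 \<eta>(1) by (intro mult_mono power_mono) (auto simp: qb_def)
    then show "\<rho> * qb\<^sup>2 < X" using \<eta>(3) by (simp add: qm_def)
    show "2 - (1 - y t) \<le> val2 P (1 - y t) (u t)"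
    proof -
      have "1 + y t = (1 - y t) * (2 * S t - 1)" by fact
      also have "\<dots> \<le> 1 * (2 * S t - 1)" using yb q1 by (intro mult_right_mono) auto
      finally show ?thesis by (simp add: val)
    qed
    have "rho_Q (- y t) = ereal \<rho>" using \<rho>(1) by (simp add: rho_Q_eq)
    then show "Q_deriv_u (1 - y t - 1) (ereal \<rho>) < \<infinity>" using deriv[of "- y t"] third yb by simp
    show "1 - (2 - (1 - y t)) / qb < V" using Vb by simp
  qed (use yb \<rho> ut VX bound in auto)
qed

end

section \<open>The endpoint of the curve\<close>

context parallel_stacks
begin

context
  assumes gd: "\<And>t. 0 \<le> t \<Longrightarrow> t < tc \<Longrightarrow> good t"
begin

lemma q_eq: "0 \<le> t \<Longrightarrow> t < tc \<Longrightarrow> val2 P (1 - y t) (u t) = 2 * S t - 1"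
  and y_third: "0 \<le> t \<Longrightarrow> t < tc \<Longrightarrow> y t \<le> 1/3"
  using below_bad[OF tc_pos order_refl gd] by auto

text \<open>The bound 1/3 is uniform in \<open>t < tc\<close>, so the series still converges at the
  end point, where \<open>y\<close> takes part in all that follows.\<close>

lemma y_tc: "summable (\<lambda>n. s_prim_coeff n * tc ^ n)" "y tc \<le> 1/3"
proof -
  have "summable (\<lambda>n. s_prim_coeff n * t ^ n) \<and> (\<Sum>n. s_prim_coeff n * t ^ n) \<le> 1/3" if "0 < t" "t < tc" for t
    using summable_sp[of t] y_third[of t] that by (simp add: S_prim_def)
  note * = summable_at_boundary[OF s_prim_coeff_nonneg tc_pos this]
  show "summable (\<lambda>n. s_prim_coeff n * tc ^ n)" by (rule *(1))
  show "y tc \<le> 1/3" using *(2) by (simp add: S_prim_def)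
qed

lemma conv_sp_tc: "conv2 (\<lambda>n. [:s_prim_coeff n:]) 0 tc"
  using y_tc(1) by (simp add: conv2_def)

lemma y_mono_tc: "0 \<le> t \<Longrightarrow> t \<le> tc \<Longrightarrow> y t \<le> y tc"
  using val2_mono[OF nonneg_sp conv_sp_tc, of 0 t] by (simp add: val_sp)

lemma y_tc_nonneg: "0 \<le> y tc"
  using y_mono_tc[of 0] tc_pos by (simp add: y_0)

lemma y_nonneg_tc: "0 \<le> t \<Longrightarrow> t \<le> tc \<Longrightarrow> 0 \<le> y t"
  using y_bounds[of t] y_tc_nonneg by (cases "t = tc") auto

lemma y_continuous_tc: "continuous_on {0..tc} y"
proof -
  have "continuous_on {0..tc} (\<lambda>t. val2 (\<lambda>n. [:s_prim_coeff n:]) 0 t)"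
    by (rule val2_continuous_on[OF nonneg_sp conv_sp_tc]) (auto intro!: continuous_intros)
  then show ?thesis by (simp add: val_sp)
qed

lemma u_continuous_tc: "continuous_on {0..tc} u"
  unfolding u_def by (intro continuous_intros y_continuous_tc) (use y_nonneg_tc in force)

lemma near_tc:
  assumes "continuous_on {0..tc} f" "0 < (e :: real)"
  obtains t where "0 < t" "t < tc" "\<And>s. t \<le> s \<Longrightarrow> s \<le> tc \<Longrightarrow> \<bar>f s - f tc\<bar> < e"
proof -
  obtain d where d: "0 < d" "\<And>t. 0 \<le> t \<Longrightarrow> t \<le> tc \<Longrightarrow> tc - d < t \<Longrightarrow> \<bar>f t - f tc\<bar> < e"
    by (rule continuous_on_near_end[OF assms(1) less_imp_le[OF tc_pos] assms(2)]) (rule that)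
  show thesis
    by (rule that[of "max (tc / 2) (tc - d / 2)"]) (use tc_pos d in auto)
qed

text \<open>For \<open>t < tc\<close> antitonicity gives
  \<open>u t < rho (1 - y t) \<le> rho (1 - y tc)\<close>; the right side does not depend on
  \<open>t\<close>, so continuity of \<open>u\<close> suffices.\<close>

lemma u_tc_le: "ereal (u tc) \<le> rho (1 - y tc)"
proof (rule ccontr)
  assume "\<not> ?thesis"
  then have "rho (1 - y tc) < ereal (u tc)" by simp
  then obtain r where r: "rho (1 - y tc) < ereal r" "ereal r < ereal (u tc)" using ereal_dense2 by blast
  then have r': "0 < u tc - r" by simp
  obtain t where t: "0 < t" "t < tc" "\<And>s. t \<le> s \<Longrightarrow> s \<le> tc \<Longrightarrow> \<bar>u s - u tc\<bar> < u tc - r"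
    by (rule near_tc[OF u_continuous_tc r']) (rule that)
  have "r < u t" using t(3)[of t] t(1,2) by simp
  moreover have "ereal (u t) < rho (1 - y t)" using gd[of t] t by (simp add: good_def)
  moreover have "rho (1 - y t) \<le> rho (1 - y tc)"
    using y_mono_tc[of t] y_tc(2) t by (intro rho_antimono) auto
  ultimately have "ereal (u t) < ereal r" using r(1) by (meson less_le_trans order_less_trans)
  then show False using \<open>r < u t\<close> by simp
qed

text \<open>If \<open>u\<close> failed to increase, both arguments of \<open>Q\<close> would weakly
  decrease along the curve, yet its value \<open>2 * S t - 1\<close> strictly increases.\<close>

lemma u_strict: "0 \<le> t \<Longrightarrow> t < t' \<Longrightarrow> t' < tc \<Longrightarrow> u t < u t'"
proof (rule ccontr)
  assume t: "0 \<le> t" "t < t'" "t' < tc" and "\<not> u t < u t'"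
  then have le: "u t' \<le> u t" by simp
  have c: "conv2 P (1 - y t) (u t)"
    using gd[of t] t u_bounds[of t] by (intro conv_P) (auto simp: good_def)
  have "val2 P (1 - y t') (u t') \<le> val2 P (1 - y t) (u t)"
    using y_mono[of t t'] y_bounds[of t'] u_bounds[of t'] t le by (intro val2_mono[OF P_nonneg c]) auto
  then show False using q_eq[of t] q_eq[of t'] S_mono[of t t'] t by simp
qed

lemma u_strict_mono: "strict_mono_on {0..tc} u"
proof (rule strict_mono_onI)
  fix t t' assume t: "t \<in> {0..tc}" "t' \<in> {0..tc}" "t < t'"
  show "u t < u t'"
  proof (cases "t' = tc")
    case True
    define m where "m = (t + tc) / 2"
    have m: "t < m" "m < tc" using t True by (auto simp: m_def)
    have "u m \<le> u tc"
    proof (rule ccontr)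
      assume "\<not> u m \<le> u tc"
      then have e: "0 < u m - u tc" by simp
      obtain s where s: "0 < s" "s < tc" "\<And>s'. s \<le> s' \<Longrightarrow> s' \<le> tc \<Longrightarrow> \<bar>u s' - u tc\<bar> < u m - u tc"
        by (rule near_tc[OF u_continuous_tc e]) (rule that)
      define s' where "s' = (max s m + tc) / 2"
      have s': "s \<le> s'" "m < s'" "s' < tc" using s m by (auto simp: s'_def)
      then have "u s' < u m" using s(3)[of s'] by simp
      then show False using u_strict[of m s'] s' m t by simp
    qed
    then show ?thesis using u_strict[of t m] t m True by simp
  qed (use t u_strict in auto)
qed

text \<open>With room beyond \<open>u tc\<close>, the identity for \<open>Q\<close> on the curve,
  multiplied by \<open>1 - y\<close>, is an equation in \<open>t\<close> and \<open>w = y\<close>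
  that is holomorphic around the end point. Its left side decreases in \<open>w\<close> and its
  right side increases, so it is solvable for \<open>w\<close>.\<close>

lemma u_tc_eq: "ereal (u tc) = rho (1 - y tc)"
proof (rule ccontr)
  assume "\<not> ?thesis"
  then have lt: "ereal (u tc) < rho (1 - y tc)" using u_tc_le by simp
  have yb: "0 \<le> y tc" "y tc \<le> 1/3" using y_tc_nonneg y_tc(2) by auto
  have u0: "0 \<le> u tc" using tc_pos by (simp add: u_def)
  obtain b' x' where bx: "1 - y tc < b'" "u tc < x'" "conv2 P b' x'"
    using conv_P_expand[of "1 - y tc" "u tc"] lt yb u0 by auto
  \<comment> \<open>The point -1 is a pole of the second argument; 1 is removed so that
    \<open>1 / (1 - g z)\<close> will be holomorphic.\<close>
  define N0 :: "(complex \<times> complex) set" where "N0 = UNIV \<times> (UNIV - {-1, 1})"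
  have N0: "open N0" unfolding N0_def by (intro open_Times open_Diff open_UNIV finite_imp_closed) simp
  have h\<alpha>: "holomorphic2_on (\<lambda>z w. 1 - w) N0" by (intro holomorphic2_diff holomorphic2_const holomorphic2_snd)
  have h\<beta>: "holomorphic2_on (\<lambda>z w. z / ((1 + w) * (1 + w))) N0"
    by (intro holomorphic2_divide holomorphic2_mult holomorphic2_add holomorphic2_const holomorphic2_fst holomorphic2_snd)
       (auto simp: N0_def add_eq_0_iff)
  define N where "N = {(z, w) \<in> N0. norm (1 - w) < b'} \<inter> {(z, w) \<in> N0. norm (z / ((1 + w) * (1 + w))) < x'}"
  have N: "open N" unfolding N_def by (intro open_Int open_holomorphic2_less[OF N0] h\<alpha> h\<beta>)
  have sub: "N \<subseteq> N0" by (auto simp: N_def)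
  define E where "E = (\<lambda>z w. (1 - w) * series2 P (1 - w) (z / ((1 + w) * (1 + w))) - (1 + w))"
  have hE: "holomorphic2_on E N" unfolding E_def
  proof (intro holomorphic2_diff holomorphic2_mult holomorphic2_add holomorphic2_const holomorphic2_snd)
    show "holomorphic2_on (\<lambda>z w. series2 P (1 - w) (z / ((1 + w) * (1 + w)))) N"
      by (rule holomorphic2_series2[OF P_nonneg bx(3)[unfolded conv2_def]
            holomorphic2_subset[OF h\<alpha> sub] holomorphic2_subset[OF h\<beta> sub]]) (auto simp: N_def)
  qed
  have E_real: "E (of_real t) (of_real w) = of_real ((1 - w) * val2 P (1 - w) (t / (1 + w)\<^sup>2) - (1 + w))"
    if "\<bar>1 - w\<bar> \<le> b'" "\<bar>t / (1 + w)\<^sup>2\<bar> \<le> x'" for t w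
    using series2_val2[OF P_nonneg bx(3) that] by (simp add: E_def power2_eq_square)
  obtain t1 where t1: "0 < t1" "t1 < tc" "\<And>s. t1 \<le> s \<Longrightarrow> s \<le> tc \<Longrightarrow> \<bar>y s - y tc\<bar> < b' - (1 - y tc)"
    by (rule near_tc[OF y_continuous_tc, of "b' - (1 - y tc)"]) (use bx(1) that in auto)
  obtain t2 where t2: "0 < t2" "t2 < tc" "\<And>s. t2 \<le> s \<Longrightarrow> s \<le> tc \<Longrightarrow> \<bar>u s - u tc\<bar> < x' - u tc"
    by (rule near_tc[OF u_continuous_tc, of "x' - u tc"]) (use bx(2) that in auto)
  define s0 where "s0 = max t1 t2"
  have s0: "0 < s0" "s0 < tc" using t1 t2 by (auto simp: s0_def)
  have box: "\<bar>1 - y s\<bar> \<le> b'" "\<bar>u s\<bar> \<le> x'" if s: "s0 \<le> s" "s \<le> tc" for s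
  proof -
    have "y s \<le> y tc" "0 \<le> u s" using y_mono_tc[of s] s s0 by (auto simp: u_def)
    then show "\<bar>1 - y s\<bar> \<le> b'" "\<bar>u s\<bar> \<le> x'"
      using t1(3)[of s] t2(3)[of s] s yb by (auto simp: s0_def)
  qed
  define h where "h s = (1 - y s) * val2 P (1 - y s) (u s) - (1 + y s)" for s
  have h_below: "h s = 0" if "s0 \<le> s" "s < tc" for s
    using q_eq[of s] twice_S[of s] y_bounds[of s] that s0 by (simp add: h_def)
  have h_tc: "h tc = 0"
  proof (rule continuous_constant_on_closure[of "{s0..<tc}" h 0 tc])
    have c: "continuous_on {s0..tc} y" "continuous_on {s0..tc} u"
      using continuous_on_subset[OF y_continuous_tc] continuous_on_subset[OF u_continuous_tc] s0 by auto
    have "continuous_on {s0..tc} (\<lambda>s. val2 P (1 - y s) (u s))"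
      by (rule val2_continuous_on[OF P_nonneg bx(3)]) (use c box in \<open>auto intro!: continuous_intros\<close>)
    then have "continuous_on {s0..tc} h" unfolding h_def by (intro continuous_intros c)
    then show "continuous_on (closure {s0..<tc}) h" using s0 by (simp add: closure_atLeastLessThan)
  qed (use h_below s0 in \<open>auto simp: closure_atLeastLessThan\<close>)
  have E_h: "E (of_real s) (of_real (y s)) = of_real (h s)" if "s0 \<le> s" "s \<le> tc" for s
    using E_real[of "y s" s] box[OF that] by (simp add: h_def u_def)
  have E0: "E (of_real tc) (of_real (y tc)) = 0" using E_h[of tc] h_tc s0 by simp
  have in_N: "(complex_of_real tc, complex_of_real (y tc)) \<in> N"
  proof -
    have "norm (1 - complex_of_real (y tc)) = 1 - y tc"
      using norm_of_real[of "1 - y tc", where 'a = complex] yb by simp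
    moreover have "norm (complex_of_real tc / ((1 + of_real (y tc)) * (1 + of_real (y tc)))) = u tc"
    proof -
      have "norm (complex_of_real (u tc)) = u tc" using u0 by simp
      then show ?thesis by (simp add: u_def power2_eq_square)
    qed
    moreover have "complex_of_real (y tc) \<noteq> 1"
    proof
      assume "complex_of_real (y tc) = 1"
      then have "y tc = 1" by (simp only: of_real_eq_1_iff)
      then show False using yb by simp
    qed
    moreover have "complex_of_real (y tc) \<noteq> - 1"
    proof
      assume "complex_of_real (y tc) = - 1"
      then have "complex_of_real (y tc) = of_real (- 1)" by simp
      then have "y tc = - 1" by (simp only: of_real_eq_iff)
      then show False using yb by simp
    qed
    ultimately show ?thesis using bx by (simp add: N_def N0_def)
  qed
  obtain \<epsilon> \<delta> g where g: "0 < \<epsilon>" "0 < \<delta>" "g holomorphic_on ball (of_real tc) \<epsilon>"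
    "\<And>z w. z \<in> ball (of_real tc) \<epsilon> \<Longrightarrow> w \<in> ball (of_real (y tc)) \<delta> \<Longrightarrow> E z w = 0 \<Longrightarrow> w = g z"
    "\<And>z. z \<in> ball (of_real tc) \<epsilon> \<Longrightarrow> g z \<in> ball (of_real (y tc)) \<delta> \<and> (z, g z) \<in> N"
  proof (rule implicit_function2_D[OF N in_N hE E0])
    show "D \<noteq> 0" if D: "(E (of_real tc) has_field_derivative D) (at (of_real (y tc)))" for D
    proof (rule derivative_nonzeroI[OF D E0 zero_less_one])
      fix e :: real assume e: "0 < e"
      \<comment> \<open>Test points to the right of \<open>y tc\<close>, kept below 1: there
        \<open>b\<close> and \<open>u\<close> both decrease, so \<open>Q\<close> is at most its
        value at the end point and \<open>E\<close> drops with slope at least 1.\<close>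
      define w where "w = y tc + min (e / 2) (1 / 3)"
      have w: "y tc < w" "w - y tc < e" "w < 1" using e yb by (auto simp: w_def)
      define v where "v = val2 P (1 - y tc) (u tc)"
      have c: "conv2 P (1 - y tc) (u tc)"
        by (rule conv2_mono[OF P_nonneg bx(3)]) (use bx yb u0 in auto)
      have v: "1 \<le> v" unfolding v_def using yb u0 c by (intro val_P_ge_1) auto
      have vE: "(1 - y tc) * v = 1 + y tc" using h_tc by (simp add: h_def v_def)
      have le_u: "tc / (1 + w)\<^sup>2 \<le> u tc" "0 \<le> tc / (1 + w)\<^sup>2"
        unfolding u_def using tc_pos w yb by (auto intro!: divide_left_mono power_mono mult_pos_pos)
      define r where "r = (1 - w) * val2 P (1 - w) (tc / (1 + w)\<^sup>2) - (1 + w)"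
      have "val2 P (1 - w) (tc / (1 + w)\<^sup>2) \<le> v"
        unfolding v_def by (rule val2_mono[OF P_nonneg c]) (use w le_u in auto)
      then have "r \<le> (1 - w) * v - (1 + w)" unfolding r_def using w by (intro diff_mono mult_left_mono) auto
      also have "\<dots> = - (w - y tc) * (v + 1)" using vE by (simp add: algebra_simps)
      also have "\<dots> \<le> - (w - y tc)" using w v mult_left_mono[of 1 "v + 1" "w - y tc"] by simp
      finally have "w - y tc \<le> \<bar>r\<bar>" by simp
      moreover have "E (of_real tc) (of_real w) = of_real r"
        unfolding r_def by (rule E_real) (use w yb le_u bx in auto)
      ultimately have "complex_of_real w \<noteq> of_real (y tc) \<and> norm (complex_of_real w - of_real (y tc)) < e \<and>
          1 * norm (complex_of_real w - of_real (y tc)) \<le> norm (E (of_real tc) (of_real w))"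
        unfolding of_real_diff[symmetric] norm_of_real using w by simp
      then show "\<exists>w. w \<noteq> complex_of_real (y tc) \<and> norm (w - of_real (y tc)) < e \<and>
          1 * norm (w - of_real (y tc)) \<le> norm (E (of_real tc) w)" by blast
    qed
    fix \<epsilon> \<delta> g assume *: "0 < \<epsilon>" "0 < \<delta>" "g holomorphic_on ball (of_real tc) \<epsilon>"
      "\<And>z w. z \<in> ball (of_real tc) \<epsilon> \<Longrightarrow> w \<in> ball (of_real (y tc)) \<delta> \<Longrightarrow> E z w = 0 \<Longrightarrow> w = g z"
      "\<And>z. z \<in> ball (of_real tc) \<epsilon> \<Longrightarrow> g z \<in> ball (of_real (y tc)) \<delta> \<and> (z, g z) \<in> N"
    show thesis by (rule that[of \<epsilon> \<delta> g]) (fact *)+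
  qed
  obtain t3 where t3: "0 < t3" "t3 < tc" "\<And>s. t3 \<le> s \<Longrightarrow> s \<le> tc \<Longrightarrow> \<bar>y s - y tc\<bar> < \<delta>"
    by (rule near_tc[OF y_continuous_tc g(2)]) (rule that)
  define \<epsilon>' where "\<epsilon>' = min \<epsilon> (tc - max s0 t3)"
  have "\<exists>t>tc. summable (\<lambda>n. s_coeff n * t ^ n)"
  proof (rule pringsheim[OF s_coeff_nonneg tc_pos])
    show "summable (\<lambda>n. s_coeff n * t ^ n)" if "0 \<le> t" "t < tc" for t using that by (rule summable_s)
    have "(\<lambda>z. 1 / (1 - g z)) holomorphic_on ball (of_real tc) \<epsilon>"
    proof (intro holomorphic_intros g(3))
      fix z :: complex assume "z \<in> ball (of_real tc) \<epsilon>"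
      then have "(z, g z) \<in> N0" using g(5) sub by blast
      then show "1 - g z \<noteq> 0" by (auto simp: N0_def)
    qed
    then show "(\<lambda>z. 1 / (1 - g z)) holomorphic_on ball (of_real tc) \<epsilon>'"
      by (rule holomorphic_on_subset) (auto simp: \<epsilon>'_def)
    show "0 < \<epsilon>'" using g(1) s0 t3 by (simp add: \<epsilon>'_def)
    show "1 / (1 - g (of_real t)) = of_real (\<Sum>n. s_coeff n * t ^ n)" if t: "0 < t" "tc - \<epsilon>' < t" "t < tc" for t
    proof -
      have t': "s0 \<le> t" "t3 \<le> t" "tc - t < \<epsilon>" using t by (auto simp: \<epsilon>'_def)
      have "complex_of_real (y t) = g (of_real t)"
      proof (rule g(4))
        show "of_real t \<in> ball (complex_of_real tc) \<epsilon>" using t t' by (simp add: dist_of_real dist_real_def)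
        show "of_real (y t) \<in> ball (complex_of_real (y tc)) \<delta>"
          using t3(3)[of t] t t' by (simp add: dist_of_real dist_real_def abs_minus_commute)
        show "E (of_real t) (of_real (y t)) = 0" using E_h[of t] h_below[of t] t t' by simp
      qed
      then have "1 / (1 - g (of_real t)) = complex_of_real (1 / (1 - y t))" by simp
      also have "1 / (1 - y t) = S t" using S_y[of t] t by simp
      finally show ?thesis by (simp add: S_def)
    qed
  qed
  then obtain t where t: "tc < t" "summable (\<lambda>n. s_coeff n * t ^ n)" by blast
  have "ereal (norm t) \<le> conv_radius s_coeff" using t(2) by (rule conv_radius_geI)
  then show False using t(1) tc tc_pos by simp
qed

end

end

lemma conv_radius_s_coeff:
  obtains tc where "0 < tc" "conv_radius s_coeff = ereal tc"
proof -
  have "summable (\<lambda>n. s_coeff n * (1 / 17) ^ n)"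
  proof (rule summable_comparison_test'[where N = 0])
    show "summable (\<lambda>n. (16 / 17 :: real) ^ n)" by (rule summable_geometric) simp
    fix n
    have "s_coeff n * (1 / 17) ^ n \<le> 16 ^ n * (1 / 17) ^ n" by (intro mult_right_mono s_coeff_bounds) simp
    also have "\<dots> = (16 / 17 :: real) ^ n" by (simp add: power_mult_distrib[symmetric])
    finally show "norm (s_coeff n * (1 / 17) ^ n) \<le> (16 / 17) ^ n"
      by (simp add: abs_mult s_coeff_nonneg)
  qed
  from conv_radius_geI[OF this] have ge: "ereal (1 / 17) \<le> conv_radius s_coeff" by simp
  have "\<not> summable (\<lambda>n. s_coeff n * 1 ^ n)"
  proof
    assume "summable (\<lambda>n. s_coeff n * 1 ^ n)"
    then have "s_coeff \<longlonglongrightarrow> 0" using summable_LIMSEQ_zero by fastforce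
    then have "1 \<le> (0 :: real)" by (rule LIMSEQ_le_const) (use s_coeff_bounds in auto)
    then show False by simp
  qed
  from conv_radius_leI'[OF this] have le: "conv_radius s_coeff \<le> ereal 1" by simp
  obtain tc where tc: "conv_radius s_coeff = ereal tc" using ge le by (cases "conv_radius s_coeff") auto
  show thesis by (rule that[OF _ tc]) (use ge tc in auto)
qed

lemma degree_Q_coeff: "degree (Q_coeff n) \<le> 2 * n"
  unfolding Q_coeff_eq
proof (rule degree_sum_le)
  show "finite {w. balanced w \<and> length w = 2 * n}" by (rule finite_words)
  fix w assume w: "w \<in> {w. balanced w \<and> length w = 2 * n}"
  have "degree (monom (1 :: real) (mismatches w)) \<le> mismatches w" by (rule degree_monom_le)
  then show "degree (monom (1 :: real) (mismatches w)) \<le> 2 * n" using w mismatches_le_length[of w] by simp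
qed

theorem theorem5p1:
  assumes "Q_succ_positive"
    and "\<forall>a \<in> {-1/3..0}. Q_deriv_u a (rho_Q a) < \<infinity>"
  shows "\<exists>t\<^sub>c :: real. conv_radius s_coeff = ereal t\<^sub>c \<and>
    summable (\<lambda>n. s_prim_coeff n * t\<^sub>c ^ n) \<and>
    strict_mono_on {0..t\<^sub>c} (\<lambda>t. t / (1 + S_prim t)\<^sup>2) \<and>
    (\<forall>t \<in> {0..t\<^sub>c}.
       ereal (t / (1 + S_prim t)\<^sup>2) \<le> rho_Q (- S_prim t) \<and>
       (ereal (t / (1 + S_prim t)\<^sup>2) = rho_Q (- S_prim t) \<longleftrightarrow> t = t\<^sub>c)) \<and>
    S_prim t\<^sub>c \<le> 1/3"
proof -
  obtain P :: "nat \<Rightarrow> real poly" where P: "\<And>n k. coeff (P n) k \<in> \<nat>" "\<And>n. Q_coeff n = pcompose (P n) [:1, 1:]"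
    using assms(1) unfolding Q_succ_positive_def by metis
  obtain tc where tc: "0 < tc" "conv_radius s_coeff = ereal tc" by (rule conv_radius_s_coeff)
  interpret parallel_stacks P tc
  proof
    show "nonneg_coeffs (P n)" for n
      unfolding nonneg_coeffs_def
    proof
      fix k show "0 \<le> coeff (P n) k" using P(1)[of n k] by (elim Nats_cases) simp
    qed
    show "poly (Q_coeff n) a = poly (P n) (1 + a)" for n a by (simp add: P(2) poly_pcompose)
    show "degree (P n) \<le> 2 * n" for n using degree_Q_coeff[of n] by (simp add: P(2) degree_pcompose)
  qed (fact tc)+
  have gd: "good t" if "0 \<le> t" "t < tc" for t
    by (rule all_good[OF _ that]) (use assms(2) in auto)
  have rho: "rho_Q (- S_prim t) = rho (1 - S_prim t)" for t by (simp add: rho_Q_eq)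
  have ineq: "ereal (u t) \<le> rho (1 - S_prim t) \<and> (ereal (u t) = rho (1 - S_prim t) \<longleftrightarrow> t = tc)"
    if "t \<in> {0..tc}" for t
    using gd[of t] u_tc_eq[OF gd] that by (cases "t = tc") (auto simp: good_def)
  show ?thesis
  proof (intro exI[of _ tc] conjI)
    show "strict_mono_on {0..tc} (\<lambda>t. t / (1 + S_prim t)\<^sup>2)"
      using u_strict_mono[OF gd] by (simp only: u_def[abs_def])
    show "\<forall>t\<in>{0..tc}. ereal (t / (1 + S_prim t)\<^sup>2) \<le> rho_Q (- S_prim t) \<and>
       (ereal (t / (1 + S_prim t)\<^sup>2) = rho_Q (- S_prim t) \<longleftrightarrow> t = tc)"
    proof
      fix t assume "t \<in> {0..tc}"
      from ineq[OF this] show "ereal (t / (1 + S_prim t)\<^sup>2) \<le> rho_Q (- S_prim t) \<and>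
          (ereal (t / (1 + S_prim t)\<^sup>2) = rho_Q (- S_prim t) \<longleftrightarrow> t = tc)"
        by (simp only: u_def rho)
    qed
  qed (use tc y_tc[OF gd] in auto)
qed

end
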